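(* Let $(A_t,B_t)_{t\in\mathbb{Z}}$ be an iid sequence of $\mathbb{R}_+^2$-valued random vectors with generic element $(A,B)$ such that: (i) the sequences $(A_t)$ and $(B_t)$ are independent; (ii) $B$ is regularly varying with index $\alpha=2$ and $\mathrm{var}(B)=\infty$; (iii) $\mathbb{E}[A^2]<1$ and $\mathbb{E}[A^4]<\infty$; (iv) there exists $\beta>2$ such that $\mathbb{E}[A^\beta]=1$, $\mathbb{E}[A^\beta\log A]<\infty$, and the law of $\log A$ conditioned on $\{A>0\}$ is non-arithmetic. Let $(X_t)_{t\in\mathbb{Z}}$ be the strictly stationary solution to $X_t=A_tX_{t-1}+B_t$, $t\in\mathbb{Z}$, with generic element $X$, let $S_n=X_1+\cdots+X_n$, $d_n=n\,\mathbb{E}[X]=n\,\mathbb{E}[B]/(1-\mathbb{E}[A])$, and let $(a_n)$ be defined by $$n\,\mathbb{P}(|X|>a_n)+\frac{n}{a_n^2}\,\mathbb{E}\big[X^2\,\mathbf 1(|X|\le a_n)\big]=1 .$$ Assume that $(X_t)$ is strongly mixing with geometric rate and such that one can choose integer block lengths $r_n\to\infty$, $r_n/n\to 0$, for which, with $k_n=\lfloor n/r_n\rfloor$, the mixing condition $$\mathbb{E}\big[e^{iu(S_n-d_n)/a_n}\big]=\Big(\mathbb{E}\big[e^{iu(S_{r_n}-d_{r_n})/a_n}\big]\Big)^{k_n}+o(1),\qquad n\to\infty,\quad u\in\mathbb{R},$$ holds and $(n/a_n^2)\,r_n^\delta=o(1)$ as $n\to\infty$ for some $\delta\in(0,1)$.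 Then $$a_n^{-1}(S_n-d_n)\ \stackrel{d}{\to}\ N(0,c_0),\qquad n\to\infty,\qquad\text{where } c_0=\frac{1+\mathbb{E}[A]}{1-\mathbb{E}[A]} .$$
   Context: A nonnegative random variable $B$ is regularly varying with index $2$ if $\mathbb{P}(B>x)=L(x)x^{-2}$, $x>0$, for a slowly varying function $L$. The stationary solution is $X_t=\sum_{j=-\infty}^t B_j\,A_{j+1}\cdots A_t$. Here $A^\beta\log A:=0$ on $\{A=0\}$. Strongly mixing with geometric rate means that the strong mixing coefficients $(\alpha_h)_{h\ge 0}$ of $(X_t)$ satisfy $\alpha_h\le c\,\rho^h$ for some $c>0$ and $\rho\in(0,1)$. A law is non-arithmetic if it is not supported on a set of the form $d\,\mathbb{Z}$, $d>0$ (nor degenerate at $0$). The sequence $(a_n)$ is uniquely defined by its equation for all sufficiently large $n$. *)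

theory Defs
  imports "HOL-Probability.Probability"
begin

definition slowly_varying :: "(real \<Rightarrow> real) \<Rightarrow> bool" where
  "slowly_varying L \<longleftrightarrow>
     L \<in> borel_measurable (restrict_space borel {0<..}) \<and>
     (\<forall>\<^sub>F x in at_top. L x > 0) \<and>
     (\<forall>c>0. ((\<lambda>x. L (c * x) / L x) \<longlongrightarrow> 1) at_top)"

definition regularly_varying :: "'a measure \<Rightarrow> ('a \<Rightarrow> real) \<Rightarrow> real \<Rightarrow> bool" where
  "regularly_varying M Y \<alpha> \<longleftrightarrow>
     (\<exists>L. slowly_varying L \<and>
        (\<forall>x>0. measure M {\<omega> \<in> space M. Y \<omega> > x} = L x * x powr (- \<alpha>)))"

text \<open>
  The case of a law degenerate at 0 is covered, since 0 lies in every lattice.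
\<close>
definition non_arithmetic :: "real measure \<Rightarrow> bool" where
  "non_arithmetic N \<longleftrightarrow> \<not> (\<exists>d>0. AE x in N. \<exists>k::int. x = d * of_int k)"

definition strictly_stationary :: "'a measure \<Rightarrow> (int \<Rightarrow> 'a \<Rightarrow> real) \<Rightarrow> bool" where
  "strictly_stationary M X \<longleftrightarrow>
     (\<forall>t. X t \<in> borel_measurable M) \<and>
     (\<forall>h. distr M (Pi\<^sub>M UNIV (\<lambda>_::int. borel)) (\<lambda>\<omega> t. X (t + h) \<omega>) =
          distr M (Pi\<^sub>M UNIV (\<lambda>_::int. borel)) (\<lambda>\<omega> t. X t \<omega>))"

text \<open>
  For nonnegative iid pairs \<open>(A t, B t)\<close> with \<open>E[(A t)\<^sup>2] < 1\<close> and integrable \<open>B t\<close>, such an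
  \<open>X\<close> is almost surely unique, namely the sum over all \<open>j \<le> t\<close> of
  \<open>B j * A (j+1) * \<dots> * A t\<close>.
\<close>
definition stationary_solution ::
  "'a measure \<Rightarrow> (int \<Rightarrow> 'a \<Rightarrow> real) \<Rightarrow> (int \<Rightarrow> 'a \<Rightarrow> real) \<Rightarrow> (int \<Rightarrow> 'a \<Rightarrow> real) \<Rightarrow> bool" where
  "stationary_solution M A B X \<longleftrightarrow>
     strictly_stationary M X \<and>
     (\<forall>t. AE \<omega> in M. X t \<omega> = A t \<omega> * X (t - 1) \<omega> + B t \<omega>)"

definition generated_events :: "'a measure \<Rightarrow> (int \<Rightarrow> 'a \<Rightarrow> real) \<Rightarrow> int set \<Rightarrow> 'a set set" where
  "generated_events M X T =
     sigma_sets (space M) {X t -` U \<inter> space M | t U. t \<in> T \<and> U \<in> sets borel}"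

text \<open>
  The time origin is fixed at 0, so this is the strong mixing coefficient of strictly stationary
  sequences only.
\<close>
definition strong_mixing_coeff :: "'a measure \<Rightarrow> (int \<Rightarrow> 'a \<Rightarrow> real) \<Rightarrow> nat \<Rightarrow> real" where
  "strong_mixing_coeff M X h =
     (SUP (E, F) \<in> generated_events M X {..0} \<times> generated_events M X {int h..}.
        \<bar>measure M (E \<inter> F) - measure M E * measure M F\<bar>)"

definition strongly_mixing_geometric :: "'a measure \<Rightarrow> (int \<Rightarrow> 'a \<Rightarrow> real) \<Rightarrow> bool" where
  "strongly_mixing_geometric M X \<longleftrightarrow>
     (\<exists>c>0. \<exists>\<rho>\<in>{0<..<1}. \<forall>h. strong_mixing_coeff M X h \<le> c * \<rho> ^ h)"

definition partial_sum :: "(int \<Rightarrow> 'a \<Rightarrow> real) \<Rightarrow> nat \<Rightarrow> 'a \<Rightarrow> real" where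
  "partial_sum X n \<omega> = (\<Sum>t=1..n. X (int t) \<omega>)"

definition centering :: "'a measure \<Rightarrow> (int \<Rightarrow> 'a \<Rightarrow> real) \<Rightarrow> nat \<Rightarrow> real" where
  "centering M X n = real n * integral\<^sup>L M (X 0)"

text \<open>
  The defining equation has a (unique) solution only for sufficiently large \<open>n\<close>; the other
  values of \<open>a\<close> are arbitrary.
\<close>
definition normalizing_sequence :: "'a measure \<Rightarrow> ('a \<Rightarrow> real) \<Rightarrow> (nat \<Rightarrow> real) \<Rightarrow> bool" where
  "normalizing_sequence M Y a \<longleftrightarrow>
     (\<forall>\<^sub>F n in sequentially. a n > 0 \<and>
        real n * measure M {\<omega> \<in> space M. \<bar>Y \<omega>\<bar> > a n} +
        real n / (a n)\<^sup>2 *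
          (\<integral>\<omega>. (Y \<omega>)\<^sup>2 * indicator {\<omega> \<in> space M. \<bar>Y \<omega>\<bar> \<le> a n} \<omega> \<partial>M) = 1)"

end

theory Submission
  imports Defs
begin

text \<open>
  Write \<open>\<mu> = E A\<close>, \<open>\<rho> = E A\<^sup>2\<close>, \<open>\<mu>\<^sub>B = E B\<close> and \<open>m = E X\<close>. The recursion shows that
  \<open>D t = X t - \<mu> X (t-1) - \<mu>\<^sub>B = (A t - \<mu>) X (t-1) + (B t - \<mu>\<^sub>B)\<close> are martingale differences, and summing
  them gives \<open>(1 - \<mu>) (S\<^sub>n - n m) = M\<^sub>n - \<mu> (X n - X 0)\<close> with \<open>M\<^sub>n = D 1 + \<dots> + D n\<close>. So the theorem
  says that \<open>M\<^sub>n / a\<^sub>n\<close> converges to \<open>N(0, 1 - \<mu>\<^sup>2)\<close>. The increments have infinite variance, and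
  the whole argument is a comparison of truncated second moments.

  The yardstick is \<open>H\<^sub>Y(l) = E min((l Y)\<^sup>2, \<bar>l Y\<bar>)\<close> as \<open>l\<close> decreases to 0. If the part of \<open>l Y\<close> above 1
  has expectation \<open>o(H\<^sub>Y(l))\<close>, which for an infinite second moment characterizes the domain of
  attraction of the normal law, then
  \<open>E f(l Y) / H\<^sub>Y(l)\<close> converges to \<open>lim f(y) / y\<^sup>2\<close> for every \<open>f\<close> that is quadratic at 0 and grows at
  most linearly (\<open>gaussian_domain_integral\<close>). This one fact yields every asymptotic constant below:
  those of Laplace transforms, of characteristic functions and of the normalizing equation, which
  reads \<open>n E min(1, X / a\<^sub>n)\<^sup>2 = 1\<close> and hence means \<open>n H\<^sub>X(1 / a\<^sub>n) \<longrightarrow> 1\<close>.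

  For \<open>B\<close> the tail condition follows from regular variation by splitting the range dyadically. It is
  transferred to \<open>X\<close> through \<open>W(l) = E (exp (- l X) - 1 + l X)\<close>, for which the recursion becomes the linear
  equation \<open>W(l) = E W(l A) + H\<^sub>B(l) / 2 + o(H\<^sub>B(l))\<close>. The operator \<open>W \<mapsto> E W(\<cdot> A)\<close> multiplies \<open>l\<close> by \<open>\<mu> < 1\<close> and
  \<open>l\<^sup>2\<close> by \<open>\<rho> < 1\<close>, so it is a contraction on functions dominated by \<open>l + l\<^sup>2\<close>, and the equation is solved
  by \<open>W \<sim> H\<^sub>B / (2 (1 - \<rho>))\<close> (\<open>W_limit\<close>). Consequently \<open>X\<close> is in the same domain and
  \<open>H\<^sub>B / H\<^sub>X \<longrightarrow> 1 - \<rho>\<close>.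

  Conditionally on the past, \<open>exp (i v D t)\<close> has expectation \<open>cA (v X (t-1)) cB v\<close>, where \<open>cA\<close> and \<open>cB\<close> are the
  characteristic functions of \<open>A - \<mu>\<close> and \<open>B - \<mu>\<^sub>B\<close>. The core of the proof (\<open>decoupling\<close>) is that
  \<open>cA (v X (t-1)) - 1\<close> and \<open>exp (i v M\<^bsub>t-1\<^esub>)\<close> are uncorrelated up to \<open>o(1/n)\<close> when \<open>v = u / a\<^sub>n\<close>, uniformly
  in \<open>t\<close>. Two effects combine: the last \<open>q\<close> increments are negligible because they are \<open>o(a\<^sub>n)\<close> even under
  the truncated second moment of \<open>X (t-1)\<close>, and \<open>X (t-1)\<close> depends on what happened more than \<open>q\<close> steps
  ago only through a factor of order \<open>\<mu>\<^sup>q + \<rho>\<^sup>q\<close>. Therefore the characteristic function of \<open>M\<^sub>t\<close> at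
  \<open>u / a\<^sub>n\<close> gains in each step the same factor \<open>1 - u\<^sup>2 (1 - \<mu>\<^sup>2) / (2 n) + o(1/n)\<close>; here
  \<open>1 - \<mu>\<^sup>2 = (\<rho> - \<mu>\<^sup>2) + (1 - \<rho>)\<close> adds up the contributions of \<open>(A - \<mu>) X\<close> and of \<open>B - \<mu>\<^sub>B\<close>. After \<open>n\<close>
  steps the product is \<open>exp (- u\<^sup>2 (1 - \<mu>\<^sup>2) / 2)\<close>, and Levy's continuity theorem concludes.
\<close>

section \<open>Truncated second moments\<close>

text \<open>
  The truncation continues the square linearly instead of by a constant: linear growth absorbs
  the expectation of the tail, and the function obeys the scaling bound
  \<open>trunc_sq (p * y) \<le> (p + p\<^sup>2) * trunc_sq y\<close> that replaces Potter's bounds for slowly varying functions.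
\<close>

definition trunc_sq :: "real \<Rightarrow> real" where
  "trunc_sq y = min (y\<^sup>2) \<bar>y\<bar>"

lemma trunc_sq_nonneg [simp]: "0 \<le> trunc_sq y"
  by (simp add: trunc_sq_def)

lemma trunc_sq_0 [simp]: "trunc_sq 0 = 0"
  by (simp add: trunc_sq_def)

lemma trunc_sq_le_abs: "trunc_sq y \<le> \<bar>y\<bar>"
  by (simp add: trunc_sq_def)

lemma trunc_sq_le_sq: "trunc_sq y \<le> y\<^sup>2"
  by (simp add: trunc_sq_def)

lemma trunc_sq_small: "\<bar>y\<bar> \<le> 1 \<Longrightarrow> trunc_sq y = y\<^sup>2"
  using mult_left_le[of "\<bar>y\<bar>" "\<bar>y\<bar>"] by (simp add: trunc_sq_def power2_eq_square)

lemma trunc_sq_large: "1 \<le> \<bar>y\<bar> \<Longrightarrow> trunc_sq y = \<bar>y\<bar>"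
  using mult_right_mono[of 1 "\<bar>y\<bar>" "\<bar>y\<bar>"] by (simp add: trunc_sq_def power2_eq_square)

lemma trunc_sq_eq: "0 \<le> y \<Longrightarrow> trunc_sq y = y * min 1 y"
  by (cases "y \<le> 1") (auto simp: trunc_sq_small trunc_sq_large power2_eq_square)

lemma trunc_sq_mono: "\<bar>x\<bar> \<le> \<bar>y\<bar> \<Longrightarrow> trunc_sq x \<le> trunc_sq y"
  unfolding trunc_sq_def by (intro min.mono) (auto simp: abs_le_square_iff)

lemma trunc_sq_scale:
  assumes "0 \<le> p" shows "trunc_sq (p * y) \<le> (p + p\<^sup>2) * trunc_sq y"
proof -
  have "trunc_sq (p * y) \<le> p\<^sup>2 * y\<^sup>2" "trunc_sq (p * y) \<le> p * \<bar>y\<bar>"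
    using assms trunc_sq_le_sq[of "p*y"] trunc_sq_le_abs[of "p*y"]
    by (auto simp: power_mult_distrib abs_mult)
  moreover have "p\<^sup>2 * y\<^sup>2 \<le> (p + p\<^sup>2) * y\<^sup>2" "p * \<bar>y\<bar> \<le> (p + p\<^sup>2) * \<bar>y\<bar>"
    using assms by (auto intro!: mult_right_mono)
  ultimately show ?thesis
    unfolding trunc_sq_def[of y] by (auto simp: min_def)
qed

lemma trunc_sq_add: "trunc_sq (x + y) \<le> 4 * trunc_sq x + 4 * trunc_sq y"
proof -
  have *: "trunc_sq (2 * z) \<le> 4 * trunc_sq z" for z
    by (auto simp: trunc_sq_def min_def power_mult_distrib abs_mult)
  show ?thesis
  proof (cases "\<bar>x\<bar> \<le> \<bar>y\<bar>")
    case True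
    then have "trunc_sq (x + y) \<le> trunc_sq (2 * y)" by (intro trunc_sq_mono) auto
    with *[of y] show ?thesis using trunc_sq_nonneg[of x] by linarith
  next
    case False
    then have "trunc_sq (x + y) \<le> trunc_sq (2 * x)" by (intro trunc_sq_mono) auto
    with *[of x] show ?thesis using trunc_sq_nonneg[of y] by linarith
  qed
qed

lemma trunc_sq_measurable [measurable]: "trunc_sq \<in> borel_measurable borel"
  unfolding trunc_sq_def[abs_def] by measurable

definition trunc_moment :: "'a measure \<Rightarrow> ('a \<Rightarrow> real) \<Rightarrow> real \<Rightarrow> real" where
  "trunc_moment M Y l = (\<integral>w. trunc_sq (l * Y w) \<partial>M)"

text \<open>
  For a law with infinite second moment this is the domain of attraction of the normal law. The
  usual criterion asks that \<open>x\<^sup>2 P(Y > x)\<close> be negligible against \<open>E(Y\<^sup>2; Y \<le> x)\<close>; with \<open>l = 1 / x\<close> the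
  integrated form of the tail is the one that is used throughout.
\<close>

definition gaussian_domain :: "'a measure \<Rightarrow> ('a \<Rightarrow> real) \<Rightarrow> bool" where
  "gaussian_domain M Y \<longleftrightarrow>
     integrable M Y \<and> (\<forall>w\<in>space M. 0 \<le> Y w) \<and>
     (\<forall>\<^sub>F l in at_right 0. 0 < trunc_moment M Y l) \<and>
     ((\<lambda>l. (\<integral>w. (if 1 < l * Y w then l * Y w else 0) \<partial>M) / trunc_moment M Y l)
        \<longlongrightarrow> 0) (at_right 0)"

lemma integrable_trunc_sq:
  assumes "integrable M Y" shows "integrable M (\<lambda>w. trunc_sq (l * Y w))"
proof (rule Bochner_Integration.integrable_bound)
  show "integrable M (\<lambda>w. l * Y w)" using assms by auto
  have [measurable]: "Y \<in> borel_measurable M" using assms by auto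
  show "(\<lambda>w. trunc_sq (l * Y w)) \<in> borel_measurable M" by measurable
qed (auto intro: order_trans[OF trunc_sq_le_abs])

lemma integrable_dominated_trunc_sq:
  fixes f :: "real \<Rightarrow> 'b::{banach, second_countable_topology}"
  assumes "integrable M Y" "\<forall>w\<in>space M. 0 \<le> Y w" "f \<in> borel_measurable borel" "0 \<le> l"
    and "\<And>y. 0 \<le> y \<Longrightarrow> norm (f y) \<le> C * trunc_sq y"
  shows "integrable M (\<lambda>w. f (l * Y w))"
proof (rule Bochner_Integration.integrable_bound)
  show "integrable M (\<lambda>w. C * trunc_sq (l * Y w))"
    using integrable_trunc_sq[OF assms(1)] by auto
  have [measurable]: "Y \<in> borel_measurable M" "f \<in> borel_measurable borel" using assms by auto
  show "(\<lambda>w. f (l * Y w)) \<in> borel_measurable M" by measurable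
  have "norm (f (l * Y w)) \<le> norm (C * trunc_sq (l * Y w))" if "w \<in> space M" for w
    using assms(5)[of "l * Y w"] assms(2,4) that by (auto intro: order_trans[OF _ abs_ge_self])
  then show "AE w in M. norm (f (l * Y w)) \<le> norm (C * trunc_sq (l * Y w))" by auto
qed

lemma trunc_moment_nonneg [simp]: "0 \<le> trunc_moment M Y l"
  by (simp add: trunc_moment_def)

lemma trunc_moment_le_linear:
  assumes "integrable M Y" "\<And>w. w \<in> space M \<Longrightarrow> 0 \<le> Y w" "0 \<le> x"
  shows "trunc_moment M Y x \<le> x * (\<integral>w. Y w \<partial>M)"
proof -
  have "trunc_moment M Y x \<le> (\<integral>w. x * Y w \<partial>M)"
    unfolding trunc_moment_def
  proof (rule integral_mono[OF integrable_trunc_sq])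
    fix w assume "w \<in> space M"
    then show "trunc_sq (x * Y w) \<le> x * Y w"
      using trunc_sq_le_abs[of "x * Y w"] assms by (simp add: abs_mult)
  qed (use assms in auto)
  then show ?thesis by simp
qed

lemma trunc_moment_scale:
  assumes "integrable M Y" "0 \<le> p"
  shows "trunc_moment M Y (p * l) \<le> (p + p\<^sup>2) * trunc_moment M Y l"
proof -
  have "trunc_moment M Y (p * l) \<le> (\<integral>w. (p + p\<^sup>2) * trunc_sq (l * Y w) \<partial>M)"
    unfolding trunc_moment_def using trunc_sq_scale[OF assms(2)]
    by (intro integral_mono integrable_trunc_sq assms integrable_mult_right) (auto simp: mult.assoc)
  then show ?thesis by (simp add: trunc_moment_def)
qed

lemma at_right_0_scale:
  fixes P :: "real \<Rightarrow> bool"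
  assumes "eventually P (at_right 0)" "0 < c"
  shows "\<forall>\<^sub>F l in at_right 0. P (c * l)"
proof -
  have "filterlim (\<lambda>l. c * l) (at_right 0) (at_right (0::real))"
    unfolding filterlim_at using assms(2)
    by (auto simp: eventually_at_filter zero_less_mult_iff intro!: tendsto_eq_intros)
  then show ?thesis using assms(1) by (auto simp: filterlim_iff)
qed

text \<open>
  Rescaling \<open>l\<close> by \<open>1 / \<eta>\<close> changes the truncated moment by a bounded factor only, so the threshold 1
  in the definition can be replaced by any other one.
\<close>

lemma gaussian_domain_tail:
  assumes Y: "gaussian_domain M Y" and "0 < \<eta>" "\<eta> \<le> 1" "0 < \<epsilon>"
  shows "\<forall>\<^sub>F l in at_right 0.
    (\<integral>w. (if \<eta> < l * Y w then l * Y w else 0) \<partial>M) \<le> \<epsilon> * trunc_moment M Y l"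
proof -
  let ?H = "trunc_moment M Y"
  let ?T = "\<lambda>l. \<integral>w. (if 1 < l * Y w then l * Y w else 0) \<partial>M"
  have Yi: "integrable M Y" using Y by (auto simp: gaussian_domain_def)
  have pos: "\<forall>\<^sub>F l in at_right 0. 0 < ?H l"
    using Y by (auto simp: gaussian_domain_def)
  have "((\<lambda>l. ?T l / ?H l) \<longlongrightarrow> 0) (at_right 0)"
    using Y by (auto simp: gaussian_domain_def)
  then have "\<forall>\<^sub>F l in at_right 0. ?T l / ?H l < \<epsilon> / 2 * \<eta>"
    using assms by (intro order_tendstoD) auto
  with pos have "\<forall>\<^sub>F l in at_right 0. ?T l \<le> \<epsilon> / 2 * \<eta> * ?H l"
    by eventually_elim (auto simp: field_simps)
  then have "\<forall>\<^sub>F l in at_right 0. ?T ((1 / \<eta>) * l) \<le> \<epsilon> / 2 * \<eta> * ?H ((1 / \<eta>) * l)"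
    by (rule at_right_0_scale) (use assms in auto)
  then show ?thesis
  proof eventually_elim
    case (elim l)
    have "(\<lambda>w. if \<eta> < l * Y w then l * Y w else 0)
        = (\<lambda>w. \<eta> * (if 1 < 1 / \<eta> * l * Y w then 1 / \<eta> * l * Y w else 0))"
      using assms by (auto simp: fun_eq_iff field_simps)
    then have "(\<integral>w. (if \<eta> < l * Y w then l * Y w else 0) \<partial>M) = \<eta> * ?T (1 / \<eta> * l)"
      by simp
    also have "\<dots> \<le> \<eta> * (\<epsilon> / 2 * \<eta> * ?H ((1 / \<eta>) * l))"
      using elim assms by (intro mult_left_mono) auto
    also have "\<dots> \<le> \<eta> * (\<epsilon> / 2 * \<eta> * ((1 / \<eta> + (1 / \<eta>)\<^sup>2) * ?H l))"
      using assms by (intro mult_left_mono trunc_moment_scale Yi) auto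
    also have "\<dots> = \<epsilon> / 2 * (\<eta> + 1) * ?H l"
      using assms by (simp add: field_simps power2_eq_square)
    also have "\<dots> \<le> \<epsilon> * ?H l"
      using assms by (intro mult_right_mono) auto
    finally show ?case .
  qed
qed

lemma dist_scaleR_inverse_less:
  fixes x k :: "'b::real_normed_vector"
  assumes "0 < h" "norm (x - h *\<^sub>R k) < e * h"
  shows "dist (x /\<^sub>R h) k < e"
proof -
  have "x /\<^sub>R h - k = (x - h *\<^sub>R k) /\<^sub>R h"
    using assms by (simp only: scaleR_diff_right) simp
  then have "dist (x /\<^sub>R h) k = norm (x - h *\<^sub>R k) / h"
    using assms by (simp only: dist_norm norm_scaleR) (simp add: divide_inverse mult.commute)
  with assms show ?thesis by (simp add: divide_less_eq)
qed

text \<open>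
  Subtracting \<open>k * trunc_sq\<close> from \<open>f\<close> leaves a function that is \<open>o(y\<^sup>2)\<close> at 0 and \<open>O(y)\<close> at infinity.
  Below a small threshold it is a small multiple of \<open>trunc_sq\<close>, and above the threshold its
  expectation is negligible.
\<close>

lemma gaussian_domain_integral:
  fixes f :: "real \<Rightarrow> 'b::{banach, second_countable_topology}"
  assumes Y: "gaussian_domain M Y" and f [measurable]: "f \<in> borel_measurable borel"
    and small: "((\<lambda>y. f y /\<^sub>R y\<^sup>2) \<longlongrightarrow> k) (at_right 0)"
    and bound: "\<And>y. 0 \<le> y \<Longrightarrow> norm (f y) \<le> C * trunc_sq y"
  shows "((\<lambda>l. (\<integral>w. f (l * Y w) \<partial>M) /\<^sub>R trunc_moment M Y l) \<longlongrightarrow> k) (at_right 0)"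
proof (rule tendstoI)
  fix e :: real assume e: "0 < e"
  let ?H = "trunc_moment M Y"
  have Yi: "integrable M Y" and Y0: "\<forall>w\<in>space M. 0 \<le> Y w"
    and pos: "\<forall>\<^sub>F l in at_right 0. 0 < ?H l"
    using Y by (auto simp: gaussian_domain_def)
  have Ym [measurable]: "Y \<in> borel_measurable M" using Yi by auto
  have "\<forall>\<^sub>F y in at_right 0. dist (f y /\<^sub>R y\<^sup>2) k < e / 3"
    using tendstoD[OF small, of "e/3"] e by simp
  then obtain d where d: "0 < d" "\<And>y. 0 < y \<Longrightarrow> y < d \<Longrightarrow> dist (f y /\<^sub>R y\<^sup>2) k < e / 3"
    unfolding eventually_at_right_field by auto
  define \<eta> where "\<eta> = min 1 (d / 2)"
  have \<eta>: "0 < \<eta>" "\<eta> \<le> 1" "\<eta> < d" using d by (auto simp: \<eta>_def min_def)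
  have f0: "f 0 = 0" using bound[of 0] by simp
  define C' where "C' = \<bar>C\<bar> + norm k + 1"
  have C': "0 < C'" by (simp add: C'_def add_nonneg_pos)
  define g where "g y = f y - trunc_sq y *\<^sub>R k" for y
  have gm [measurable]: "g \<in> borel_measurable borel" unfolding g_def[abs_def] by measurable
  have g_bound: "norm (g y) \<le> C' * trunc_sq y" if "0 \<le> y" for y
  proof -
    have "norm (g y) \<le> norm (f y) + trunc_sq y * norm k"
      unfolding g_def using norm_triangle_ineq4[of "f y" "trunc_sq y *\<^sub>R k"] by simp
    also have "\<dots> \<le> \<bar>C\<bar> * trunc_sq y + trunc_sq y * norm k"
      using bound[OF that] mult_right_mono[OF abs_ge_self[of C] trunc_sq_nonneg[of y]] by linarith
    also have "\<dots> \<le> C' * trunc_sq y" by (simp add: C'_def algebra_simps)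
    finally show ?thesis .
  qed
  have g_small: "norm (g y) \<le> e / 3 * trunc_sq y" if "0 \<le> y" "y \<le> \<eta>" for y
  proof (cases "y = 0")
    case True then show ?thesis by (simp add: g_def f0)
  next
    case False
    then have y: "0 < y" "y < d" using that \<eta> by auto
    have "f y - y\<^sup>2 *\<^sub>R k = y\<^sup>2 *\<^sub>R (f y /\<^sub>R y\<^sup>2 - k)" using y by (simp add: algebra_simps)
    then have "norm (f y - y\<^sup>2 *\<^sub>R k) = y\<^sup>2 * dist (f y /\<^sub>R y\<^sup>2) k"
      by (simp add: dist_norm)
    also have "\<dots> \<le> y\<^sup>2 * (e / 3)" using d(2)[OF y] by (intro mult_left_mono) auto
    finally show ?thesis using that \<eta> by (simp add: g_def trunc_sq_small mult.commute)
  qed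
  have g_all: "norm (g y) \<le> e / 3 * trunc_sq y + C' * (if \<eta> < y then y else 0)" if "0 \<le> y" for y
  proof (cases "y \<le> \<eta>")
    case True with g_small[OF that True] show ?thesis by simp
  next
    case False
    have "norm (g y) \<le> C' * trunc_sq y" by (rule g_bound[OF that])
    also have "\<dots> \<le> C' * y" using trunc_sq_le_abs[of y] that C' by (intro mult_left_mono) auto
    finally show ?thesis using False e by (simp add: add_increasing)
  qed
  have "\<forall>\<^sub>F l in at_right 0.
      (\<integral>w. (if \<eta> < l * Y w then l * Y w else 0) \<partial>M) \<le> e / (3 * C') * ?H l"
    using e C' \<eta> by (intro gaussian_domain_tail[OF Y]) auto
  moreover have "\<forall>\<^sub>F l in at_right (0::real). 0 < l" by (simp add: eventually_at_right_less)
  ultimately show "\<forall>\<^sub>F l in at_right 0. dist ((\<integral>w. f (l * Y w) \<partial>M) /\<^sub>R ?H l) k < e"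
    using pos
  proof eventually_elim
    case (elim l)
    let ?T = "\<lambda>w. if \<eta> < l * Y w then l * Y w else 0"
    have lY: "0 \<le> l * Y w" if "w \<in> space M" for w using Y0 elim that by auto
    have int_f: "integrable M (\<lambda>w. f (l * Y w))"
      using elim by (intro integrable_dominated_trunc_sq[OF Yi Y0 f _ bound]) auto
    have int_g: "integrable M (\<lambda>w. g (l * Y w))"
      using elim by (intro integrable_dominated_trunc_sq[OF Yi Y0 gm _ g_bound]) auto
    have int_h: "integrable M (\<lambda>w. trunc_sq (l * Y w))" by (rule integrable_trunc_sq[OF Yi])
    have int_T: "integrable M ?T"
      by (rule Bochner_Integration.integrable_bound[of M "\<lambda>w. l * Y w"]) (use Yi in auto)
    have "(\<integral>w. g (l * Y w) \<partial>M) = (\<integral>w. f (l * Y w) \<partial>M) - ?H l *\<^sub>R k"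
      unfolding g_def trunc_moment_def using int_f int_h
      by (subst Bochner_Integration.integral_diff) auto
    then have "norm ((\<integral>w. f (l * Y w) \<partial>M) - ?H l *\<^sub>R k) \<le> (\<integral>w. norm (g (l * Y w)) \<partial>M)"
      using integral_norm_bound[of M "\<lambda>w. g (l * Y w)"] by simp
    also have "\<dots> \<le> (\<integral>w. e / 3 * trunc_sq (l * Y w) + C' * ?T w \<partial>M)"
      using int_g int_h int_T g_all lY by (intro integral_mono) auto
    also have "\<dots> = e / 3 * ?H l + C' * (\<integral>w. ?T w \<partial>M)"
      using int_h int_T by (simp add: trunc_moment_def)
    also have "\<dots> \<le> e / 3 * ?H l + C' * (e / (3 * C') * ?H l)"
      using elim C' by (intro add_left_mono mult_left_mono) auto
    also have "\<dots> = 2 * e / 3 * ?H l" using C' by (simp add: field_simps)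
    also have "\<dots> < e * ?H l" using e elim by auto
    finally have *: "norm ((\<integral>w. f (l * Y w) \<partial>M) - ?H l *\<^sub>R k) < e * ?H l" .
    then show ?case using elim by (intro dist_scaleR_inverse_less)
  qed
qed

section \<open>Regularly varying tails of index two\<close>

lemma integrable_of_bounded_increasing:
  fixes f :: "nat \<Rightarrow> 'a \<Rightarrow> real"
  assumes int: "\<And>i. integrable M (f i)" and mono: "\<And>i j w. w \<in> space M \<Longrightarrow> i \<le> j \<Longrightarrow> f i w \<le> f j w"
    and nonneg: "\<And>i w. w \<in> space M \<Longrightarrow> 0 \<le> f i w"
    and lim: "\<And>w. w \<in> space M \<Longrightarrow> \<forall>\<^sub>F i in sequentially. f i w = u w"
    and bound: "\<And>i. (\<integral>w. f i w \<partial>M) \<le> c"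
    and [measurable]: "u \<in> borel_measurable M"
  shows "integrable M u \<and> (\<integral>w. u w \<partial>M) \<le> c"
proof -
  have "incseq (\<lambda>i. \<integral>w. f i w \<partial>M)"
    using int mono by (auto intro!: incseq_SucI integral_mono)
  then obtain L where L: "(\<lambda>i. \<integral>w. f i w \<partial>M) \<longlonglongrightarrow> L"
    using bound by (meson incseq_convergent)
  have lim': "AE w in M. (\<lambda>i. f i w) \<longlonglongrightarrow> u w"
    using lim by (auto intro!: AE_I2 tendsto_eventually)
  have m: "AE w in M. mono (\<lambda>i. f i w)" using mono by (auto intro!: AE_I2 monoI)
  have n: "AE w in M. 0 \<le> f i w" for i using nonneg by auto
  have "integrable M u" "integral\<^sup>L M u = L"
    using integrable_monotone_convergence[OF int m lim' L] integral_monotone_convergence[OF int m lim' L]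
    by auto
  moreover have "L \<le> c" using L bound by (intro LIMSEQ_le_const2) auto
  ultimately show ?thesis by simp
qed

lemma eventually_at_right_0_iff_inverse:
  "eventually P (at_right (0::real)) \<longleftrightarrow> eventually (\<lambda>x. P (1 / x)) at_top"
  by (simp add: eventually_at_right_to_top inverse_eq_divide)

text \<open>
  Each doubling of the threshold divides the tail by 3 at least, hence the contribution of
  \<open>(2\<^sup>k x, 2\<^sup>k\<^sup>+\<^sup>1 x]\<close> to the expectation decays like \<open>(2/3)\<^sup>k\<close>, and \<open>6 = 2 / (1 - 2/3)\<close>.
\<close>

lemma (in prob_space) tail_expectation_le:
  fixes Y :: "'a \<Rightarrow> real"
  defines "T \<equiv> \<lambda>x. prob {w\<in>space M. x < Y w}"
  assumes [measurable]: "random_variable borel Y" and Y0: "\<And>w. w \<in> space M \<Longrightarrow> 0 \<le> Y w"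
    and x0: "0 < x0" "\<And>x. x0 \<le> x \<Longrightarrow> 3 * T (2 * x) \<le> T x"
    and x: "x0 \<le> x"
  shows "integrable M (\<lambda>w. if x < Y w then Y w else 0)"
    and "(\<integral>w. (if x < Y w then Y w else 0) \<partial>M) \<le> 6 * x * T x"
proof -
  let ?f = "\<lambda>x N w. if x < Y w \<and> Y w \<le> 2 ^ N * x then Y w else 0"
  have int: "integrable M (?f x N)" for x N
    by (rule integrable_const_bound[where B="\<bar>2 ^ N * x\<bar>"]) (auto intro!: AE_I2 dest: Y0)
  have intI: "integrable M (\<lambda>w. indicator {w\<in>space M. x < Y w} w :: real)" for x
    by (rule integrable_const_bound[where B=1]) (auto simp: indicator_def)
  have *: "(\<integral>w. ?f x N w \<partial>M) \<le> 6 * x * T x" if "x0 \<le> x" for x N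
    using that
  proof (induction N arbitrary: x)
    case 0
    then have "(\<integral>w. ?f x 0 w \<partial>M) = 0" by (auto intro!: integral_eq_zero_AE)
    then show ?case using 0 x0 by (simp add: T_def)
  next
    case (Suc N)
    have "x0 \<le> 2 * x" using Suc x0 by auto
    note IH = Suc.IH[OF this]
    have "(\<integral>w. ?f x (Suc N) w \<partial>M)
        \<le> (\<integral>w. 2 * x * indicator {w\<in>space M. x < Y w} w + ?f (2 * x) N w \<partial>M)"
    proof (rule integral_mono)
      show "integrable M (?f x (Suc N))" by (rule int)
      show "integrable M (\<lambda>w. 2 * x * indicator {w\<in>space M. x < Y w} w + ?f (2 * x) N w)"
        by (intro Bochner_Integration.integrable_add integrable_mult_right int intI)
      fix w assume "w \<in> space M"
      then show "?f x (Suc N) w \<le> 2 * x * indicator {w\<in>space M. x < Y w} w + ?f (2 * x) N w"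
        using Y0[of w] Suc.prems x0(1) by (auto simp: indicator_def ac_simps)
    qed
    also have "\<dots> = 2 * x * T x + (\<integral>w. ?f (2 * x) N w \<partial>M)"
      using intI[of x] by (subst Bochner_Integration.integral_add) (auto intro!: int simp: T_def)
    also have "\<dots> \<le> 2 * x * T x + 6 * (2 * x) * T (2 * x)"
      using IH by auto
    also have "\<dots> \<le> 2 * x * T x + 4 * x * T x"
      using mult_left_mono[OF x0(2)[OF Suc.prems], of "4 * x"] Suc.prems x0 by simp
    finally show ?case by (simp add: algebra_simps)
  qed
  have "integrable M (\<lambda>w. if x < Y w then Y w else 0)
    \<and> (\<integral>w. (if x < Y w then Y w else 0) \<partial>M) \<le> 6 * x * T x"
  proof (rule integrable_of_bounded_increasing[where f="?f x"])
    fix i j w assume "i \<le> (j::nat)" and w: "w \<in> space M"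
    then have "2 ^ i * x \<le> 2 ^ j * x"
      using x0 x by (intro mult_right_mono power_increasing) auto
    then show "?f x i w \<le> ?f x j w" using Y0[OF w] by auto
  next
    fix w assume "w \<in> space M"
    have "\<forall>\<^sub>F N in sequentially. Y w / x < 2 ^ N"
      using filterlim_realpow_sequentially_gt1[of "2::real"]
      by (auto simp: filterlim_at_infinity_imp_norm_at_top filterlim_at_top_dense
          dest!: filterlim_at_infinity_imp_norm_at_top)
    then show "\<forall>\<^sub>F N in sequentially. ?f x N w = (if x < Y w then Y w else 0)"
      by eventually_elim (use x0 x in \<open>auto simp: field_simps\<close>)
  qed (use * x int Y0 in auto)
  then show "integrable M (\<lambda>w. if x < Y w then Y w else 0)"
    "(\<integral>w. (if x < Y w then Y w else 0) \<partial>M) \<le> 6 * x * T x" by auto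
qed

text \<open>
  With \<open>T(x) = P(Y > x)\<close> and \<open>L(x) = x\<^sup>2 T(x)\<close>, the tail expectation is at most \<open>6 x T(x)\<close>, whereas every
  dyadic block \<open>(x 2\<^sup>-\<^sup>k, x 2\<^sup>1\<^sup>-\<^sup>k]\<close> adds an amount of order \<open>L(x 2\<^sup>1\<^sup>-\<^sup>k)\<close>, which is close to \<open>L(x)\<close>, to the truncated
  second moment. As the number of blocks is arbitrary, that moment outgrows \<open>L(x)\<close>.
\<close>

lemma (in prob_space) gaussian_domain_of_regularly_varying:
  assumes [measurable]: "random_variable borel Y" and Y0: "\<And>w. w \<in> space M \<Longrightarrow> 0 \<le> Y w"
    and rv: "regularly_varying M Y 2"
  shows "gaussian_domain M Y"
proof -
  define T where "T x = prob {w\<in>space M. x < Y w}" for x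
  obtain L where L: "slowly_varying L" and TL: "\<And>x. x > 0 \<Longrightarrow> T x = L x * x powr (-2)"
    using rv unfolding regularly_varying_def T_def by auto
  have LT: "L x = x\<^sup>2 * T x" if "0 < x" for x
    using TL[OF that] that by (simp add: powr_minus powr_numeral)
  have Lpos: "\<forall>\<^sub>F x in at_top. 0 < L x"
    and Lscale: "\<And>c. 0 < c \<Longrightarrow> ((\<lambda>x. L (c * x) / L x) \<longlongrightarrow> 1) at_top"
    using L by (auto simp: slowly_varying_def)
  have big: "\<forall>\<^sub>F x in at_top. (0::real) < x" by (rule eventually_gt_at_top)
  have "\<forall>\<^sub>F x in at_top. L (2 * x) / L x < 4 / 3"
    using Lscale[of 2] by (intro order_tendstoD) auto
  with Lpos big have "\<forall>\<^sub>F x in at_top. 3 * T (2 * x) \<le> T x"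
  proof eventually_elim
    case (elim x)
    then have "L (2 * x) \<le> 4 / 3 * L x" by (simp add: field_simps)
    then have "x\<^sup>2 * (3 * T (2 * x)) \<le> x\<^sup>2 * T x"
      using LT[of x] LT[of "2 * x"] elim by (simp add: power_mult_distrib)
    then show ?case using elim by (simp add: mult_le_cancel_left_pos)
  qed
  with big obtain x0 where x0: "0 < x0" and T3: "\<And>x. x0 \<le> x \<Longrightarrow> 3 * T (2 * x) \<le> T x"
    unfolding eventually_at_top_linorder by (metis max.bounded_iff max.cobounded1 max.cobounded2)
  have tail: "integrable M (\<lambda>w. if x < Y w then Y w else 0)"
    "(\<integral>w. (if x < Y w then Y w else 0) \<partial>M) \<le> 6 * x * T x" if "x0 \<le> x" for x
    using tail_expectation_le[of Y x0 x] x0 T3 Y0 that by (auto simp: T_def)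
  have Yi: "integrable M Y"
  proof (rule Bochner_Integration.integrable_bound)
    show "integrable M (\<lambda>w. (if x0 < Y w then Y w else 0) + x0)"
      using tail(1)[of x0] by auto
  qed (use Y0 x0 in \<open>auto intro!: AE_I2 dest: Y0\<close>)
  define K where "K x = (\<integral>w. (if Y w \<le> x then (Y w)\<^sup>2 else 0) \<partial>M)" for x
  have Kint: "integrable M (\<lambda>w. if Y w \<le> x then (Y w)\<^sup>2 else 0)" for x
    by (rule integrable_const_bound[where B="x\<^sup>2"]) (auto intro!: AE_I2 power_mono dest: Y0)
  have intI: "integrable M (\<lambda>w. indicator {w\<in>space M. x < Y w} w :: real)" for x
    by (rule integrable_const_bound[where B=1]) (auto simp: indicator_def)
  have K_half: "K (x / 2) + x\<^sup>2 / 4 * (T (x / 2) - T x) \<le> K x" if "0 < x" for x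
  proof -
    have "K (x / 2) + x\<^sup>2 / 4 * (T (x / 2) - T x)
      = (\<integral>w. (if Y w \<le> x / 2 then (Y w)\<^sup>2 else 0) + x\<^sup>2 / 4 *
         (indicator {w\<in>space M. x / 2 < Y w} w - indicator {w\<in>space M. x < Y w} w) \<partial>M)"
    proof -
      have "K y + x\<^sup>2 / 4 * (T y - T x)
        = (\<integral>w. (if Y w \<le> y then (Y w)\<^sup>2 else 0) + x\<^sup>2 / 4 *
           (indicator {w\<in>space M. y < Y w} w - indicator {w\<in>space M. x < Y w} w) \<partial>M)" for y
        using Kint[of y] intI[of y] intI[of x] by (simp add: K_def T_def)
      then show ?thesis .
    qed
    also have "\<dots> \<le> K x"
      unfolding K_def
    proof (rule integral_mono)
      fix w assume w: "w \<in> space M"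
      have "x\<^sup>2 / 4 \<le> (Y w)\<^sup>2" if "x / 2 < Y w"
        using power_mono[of "x/2" "Y w" 2] that \<open>0 < x\<close> by (simp add: power_divide)
      then show "(if Y w \<le> x / 2 then (Y w)\<^sup>2 else 0) + x\<^sup>2 / 4 *
         (indicator {w\<in>space M. x / 2 < Y w} w - indicator {w\<in>space M. x < Y w} w)
         \<le> (if Y w \<le> x then (Y w)\<^sup>2 else 0)"
        using w that by (auto simp: indicator_def)
    qed (rule Kint | intro Bochner_Integration.integrable_add integrable_mult_right
        Bochner_Integration.integrable_diff Kint intI)+
    finally show ?thesis .
  qed
  \<comment> \<open>One more block contributes \<open>L x / 2\<close>, twice what is needed; the surplus covers the loss in passing from \<open>L (x / 2)\<close> to \<open>L x\<close>.\<close>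
  have K_large: "\<forall>\<^sub>F x in at_top. real m / 4 * L x \<le> K x" for m
  proof (induction m)
    case 0 then show ?case by (simp add: K_def)
  next
    case (Suc m)
    have half: "filterlim (\<lambda>x::real. x / 2) at_top at_top" by real_asymp
    have IH: "\<forall>\<^sub>F x in at_top. real m / 4 * L (x / 2) \<le> K (x / 2)"
      using Suc.IH half by (auto simp: filterlim_iff)
    have "\<forall>\<^sub>F x in at_top. 1 - 1 / (real m + 1) < L (1 / 2 * x) / L x"
      using Lscale[of "1/2"] by (intro order_tendstoD) auto
    then show ?case using IH Lpos big eventually_ge_at_top[of "2 * x0"]
    proof eventually_elim
      case (elim x)
      have "3 * T (2 * (x / 2)) \<le> T (x / 2)" using elim by (intro T3) auto
      then have "x\<^sup>2 / 4 * (2 * T x) \<le> x\<^sup>2 / 4 * (T (x / 2) - T x)" by (intro mult_left_mono) auto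
      then have 1: "L x / 2 \<le> K x - K (x / 2)"
      proof -
        have "x\<^sup>2 / 4 * (2 * T x) = L x / 2" using LT[of x] elim by simp
        moreover have "0 < x" using elim by simp
        note K_half[OF this]
        ultimately show ?thesis using \<open>x\<^sup>2 / 4 * (2 * T x) \<le> x\<^sup>2 / 4 * (T (x / 2) - T x)\<close> by linarith
      qed
      have "(1 - 1 / (real m + 1)) * L x \<le> L (x / 2)"
        using elim by (simp add: field_simps)
      then have "real m / 4 * ((1 - 1 / (real m + 1)) * L x) \<le> real m / 4 * L (x / 2)"
        by (intro mult_left_mono) auto
      moreover have "(real m / 4 * (1 - 1 / (real m + 1)) + 1 / 2) * L x
          = real m / 4 * ((1 - 1 / (real m + 1)) * L x) + L x / 2"
        by (simp add: distrib_right mult.assoc)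
      ultimately have "(real m / 4 * (1 - 1 / (real m + 1)) + 1 / 2) * L x \<le> K x"
        using 1 elim by linarith
      moreover have "real (Suc m) / 4 \<le> real m / 4 * (1 - 1 / (real m + 1)) + 1 / 2"
        by (simp add: field_simps)
      then have "real (Suc m) / 4 * L x \<le> (real m / 4 * (1 - 1 / (real m + 1)) + 1 / 2) * L x"
        using elim by (intro mult_right_mono) auto
      ultimately show ?case by linarith
    qed
  qed
  have H_ge: "K x / x\<^sup>2 \<le> trunc_moment M Y (1 / x)" if "0 < x" for x
  proof -
    have "K x / x\<^sup>2 = (\<integral>w. (if Y w \<le> x then (Y w)\<^sup>2 else 0) / x\<^sup>2 \<partial>M)"
      by (simp add: K_def)
    also have "\<dots> \<le> trunc_moment M Y (1 / x)"
      unfolding trunc_moment_def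
    proof (rule integral_mono)
      fix w assume "w \<in> space M"
      then show "(if Y w \<le> x then (Y w)\<^sup>2 else 0) / x\<^sup>2 \<le> trunc_sq (1 / x * Y w)"
        using Y0[of w] that by (auto simp: trunc_sq_small power_divide)
    qed (rule integrable_trunc_sq[OF Yi] | use Kint in simp)+
    finally show ?thesis .
  qed
  have H_large: "\<forall>\<^sub>F x in at_top. real m / 4 * T x \<le> trunc_moment M Y (1 / x)" for m
    using K_large[of m] big
  proof eventually_elim
    case (elim x)
    then have "real m / 4 * T x \<le> K x / x\<^sup>2" by (simp add: LT field_simps)
    with H_ge[of x] elim show ?case by linarith
  qed
  have Tpos: "\<forall>\<^sub>F x in at_top. 0 < T x"
    using Lpos big by eventually_elim (auto simp: LT zero_less_mult_iff)
  have Hpos: "\<forall>\<^sub>F x in at_top. 0 < trunc_moment M Y (1 / x)"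
    using H_large[of 1] Tpos by eventually_elim auto
  let ?T = "\<lambda>l. \<integral>w. (if 1 < l * Y w then l * Y w else 0) \<partial>M"
  have "\<forall>\<^sub>F x in at_top. norm (?T (1 / x) / trunc_moment M Y (1 / x)) < e" if e: "0 < e" for e
  proof -
    obtain m :: nat where m: "24 / e < real m" using reals_Archimedean2 by blast
    then have m0: "0 < real m" using e by (meson divide_pos_pos less_trans zero_less_numeral)
    show ?thesis using H_large[of m] Hpos Tpos big eventually_ge_at_top[of x0]
    proof eventually_elim
      case (elim x)
      have "(\<lambda>w. if 1 < 1 / x * Y w then 1 / x * Y w else 0) = (\<lambda>w. (if x < Y w then Y w else 0) / x)"
        using elim by (auto simp: fun_eq_iff field_simps)
      then have "?T (1 / x) = (\<integral>w. (if x < Y w then Y w else 0) \<partial>M) / x" by simp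
      also have "\<dots> \<le> 6 * T x" using tail(2)[of x] elim by (simp add: field_simps)
      finally have 1: "?T (1 / x) \<le> 6 * T x" .
      have "6 * T x * real m \<le> 24 * trunc_moment M Y (1 / x)" using elim by simp
      also have "\<dots> < e * real m * trunc_moment M Y (1 / x)"
        using m e elim by (intro mult_strict_right_mono) (auto simp: field_simps)
      finally have "real m * (6 * T x) < real m * (e * trunc_moment M Y (1 / x))"
        by (simp add: algebra_simps)
      then have "6 * T x < e * trunc_moment M Y (1 / x)" using m0 by (simp add: mult_less_cancel_left_pos)
      with 1 have "?T (1 / x) < e * trunc_moment M Y (1 / x)" by linarith
      moreover have "0 \<le> ?T (1 / x)" using elim by (intro integral_nonneg_AE) auto
      ultimately show ?case using elim by (simp add: divide_less_eq)
    qed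
  qed
  then have "((\<lambda>l. ?T l / trunc_moment M Y l) \<longlongrightarrow> 0) (at_right 0)"
    by (intro tendstoI) (simp only: eventually_at_right_0_iff_inverse dist_norm diff_0_right)
  moreover have "\<forall>\<^sub>F l in at_right 0. 0 < trunc_moment M Y l"
    using Hpos by (simp only: eventually_at_right_0_iff_inverse)
  ultimately show ?thesis using Yi Y0 by (auto simp: gaussian_domain_def)
qed

text \<open>
  The quotient of the truncated moment by \<open>l\<^sup>2\<close> is \<open>E min(Y\<^sup>2, Y / l)\<close>, which increases to the infinite
  second moment as \<open>l\<close> decreases.
\<close>

lemma (in prob_space) square_negligible_of_infinite_second_moment:
  assumes Yi: "integrable M Y" and Y0: "\<And>w. w \<in> space M \<Longrightarrow> 0 \<le> Y w"
    and inf: "\<not> integrable M (\<lambda>w. (Y w)\<^sup>2)" and c: "0 < c"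
  shows "\<forall>\<^sub>F l in at_right 0. l\<^sup>2 \<le> c * trunc_moment M Y l"
proof -
  have [measurable]: "Y \<in> borel_measurable M" using Yi by auto
  let ?f = "\<lambda>n w. min ((Y w)\<^sup>2) (real n * Y w)"
  have fi: "integrable M (?f n)" for n
    by (rule Bochner_Integration.integrable_bound[of M "\<lambda>w. real n * Y w"])
      (use Yi Y0 in \<open>auto intro!: AE_I2 simp: min_def\<close>)
  have "\<exists>n. 1 / c < (\<integral>w. ?f n w \<partial>M)"
  proof (rule ccontr)
    assume "\<not> ?thesis"
    then have "integrable M (\<lambda>w. (Y w)\<^sup>2) \<and> (\<integral>w. (Y w)\<^sup>2 \<partial>M) \<le> 1 / c"
    proof (intro integrable_of_bounded_increasing[where f="?f"])
      fix i j w assume "i \<le> (j::nat)" and "w \<in> space M"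
      then have "real i * Y w \<le> real j * Y w" using Y0 by (intro mult_right_mono) auto
      then show "?f i w \<le> ?f j w" by auto
    next
      fix w assume w: "w \<in> space M"
      obtain n0 :: nat where "Y w < real n0" using reals_Archimedean2 by blast
      then have "?f n w = (Y w)\<^sup>2" if "n0 \<le> n" for n
        using that mult_right_mono[of "Y w" "real n" "Y w"] Y0[OF w]
        by (auto simp: min_def power2_eq_square)
      then show "\<forall>\<^sub>F n in sequentially. ?f n w = (Y w)\<^sup>2"
        unfolding eventually_sequentially by auto
    qed (use fi Y0 in \<open>auto simp: not_less\<close>)
    with inf show False by simp
  qed
  then obtain n where n: "1 / c < (\<integral>w. ?f n w \<partial>M)" by blast
  have "\<forall>\<^sub>F l in at_right 0. l < 1 / (real n + 1)"
    by (rule eventually_at_right_real[THEN eventually_mono]) auto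
  moreover have "\<forall>\<^sub>F l in at_right (0::real). 0 < l" by (simp add: eventually_at_right_less)
  ultimately show ?thesis
  proof eventually_elim
    case (elim l)
    have nl: "l * real n \<le> 1" using elim by (simp add: field_simps)
    have "l\<^sup>2 * (1 / c) \<le> l\<^sup>2 * (\<integral>w. ?f n w \<partial>M)" using n by (intro mult_left_mono) auto
    also have "\<dots> = (\<integral>w. l\<^sup>2 * ?f n w \<partial>M)" by simp
    also have "\<dots> \<le> trunc_moment M Y l"
      unfolding trunc_moment_def
    proof (rule integral_mono)
      fix w assume w: "w \<in> space M"
      have "l\<^sup>2 * ?f n w \<le> l\<^sup>2 * (Y w)\<^sup>2" by (intro mult_left_mono) auto
      moreover have "l\<^sup>2 * ?f n w \<le> l * Y w"
      proof -
        have "l\<^sup>2 * ?f n w \<le> l\<^sup>2 * (real n * Y w)" by (intro mult_left_mono) auto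
        also have "\<dots> = (l * real n) * (l * Y w)" by (simp add: power2_eq_square)
        also have "\<dots> \<le> 1 * (l * Y w)" using nl elim Y0[OF w] by (intro mult_right_mono) auto
        finally show ?thesis by simp
      qed
      ultimately show "l\<^sup>2 * ?f n w \<le> trunc_sq (l * Y w)"
        using elim Y0[OF w] by (simp add: trunc_sq_def power_mult_distrib)
    qed (use fi integrable_trunc_sq[OF Yi] in auto)
    finally show ?case using c by (simp add: field_simps)
  qed
qed

section \<open>Affine recursions with independent coefficients\<close>

lemma (in prob_space) indep_var_integral:
  fixes f :: "'b \<times> 'b \<Rightarrow> 'd::{banach, second_countable_topology}"
  assumes ind: "indep_var S U T V" and f [measurable]: "f \<in> borel_measurable (S \<Otimes>\<^sub>M T)"
    and int: "integrable M (\<lambda>w. f (U w, V w))"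
  shows "(\<integral>w. f (U w, V w) \<partial>M) = (\<integral>w. (\<integral>w'. f (U w, V w') \<partial>M) \<partial>M)"
proof -
  have [measurable]: "random_variable S U" "random_variable T V"
    using indep_var_rv1[OF ind] indep_var_rv2[OF ind] by auto
  have eq: "distr M S U \<Otimes>\<^sub>M distr M T V = distr M (S \<Otimes>\<^sub>M T) (\<lambda>w. (U w, V w))"
    using ind by (simp add: indep_var_distribution_eq)
  interpret U: prob_space "distr M S U" by (rule prob_space_distr) simp
  interpret V: prob_space "distr M T V" by (rule prob_space_distr) simp
  interpret UV: pair_prob_space "distr M S U" "distr M T V" ..
  have "integrable (distr M S U \<Otimes>\<^sub>M distr M T V) f"
    unfolding eq by (subst integrable_distr_eq) (use int in auto)
  then have "(\<integral>x. (\<integral>y. f (x, y) \<partial>distr M T V) \<partial>distr M S U) = integral\<^sup>L (distr M S U \<Otimes>\<^sub>M distr M T V) f"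
    by (rule UV.integral_fst')
  also have "\<dots> = (\<integral>w. f (U w, V w) \<partial>M)"
    unfolding eq by (rule integral_distr) auto
  also have "(\<integral>x. (\<integral>y. f (x, y) \<partial>distr M T V) \<partial>distr M S U) =
      (\<integral>w. (\<integral>y. f (U w, y) \<partial>distr M T V) \<partial>M)"
    by (rule integral_distr) auto
  also have "\<dots> = (\<integral>w. (\<integral>w'. f (U w, V w') \<partial>M) \<partial>M)"
  proof (rule Bochner_Integration.integral_cong)
    fix w assume w: "w \<in> space M"
    have "U w \<in> space S" using w by (rule measurable_space[rotated]) simp
    then show "(\<integral>y. f (U w, y) \<partial>distr M T V) = (\<integral>w'. f (U w, V w') \<partial>M)"
      by (intro integral_distr) auto
  qed simp
  finally show ?thesis ..
qed

locale affine_recursion = prob_space M for M :: "'a measure" +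
  fixes A B :: "int \<Rightarrow> 'a \<Rightarrow> real"
  assumes nonneg: "\<And>t w. w \<in> space M \<Longrightarrow> 0 \<le> A t w \<and> 0 \<le> B t w"
    and indep_pairs: "indep_vars (\<lambda>_. borel \<Otimes>\<^sub>M borel) (\<lambda>t w. (A t w, B t w)) UNIV"
    and ident: "\<And>t. distr M (borel \<Otimes>\<^sub>M borel) (\<lambda>w. (A t w, B t w)) =
                     distr M (borel \<Otimes>\<^sub>M borel) (\<lambda>w. (A 0 w, B 0 w))"
    and indep_A_B: "\<And>t. indep_var borel (A t) borel (B t)"
    and A_square_integrable: "integrable M (\<lambda>w. A 0 w ^ 2)"
    and A_square_less_1: "(\<integral>w. A 0 w ^ 2 \<partial>M) < 1"
    and B_integrable: "integrable M (B 0)"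
begin

definition \<mu> :: real where "\<mu> = (\<integral>w. A 0 w \<partial>M)"

definition \<rho> :: real where "\<rho> = (\<integral>w. A 0 w ^ 2 \<partial>M)"

definition \<mu>\<^sub>B :: real where "\<mu>\<^sub>B = (\<integral>w. B 0 w \<partial>M)"

lemma A_nonneg: "w \<in> space M \<Longrightarrow> 0 \<le> A t w" and B_nonneg: "w \<in> space M \<Longrightarrow> 0 \<le> B t w"
  using nonneg by auto

lemma AB_measurable [measurable]: "(\<lambda>w. (A t w, B t w)) \<in> measurable M (borel \<Otimes>\<^sub>M borel)"
  using indep_pairs unfolding indep_vars_def by auto

lemma A_measurable [measurable]: "A t \<in> borel_measurable M"
  using measurable_compose[OF AB_measurable measurable_fst] by simp

lemma B_measurable [measurable]: "B t \<in> borel_measurable M"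
  using measurable_compose[OF AB_measurable measurable_snd] by simp

lemma
  fixes g :: "real \<times> real \<Rightarrow> 'b::{banach, second_countable_topology}"
  assumes [measurable]: "g \<in> borel_measurable (borel \<Otimes>\<^sub>M borel)"
  shows integral_ident: "(\<integral>w. g (A t w, B t w) \<partial>M) = (\<integral>w. g (A 0 w, B 0 w) \<partial>M)"
    and integrable_ident: "integrable M (\<lambda>w. g (A t w, B t w)) \<longleftrightarrow> integrable M (\<lambda>w. g (A 0 w, B 0 w))"
proof -
  show "(\<integral>w. g (A t w, B t w) \<partial>M) = (\<integral>w. g (A 0 w, B 0 w) \<partial>M)"
    using integral_distr[OF AB_measurable[of t] assms] integral_distr[OF AB_measurable[of 0] assms] ident[of t]
    by simp
  show "integrable M (\<lambda>w. g (A t w, B t w)) \<longleftrightarrow> integrable M (\<lambda>w. g (A 0 w, B 0 w))"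
    using integrable_distr_eq[OF AB_measurable[of t] assms] integrable_distr_eq[OF AB_measurable[of 0] assms] ident[of t]
    by simp
qed

lemma
  fixes g :: "real \<Rightarrow> 'b::{banach, second_countable_topology}"
  assumes [measurable]: "g \<in> borel_measurable borel"
  shows integral_A: "(\<integral>w. g (A t w) \<partial>M) = (\<integral>w. g (A 0 w) \<partial>M)"
    and integrable_A: "integrable M (\<lambda>w. g (A t w)) \<longleftrightarrow> integrable M (\<lambda>w. g (A 0 w))"
    and integral_B: "(\<integral>w. g (B t w) \<partial>M) = (\<integral>w. g (B 0 w) \<partial>M)"
    and integrable_B: "integrable M (\<lambda>w. g (B t w)) \<longleftrightarrow> integrable M (\<lambda>w. g (B 0 w))"
  using integral_ident[of "\<lambda>p. g (fst p)" t] integrable_ident[of "\<lambda>p. g (fst p)" t]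
    integral_ident[of "\<lambda>p. g (snd p)" t] integrable_ident[of "\<lambda>p. g (snd p)" t]
  by auto

lemma A_power_integrable:
  assumes "k \<le> 2" shows "integrable M (\<lambda>w. A t w ^ k)"
proof -
  have "integrable M (A 0)"
    by (rule square_integrable_imp_integrable[OF A_measurable A_square_integrable])
  moreover have "k = 0 \<or> k = 1 \<or> k = 2" using assms by arith
  ultimately have "integrable M (\<lambda>w. A 0 w ^ k)"
    using A_square_integrable by (elim disjE) simp_all
  then show ?thesis by (subst integrable_A) simp_all
qed

lemma integrable_A_t [simp]: "integrable M (A t)"
  using A_power_integrable[of 1] by simp

lemma integrable_B_t [simp]: "integrable M (B t)"
  using integrable_B[of "\<lambda>x. x" t] B_integrable by simp

lemma \<mu>_nonneg: "0 \<le> \<mu>" and \<rho>_nonneg: "0 \<le> \<rho>" and \<mu>\<^sub>B_nonneg: "0 \<le> \<mu>\<^sub>B"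
  using A_nonneg B_nonneg by (auto simp: \<mu>_def \<rho>_def \<mu>\<^sub>B_def intro!: integral_nonneg_AE AE_I2)

lemma \<rho>_less_1: "\<rho> < 1" using A_square_less_1 by (simp add: \<rho>_def)

lemma variance_A: "(\<integral>w. (A 0 w - \<mu>)\<^sup>2 \<partial>M) = \<rho> - \<mu>\<^sup>2"
  using variance_eq[of "A 0"] A_square_integrable by (simp add: \<rho>_def \<mu>_def)

lemma \<mu>_less_1: "\<mu> < 1"
proof -
  have "0 \<le> \<rho> - \<mu>\<^sup>2" unfolding variance_A[symmetric] by simp
  then have "\<mu>\<^sup>2 < 1\<^sup>2" using \<rho>_less_1 by simp
  then show ?thesis by (rule power_less_imp_less_base) simp
qed

text \<open>
  The information contained in the coefficients with time index in \<open>K\<close>. Independence statements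
  below all come from measurability with respect to disjoint index sets.
\<close>

definition info :: "int set \<Rightarrow> 'a measure" where
  "info K = vimage_algebra (space M) (\<lambda>w. \<lambda>t\<in>K. (A t w, B t w)) (Pi\<^sub>M K (\<lambda>_. borel \<Otimes>\<^sub>M borel))"

lemma space_info [simp]: "space (info K) = space M"
  by (simp add: info_def)

lemma info_AB: "t \<in> K \<Longrightarrow> (\<lambda>w. (A t w, B t w)) \<in> measurable (info K) (borel \<Otimes>\<^sub>M borel)"
proof -
  assume t: "t \<in> K"
  have "(\<lambda>w. \<lambda>t\<in>K. (A t w, B t w)) \<in> measurable (info K) (Pi\<^sub>M K (\<lambda>_. borel \<Otimes>\<^sub>M borel))"
    unfolding info_def by (rule measurable_vimage_algebra1) (auto simp: space_PiM space_pair_measure)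
  from measurable_compose[OF this measurable_component_singleton[OF t]] t
  show ?thesis by simp
qed

lemma info_A: "t \<in> K \<Longrightarrow> A t \<in> borel_measurable (info K)"
  using measurable_compose[OF info_AB measurable_fst] by simp

lemma info_B: "t \<in> K \<Longrightarrow> B t \<in> borel_measurable (info K)"
  using measurable_compose[OF info_AB measurable_snd] by simp

lemma info_mono:
  assumes "f \<in> measurable (info K) N" "K \<subseteq> K'" shows "f \<in> measurable (info K') N"
proof -
  have "(\<lambda>x. x) \<in> measurable (info K') (info K)"
    unfolding info_def[of K]
    using assms(2) by (intro measurable_vimage_algebra2 measurable_restrict info_AB) auto
  from measurable_compose[OF this assms(1)] show ?thesis by simp
qed

lemma info_measurable: "f \<in> measurable (info K) N \<Longrightarrow> f \<in> measurable M N"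
proof -
  assume f: "f \<in> measurable (info K) N"
  have "(\<lambda>x. x) \<in> measurable M (info K)"
    unfolding info_def by (intro measurable_vimage_algebra2 measurable_restrict AB_measurable) auto
  from measurable_compose[OF this f] show ?thesis by simp
qed

lemma indep_info:
  assumes f: "f \<in> measurable (info K) S" and g: "g \<in> measurable (info K') T" and disj: "K \<inter> K' = {}"
  shows "indep_var S f T g"
proof -
  let ?r = "\<lambda>K w. \<lambda>t\<in>K. (A t w, B t w)"
  let ?P = "\<lambda>K. Pi\<^sub>M K (\<lambda>_::int. borel \<Otimes>\<^sub>M borel :: (real \<times> real) measure)"
  have "indep_var (?P K) (?r K) (?P K') (?r K')"
    by (rule indep_var_restrict[OF indep_pairs disj]) auto
  then have ind: "indep_set (sets (info K)) (sets (info K'))"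
    by (simp add: indep_var_eq info_def sets_vimage_algebra)
  have sub: "sigma_sets (space M) {f -` A \<inter> space M |A. A \<in> sets N} \<subseteq> sets (info L)"
    if "f \<in> measurable (info L) N" for f :: "'a \<Rightarrow> 'z" and N L
    using that sets.top[of "info L"]
    by (intro sets.sigma_sets_subset'[where M="info L", simplified]) (auto dest: measurable_sets)
  show ?thesis
    unfolding indep_var_eq
  proof (intro conjI)
    show "indep_set (sigma_sets (space M) {f -` A \<inter> space M |A. A \<in> sets S})
       (sigma_sets (space M) {g -` A \<inter> space M |A. A \<in> sets T})"
      using ind sub[OF f] sub[OF g] unfolding indep_sets2_eq by blast
  qed (use f g info_measurable in auto)
qed

text \<open>
  Iterating the recursion \<open>q\<close> times gives \<open>X t = prodA t q * X (t - q) + sumB t q\<close>. Both \<open>prodA t q\<close> and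
  \<open>sumB t q\<close> use coefficients with index above \<open>t - q\<close> only, so they are independent of the past of
  time \<open>t - q\<close>.
\<close>

definition prodA :: "int \<Rightarrow> nat \<Rightarrow> 'a \<Rightarrow> real" where
  "prodA t q w = (\<Prod>i<q. A (t - int i) w)"

definition sumB :: "int \<Rightarrow> nat \<Rightarrow> 'a \<Rightarrow> real" where
  "sumB t q w = (\<Sum>j<q. B (t - int j) w * prodA t j w)"

lemma prodA_nonneg: "w \<in> space M \<Longrightarrow> 0 \<le> prodA t q w"
  by (auto simp: prodA_def intro!: prod_nonneg A_nonneg)

lemma sumB_nonneg: "w \<in> space M \<Longrightarrow> 0 \<le> sumB t q w"
  by (auto simp: sumB_def intro!: sum_nonneg mult_nonneg_nonneg B_nonneg prodA_nonneg)

lemma prodA_info: "prodA t q \<in> borel_measurable (info {t - int q<..})"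
  unfolding prodA_def[abs_def] by (intro borel_measurable_prod info_A) auto

lemma sumB_info: "sumB t q \<in> borel_measurable (info {t - int q<..})"
  unfolding sumB_def[abs_def]
  by (intro borel_measurable_sum borel_measurable_times info_B info_mono[OF prodA_info]) auto

lemma prodA_measurable [measurable]: "prodA t q \<in> borel_measurable M"
  by (rule info_measurable[OF prodA_info])

lemma sumB_measurable [measurable]: "sumB t q \<in> borel_measurable M"
  by (rule info_measurable[OF sumB_info])

lemma
  assumes "k \<le> 2"
  shows prodA_power_integrable: "integrable M (\<lambda>w. prodA t q w ^ k)"
    and prodA_power_integral: "(\<integral>w. prodA t q w ^ k \<partial>M) = (\<integral>w. A 0 w ^ k \<partial>M) ^ q"
proof -
  have "integrable M (\<lambda>w. prodA t q w ^ k) \<and>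
    (\<integral>w. prodA t q w ^ k \<partial>M) = (\<integral>w. A 0 w ^ k \<partial>M) ^ q"
  proof (induction q)
    case 0 then show ?case by (simp add: prodA_def prob_space)
  next
    case (Suc q)
    have ind: "indep_var borel (\<lambda>w. prodA t q w ^ k) borel (\<lambda>w. A (t - int q) w ^ k)"
      by (rule indep_info[where K="{t - int q<..}" and K'="{t - int q}"])
        (auto intro!: borel_measurable_power prodA_info info_A)
    have eq: "(\<lambda>w. prodA t (Suc q) w ^ k) = (\<lambda>w. prodA t q w ^ k * A (t - int q) w ^ k)"
      by (simp add: prodA_def power_mult_distrib)
    show ?case
      unfolding eq
      using indep_var_lebesgue_integral[OF ind] indep_var_integrable[OF ind] Suc
        A_power_integrable[OF assms] integral_A[of "\<lambda>x. x ^ k" "t - int q"]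
      by simp
  qed
  then show "integrable M (\<lambda>w. prodA t q w ^ k)"
    "(\<integral>w. prodA t q w ^ k \<partial>M) = (\<integral>w. A 0 w ^ k \<partial>M) ^ q" by auto
qed

lemma prodA_integrable: "integrable M (prodA t q)" and prodA_integral: "(\<integral>w. prodA t q w \<partial>M) = \<mu> ^ q"
  using prodA_power_integrable[of 1] prodA_power_integral[of 1] by (auto simp: \<mu>_def)

lemma prodA_square_integral: "(\<integral>w. (prodA t q w)\<^sup>2 \<partial>M) = \<rho> ^ q"
  using prodA_power_integral[of 2] by (auto simp: \<rho>_def)

lemma lag_decomposition:
  assumes "\<And>t. AE w in M. X t w = A t w * X (t - 1) w + B t w"
  shows "AE w in M. X t w = prodA t q w * X (t - int q) w + sumB t q w"
proof (induction q)
  case 0 then show ?case by (simp add: prodA_def sumB_def)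
next
  case (Suc q)
  from Suc assms[of "t - int q"] show ?case
    by eventually_elim (simp add: prodA_def sumB_def algebra_simps)
qed

section \<open>The stationary solution\<close>

text \<open>
  The series is summed in \<^typ>\<open>ennreal\<close>, where the shift identity behind the recursion holds without
  convergence conditions, and converted to a nonnegative real afterwards.
\<close>

definition perp_sum :: "int \<Rightarrow> 'a \<Rightarrow> ennreal" where
  "perp_sum t w = (\<Sum>j. ennreal (B (t - int j) w * prodA t j w))"

definition perpetuity :: "int \<Rightarrow> 'a \<Rightarrow> real" where
  "perpetuity t w = enn2real (perp_sum t w)"

lemma perpetuity_nonneg: "0 \<le> perpetuity t w"
  by (simp add: perpetuity_def)

lemma perp_sum_info: "perp_sum t \<in> borel_measurable (info {..t})"
  unfolding perp_sum_def[abs_def] prodA_def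
  by (intro borel_measurable_suminf_order measurable_compose[OF _ measurable_ennreal]
      borel_measurable_times borel_measurable_prod info_A info_B) auto

lemma perpetuity_info: "perpetuity t \<in> borel_measurable (info {..t})"
  unfolding perpetuity_def[abs_def] using perp_sum_info by (rule measurable_compose) simp

lemma perp_sum_measurable [measurable]: "perp_sum t \<in> borel_measurable M"
  by (rule info_measurable[OF perp_sum_info])

lemma perpetuity_measurable [measurable]: "perpetuity t \<in> borel_measurable M"
  by (rule info_measurable[OF perpetuity_info])

lemma nn_integral_perp_sum: "(\<integral>\<^sup>+w. perp_sum t w \<partial>M) = ennreal (\<mu>\<^sub>B / (1 - \<mu>))"
proof -
  have term_eq: "(\<integral>\<^sup>+w. ennreal (B (t - int j) w * prodA t j w) \<partial>M) = ennreal (\<mu>\<^sub>B * \<mu> ^ j)" for j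
  proof -
    have ind: "indep_var borel (B (t - int j)) borel (prodA t j)"
      by (rule indep_info[where K="{t - int j}" and K'="{t - int j<..}"]) (auto intro: info_B prodA_info)
    have "(\<integral>w. B (t - int j) w * prodA t j w \<partial>M) = \<mu>\<^sub>B * \<mu> ^ j"
      using indep_var_lebesgue_integral[OF ind integrable_B_t prodA_integrable]
        integral_B[of "\<lambda>x. x" "t - int j"] by (simp add: \<mu>\<^sub>B_def prodA_integral)
    moreover have "integrable M (\<lambda>w. B (t - int j) w * prodA t j w)"
      by (rule indep_var_integrable[OF ind integrable_B_t prodA_integrable])
    moreover have "AE w in M. 0 \<le> B (t - int j) w * prodA t j w"
      by (intro AE_I2 mult_nonneg_nonneg B_nonneg prodA_nonneg)
    ultimately show ?thesis
      by (simp only: nn_integral_eq_integral)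
  qed
  have "(\<integral>\<^sup>+w. perp_sum t w \<partial>M) = (\<Sum>j. \<integral>\<^sup>+w. ennreal (B (t - int j) w * prodA t j w) \<partial>M)"
    unfolding perp_sum_def by (rule nn_integral_suminf) measurable
  also have "\<dots> = (\<Sum>j. ennreal (\<mu>\<^sub>B * \<mu> ^ j))" by (simp only: term_eq)
  also have "\<dots> = ennreal (\<mu>\<^sub>B * (1 / (1 - \<mu>)))"
  proof (rule suminf_ennreal_eq)
    show "(\<lambda>j. \<mu>\<^sub>B * \<mu> ^ j) sums (\<mu>\<^sub>B * (1 / (1 - \<mu>)))"
      using \<mu>_nonneg \<mu>_less_1 by (intro sums_mult geometric_sums) simp
  qed (use \<mu>_nonneg \<mu>\<^sub>B_nonneg in simp)
  finally show ?thesis by (simp only: mult_1_right times_divide_eq_right)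
qed

lemma perp_sum_finite: "AE w in M. perp_sum t w < \<infinity>"
proof -
  have "AE w in M. perp_sum t w \<noteq> \<infinity>"
    by (rule nn_integral_PInf_AE) (simp_all add: nn_integral_perp_sum)
  then show ?thesis by eventually_elim (simp add: less_top)
qed

lemma perpetuity_integrable: "integrable M (perpetuity t)"
  and perpetuity_integral: "(\<integral>w. perpetuity t w \<partial>M) = \<mu>\<^sub>B / (1 - \<mu>)"
proof -
  have "(\<integral>\<^sup>+w. ennreal (perpetuity t w) \<partial>M) = (\<integral>\<^sup>+w. perp_sum t w \<partial>M)"
    using perp_sum_finite[of t] by (intro nn_integral_cong_AE) (auto simp: perpetuity_def ennreal_enn2real_if)
  then have eq: "(\<integral>\<^sup>+w. ennreal (perpetuity t w) \<partial>M) = ennreal (\<mu>\<^sub>B / (1 - \<mu>))"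
    by (simp add: nn_integral_perp_sum)
  then show int: "integrable M (perpetuity t)"
    by (intro integrableI_nonneg) (auto simp: perpetuity_nonneg)
  show "(\<integral>w. perpetuity t w \<partial>M) = \<mu>\<^sub>B / (1 - \<mu>)"
  proof -
    have "ennreal (\<integral>w. perpetuity t w \<partial>M) = ennreal (\<mu>\<^sub>B / (1 - \<mu>))"
      using nn_integral_eq_integral[OF int] perpetuity_nonneg eq by simp
    then show ?thesis
      using \<mu>\<^sub>B_nonneg \<mu>_less_1 by (subst (asm) ennreal_inj) (auto simp: perpetuity_nonneg intro!: integral_nonneg_AE)
  qed
qed

lemma perpetuity_recursion: "AE w in M. perpetuity t w = A t w * perpetuity (t - 1) w + B t w"
  using perp_sum_finite[of "t - 1"] AE_space
proof eventually_elim
  case (elim w)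
  have shift: "prodA t (Suc j) w = A t w * prodA (t - 1) j w" for j
    unfolding prodA_def by (subst prod.lessThan_Suc_shift) (simp add: algebra_simps)
  have "perp_sum t w = ennreal (B t w) + (\<Sum>j. ennreal (B (t - int (Suc j)) w * prodA t (Suc j) w))"
    unfolding perp_sum_def by (subst suminf_offset[where i=1]) (simp_all add: prodA_def add.commute)
  also have "(\<Sum>j. ennreal (B (t - int (Suc j)) w * prodA t (Suc j) w))
      = (\<Sum>j. ennreal (A t w) * ennreal (B (t - 1 - int j) w * prodA (t - 1) j w))"
    using elim by (intro suminf_cong) (simp add: shift A_nonneg algebra_simps flip: ennreal_mult')
  also have "\<dots> = ennreal (A t w) * perp_sum (t - 1) w"
    by (simp add: perp_sum_def)
  also have "perp_sum (t - 1) w = ennreal (perpetuity (t - 1) w)"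
    using elim by (simp add: perpetuity_def ennreal_enn2real_if)
  also have "ennreal (B t w) + ennreal (A t w) * ennreal (perpetuity (t - 1) w)
      = ennreal (A t w * perpetuity (t - 1) w + B t w)"
    using elim by (simp add: A_nonneg B_nonneg perpetuity_nonneg add.commute flip: ennreal_mult ennreal_plus)
  finally have "perpetuity t w = enn2real (ennreal (A t w * perpetuity (t - 1) w + B t w))"
    by (simp only: perpetuity_def[of t])
  then show ?case
    using elim by (simp only: enn2real_ennreal add_nonneg_nonneg mult_nonneg_nonneg
        A_nonneg B_nonneg perpetuity_nonneg)
qed

text \<open>
  The difference of two solutions at time \<open>t\<close> is \<open>prodA t N\<close> times their difference at time \<open>t - N\<close>. The
  product tends to 0 in mean, and the earlier differences are bounded in probability, since one
  solution has a constant law and the other a constant mean. This identification is what makes a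
  given stationary solution a function of past coefficients.
\<close>

lemma stationary_solution_eq_perpetuity:
  assumes X [measurable]: "\<And>t. X t \<in> borel_measurable M"
    and distr: "\<And>t. distr M borel (X t) = distr M borel (X 0)"
    and rec: "\<And>t. AE w in M. X t w = A t w * X (t - 1) w + B t w"
  shows "AE w in M. X t w = perpetuity t w"
proof -
  let ?m = "\<mu>\<^sub>B / (1 - \<mu>)"
  have m0: "0 \<le> ?m" using \<mu>\<^sub>B_nonneg \<mu>_less_1 by simp
  let ?E = "\<integral>w. min 1 \<bar>X t w - perpetuity t w\<bar> \<partial>M"
  define G where "G K = prob {w\<in>space M. K < \<bar>X 0 w\<bar>}" for K
  have int: "integrable M (\<lambda>w. min 1 \<bar>X t w - perpetuity t w\<bar>)"
    by (rule integrable_const_bound[where B=1]) auto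
  have G: "prob {w\<in>space M. K < \<bar>X s w\<bar>} = G K" for K s
  proof -
    have "prob {w\<in>space M. K < \<bar>X s w\<bar>} = measure (distr M borel (X s)) {x. K < \<bar>x\<bar>}" for s
      by (subst measure_distr) (auto intro!: arg_cong[where f=prob])
    then show ?thesis using distr[of s] by (simp add: G_def)
  qed
  \<comment> \<open>Either both solutions at time \<open>t - N\<close> are at most \<open>K / 2\<close>, or one of the last two terms is at least 1.\<close>
  have step: "?E \<le> K * \<mu> ^ N + G (K / 2) + 2 / K * ?m" if K: "0 < K" for K N
  proof -
    let ?s = "t - int N"
    let ?I = "\<lambda>w. indicator {w\<in>space M. K / 2 < \<bar>X ?s w\<bar>} w :: real"
    have iI: "integrable M ?I" by (rule integrable_const_bound[where B=1]) (auto simp: indicator_def)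
    have "?E \<le> (\<integral>w. K * prodA t N w + ?I w + 2 / K * perpetuity ?s w \<partial>M)"
    proof (rule integral_mono_AE[OF int])
      show "integrable M (\<lambda>w. K * prodA t N w + ?I w + 2 / K * perpetuity ?s w)"
        using prodA_integrable iI perpetuity_integrable by simp
      show "AE w in M. min 1 \<bar>X t w - perpetuity t w\<bar> \<le> K * prodA t N w + ?I w + 2 / K * perpetuity ?s w"
        using lag_decomposition[of X t N, OF rec] lag_decomposition[of perpetuity t N, OF perpetuity_recursion]
          AE_space
      proof eventually_elim
        case (elim w)
        have P: "0 \<le> prodA t N w" using elim prodA_nonneg by simp
        have p: "0 \<le> 2 / K * perpetuity ?s w" using K perpetuity_nonneg by simp
        show ?case
        proof (cases "\<bar>X ?s w\<bar> \<le> K / 2 \<and> perpetuity ?s w \<le> K / 2")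
          case True
          have "X t w - perpetuity t w = prodA t N w * (X ?s w - perpetuity ?s w)"
            using elim by (simp add: algebra_simps)
          then have "\<bar>X t w - perpetuity t w\<bar> = prodA t N w * \<bar>X ?s w - perpetuity ?s w\<bar>"
            using P by (simp add: abs_mult)
          also have "\<dots> \<le> prodA t N w * K"
            using True perpetuity_nonneg[of ?s w] P by (intro mult_left_mono) auto
          finally have "\<bar>X t w - perpetuity t w\<bar> \<le> K * prodA t N w" by (simp add: mult.commute)
          moreover have "0 \<le> ?I w" by simp
          ultimately show ?thesis using p by linarith
        next
          case False
          have KP: "0 \<le> K * prodA t N w" using P K by simp
          have "1 \<le> ?I w + 2 / K * perpetuity ?s w"
          proof (cases "\<bar>X ?s w\<bar> \<le> K / 2")
            case True
            then have "1 \<le> 2 / K * perpetuity ?s w" using False K by (simp add: field_simps)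
            moreover have "0 \<le> ?I w" by simp
            ultimately show ?thesis by linarith
          next
            case False
            then have "?I w = 1" using elim by (simp add: indicator_def)
            with p show ?thesis by linarith
          qed
          with KP show ?thesis by linarith
        qed
      qed
    qed
    also have "\<dots> = K * (\<integral>w. prodA t N w \<partial>M) + (\<integral>w. ?I w \<partial>M) + 2 / K * (\<integral>w. perpetuity ?s w \<partial>M)"
      using prodA_integrable[of t N] iI perpetuity_integrable[of ?s] by simp
    also have "(\<integral>w. ?I w \<partial>M) = G (K / 2)"
      using G[of "K / 2" ?s] by simp
    also note prodA_integral also note perpetuity_integral
    finally show ?thesis .
  qed
  have bound: "?E \<le> G (K / 2) + 2 / K * ?m" if K: "0 < K" for K
  proof (rule LIMSEQ_le_const)
    show "(\<lambda>N. K * \<mu> ^ N + G (K / 2) + 2 / K * ?m) \<longlonglongrightarrow> G (K / 2) + 2 / K * ?m"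
      using \<mu>_nonneg \<mu>_less_1 by (auto intro!: tendsto_eq_intros LIMSEQ_power_zero)
  qed (use step[OF K] in auto)
  have "(\<lambda>n. G (real n)) \<longlonglongrightarrow> prob (\<Inter>n. {w\<in>space M. real n < \<bar>X 0 w\<bar>})"
    unfolding G_def by (rule finite_Lim_measure_decseq) (auto simp: decseq_def)
  also have "(\<Inter>n. {w\<in>space M. real n < \<bar>X 0 w\<bar>}) = {}"
    by (auto simp: not_less) (meson less_le_not_le linear reals_Archimedean2)
  finally have Glim: "(\<lambda>n. G (real n)) \<longlonglongrightarrow> 0" by simp
  have "?E \<le> 0"
  proof (rule LIMSEQ_le_const)
    have "(\<lambda>n. inverse (real (Suc n)) * ?m) \<longlonglongrightarrow> 0 * ?m"
      by (intro tendsto_mult LIMSEQ_inverse_real_of_nat tendsto_const)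
    with LIMSEQ_Suc[OF Glim]
    show "(\<lambda>n. G (real (Suc n)) + inverse (real (Suc n)) * ?m) \<longlonglongrightarrow> 0"
      using tendsto_add by fastforce
    show "\<exists>N. \<forall>n\<ge>N. ?E \<le> G (real (Suc n)) + inverse (real (Suc n)) * ?m"
    proof (intro exI[of _ 0] allI impI)
      fix n
      show "?E \<le> G (real (Suc n)) + inverse (real (Suc n)) * ?m"
      proof -
        have "2 * real (Suc n) / 2 = real (Suc n)" "2 / (2 * real (Suc n)) = inverse (real (Suc n))"
          by (simp_all add: field_simps)
        then show ?thesis using bound[of "2 * real (Suc n)"] by (simp only:)
      qed
    qed
  qed
  moreover have "0 \<le> ?E" by (intro integral_nonneg_AE) auto
  ultimately have "?E = 0" by simp
  then have "AE w in M. min 1 \<bar>X t w - perpetuity t w\<bar> = 0"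
    by (subst (asm) integral_nonneg_eq_0_iff_AE[OF int]) auto
  then show ?thesis by eventually_elim (auto simp: min_def split: if_splits)
qed

end

section \<open>The tail of the stationary solution\<close>

lemma integral_dominated_convergence_at_right_0:
  fixes s :: "real \<Rightarrow> 'a \<Rightarrow> 'b::{banach, second_countable_topology}"
  assumes "f \<in> borel_measurable M" "\<And>l. s l \<in> borel_measurable M" "integrable M w"
    and lim: "AE x in M. ((\<lambda>l. s l x) \<longlongrightarrow> f x) (at_right 0)"
    and bound: "\<forall>\<^sub>F l in at_right 0. AE x in M. norm (s l x) \<le> w x"
  shows "((\<lambda>l. integral\<^sup>L M (s l)) \<longlongrightarrow> integral\<^sup>L M f) (at_right 0)"
  using assms(1-3) lim bound unfolding filterlim_at_right_to_top eventually_at_right_to_top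
  by (rule integral_dominated_convergence_at_top)

lemma gaussian_domain_scale_limit:
  assumes Y: "gaussian_domain M Y" and p: "0 \<le> p"
  shows "((\<lambda>l. trunc_moment M Y (p * l) / trunc_moment M Y l) \<longlongrightarrow> p\<^sup>2) (at_right 0)"
proof -
  have "\<forall>\<^sub>F y in at_right (0::real). y \<in> {0<..<1 / (p + 1)}"
    using p by (intro eventually_at_right_real) (auto intro: divide_pos_pos)
  then have "\<forall>\<^sub>F y in at_right (0::real). p\<^sup>2 = trunc_sq (p * y) /\<^sub>R y\<^sup>2"
  proof eventually_elim
    case (elim y)
    then have "y * (p + 1) < 1" using p by (simp add: field_simps)
    then have "p * y \<le> 1" using elim by (simp add: algebra_simps)
    then show ?case using elim p by (simp add: trunc_sq_small abs_mult power_mult_distrib)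
  qed
  then have "((\<lambda>y. trunc_sq (p * y) /\<^sub>R y\<^sup>2) \<longlongrightarrow> p\<^sup>2) (at_right 0)"
    by (rule Lim_transform_eventually[OF tendsto_const])
  then have "((\<lambda>l. (\<integral>w. trunc_sq (p * (l * Y w)) \<partial>M) /\<^sub>R trunc_moment M Y l) \<longlongrightarrow> p\<^sup>2) (at_right 0)"
    using trunc_sq_scale[OF p]
    by (intro gaussian_domain_integral[OF Y, where C="p + p\<^sup>2"]) auto
  then show ?thesis by (simp add: trunc_moment_def divide_inverse mult.commute mult.left_commute mult.assoc)
qed

text \<open>
  The second order remainder of the Laplace kernel. It is comparable to \<open>trunc_sq\<close> and, unlike that
  function, almost additive: \<open>lap_add\<close> leaves only a product of two small terms.
\<close>

definition lap :: "real \<Rightarrow> real" where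
  "lap y = exp (- y) - 1 + y"

lemma lap_measurable [measurable]: "lap \<in> borel_measurable borel"
  unfolding lap_def[abs_def] by measurable

lemma lap_nonneg [simp]: "0 \<le> lap y"
  using exp_ge_add_one_self[of "- y"] by (simp add: lap_def)

lemma lap_le_trunc_sq: assumes "0 \<le> y" shows "lap y \<le> trunc_sq y"
proof -
  have "lap y \<le> y" using assms by (simp add: lap_def)
  moreover have "lap y \<le> y\<^sup>2"
  proof (cases "y \<le> 1")
    case True
    have "exp (- y) \<le> 1 / (1 + y)"
      using exp_ge_add_one_self[of y] assms by (simp add: exp_minus divide_simps)
    also have "\<dots> \<le> 1 - y + y\<^sup>2"
    proof -
      have "(1 - y + y\<^sup>2) * (1 + y) = 1 + y ^ 3"
        by (simp add: algebra_simps power2_eq_square power3_eq_cube)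
      moreover have "0 \<le> y ^ 3" using assms by simp
      ultimately show ?thesis using assms by (subst pos_divide_le_eq) auto
    qed
    finally show ?thesis by (simp add: lap_def)
  next
    case False
    then have "y \<le> y\<^sup>2" by (simp add: power2_eq_square)
    with \<open>lap y \<le> y\<close> show ?thesis by simp
  qed
  ultimately show ?thesis using assms by (simp add: trunc_sq_def)
qed

lemma lap_integrable:
  assumes "integrable M Y" "\<And>w. w \<in> space M \<Longrightarrow> 0 \<le> Y w" "0 \<le> x"
  shows "integrable M (\<lambda>w. lap (x * Y w))"
  using assms lap_le_trunc_sq by (intro integrable_dominated_trunc_sq[where C=1]) auto

lemma lap_limit: "((\<lambda>y. lap y /\<^sub>R y\<^sup>2) \<longlongrightarrow> 1 / 2) (at_right 0)"
  unfolding lap_def real_scaleR_def by real_asymp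

lemma gaussian_domain_lap:
  assumes "gaussian_domain M Y"
  shows "((\<lambda>l. (\<integral>w. lap (l * Y w) \<partial>M) / trunc_moment M Y l) \<longlongrightarrow> 1 / 2) (at_right 0)"
proof -
  have "((\<lambda>l. (\<integral>w. lap (l * Y w) \<partial>M) /\<^sub>R trunc_moment M Y l) \<longlongrightarrow> 1 / 2) (at_right 0)"
    by (rule gaussian_domain_integral[OF assms lap_measurable lap_limit, where C=1])
      (simp add: lap_le_trunc_sq)
  then show ?thesis by (simp only: real_scaleR_def divide_inverse_commute)
qed

lemma lap_add: "lap (y + z) = lap y + lap z + (1 - exp (- y)) * (1 - exp (- z))"
proof -
  have "exp (- (y + z)) = exp (- y) * exp (- z)" by (simp flip: exp_add)
  then show ?thesis by (simp add: lap_def algebra_simps)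
qed

text \<open>
  The combination vanishes to third order at 0 but keeps linear growth. Its expectation at \<open>l Y\<close> is
  negligible as soon as that of \<open>lap (l Y)\<close> scales quadratically, and it then controls the tail.
\<close>

lemma lap_second_difference:
  assumes "0 \<le> y"
  shows "0 \<le> lap y - lap (2 * y) / 4" and "2 \<le> y \<Longrightarrow> y / 8 \<le> lap y - lap (2 * y) / 4"
proof -
  have *: "lap y - lap (2 * y) / 4 = exp (- y) - exp (- y) ^ 2 / 4 - 3 / 4 + y / 2" for y
  proof -
    have "exp (- (2 * y)) = exp (- y) ^ 2" by (simp add: power2_eq_square flip: exp_add)
    then show ?thesis by (simp add: lap_def field_simps)
  qed
  have der: "((\<lambda>y. exp (- y) - exp (- y) ^ 2 / 4 - 3 / 4 + y / 2) has_real_derivative (1 - exp (- y))\<^sup>2 / 2) (at y)" for y :: real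
  proof -
    have "((\<lambda>y. exp (- y) - exp (- y) ^ 2 / 4 - 3 / 4 + y / 2) has_real_derivative
        - exp (- y) + exp (- y) * exp (- y) / 2 + 1 / 2) (at y)"
      by (rule derivative_eq_intros refl | simp)+
    moreover have "- z + z * z / 2 + 1 / 2 = (1 - z)\<^sup>2 / 2" for z :: real
      by (simp add: power2_eq_square field_simps)
    ultimately show ?thesis by (simp only:)
  qed
  have "exp (- 0) - exp (- 0) ^ 2 / 4 - 3 / 4 + 0 / 2 \<le> exp (- y) - exp (- y) ^ 2 / 4 - 3 / 4 + y / 2"
  proof (rule DERIV_nonneg_imp_nondecreasing[OF assms])
    fix z :: real
    have "0 \<le> (1 - exp (- z))\<^sup>2 / 2" by simp
    with der[of z]
    show "\<exists>d. ((\<lambda>y. exp (- y) - exp (- y) ^ 2 / 4 - 3 / 4 + y / 2) has_real_derivative d) (at z) \<and> 0 \<le> d"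
      by blast
  qed
  then show "0 \<le> lap y - lap (2 * y) / 4" by (simp add: *)
  show "y / 8 \<le> lap y - lap (2 * y) / 4" if "2 \<le> y"
  proof -
    have "exp (- y) ^ 2 \<le> exp (- y)"
      using assms by (simp add: power2_eq_square mult_left_le)
    moreover have "0 \<le> exp (- y)" by simp
    ultimately show ?thesis unfolding * using that by linarith
  qed
qed

context affine_recursion
begin

text \<open>
  Averaging over \<open>A\<close> maps \<open>x\<close> to \<open>\<mu> x\<close> and \<open>x\<^sup>2\<close> to \<open>\<rho> x\<^sup>2\<close>. After \<open>N\<close> iterations \<open>D x\<close> is therefore at most
  \<open>K (\<mu>\<^sup>N x + \<rho>\<^sup>N x\<^sup>2)\<close>, which tends to 0.
\<close>

lemma contraction_nonpos:
  fixes D :: "real \<Rightarrow> real"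
  assumes D [measurable]: "D \<in> borel_measurable borel"
    and bound: "\<And>x. 0 \<le> x \<Longrightarrow> \<bar>D x\<bar> \<le> K * (x + x\<^sup>2)"
    and sub: "\<And>x. 0 \<le> x \<Longrightarrow> D x \<le> (\<integral>w. D (x * A 0 w) \<partial>M)"
    and x: "0 \<le> x"
  shows "D x \<le> 0"
proof -
  have intA: "integrable M (\<lambda>w. a * A 0 w + b * (A 0 w)\<^sup>2)" for a b
    using A_power_integrable[of 2 0] by simp
  have *: "D x \<le> K * (\<mu> ^ N * x + \<rho> ^ N * x\<^sup>2)" if "0 \<le> x" for N x
    using that
  proof (induction N arbitrary: x)
    case 0 then show ?case using bound[of x] by simp
  next
    case (Suc N)
    have "D x \<le> (\<integral>w. D (x * A 0 w) \<partial>M)" using Suc by (intro sub)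
    also have "\<dots> \<le> (\<integral>w. (K * \<mu> ^ N * x) * A 0 w + (K * \<rho> ^ N * x\<^sup>2) * (A 0 w)\<^sup>2 \<partial>M)"
    proof (rule integral_mono)
      show "integrable M (\<lambda>w. D (x * A 0 w))"
      proof (rule Bochner_Integration.integrable_bound)
        show "integrable M (\<lambda>w. (K * x) * A 0 w + (K * x\<^sup>2) * (A 0 w)\<^sup>2)" by (rule intA)
        show "AE w in M. norm (D (x * A 0 w)) \<le> norm ((K * x) * A 0 w + (K * x\<^sup>2) * (A 0 w)\<^sup>2)"
        proof (rule AE_I2)
          fix w assume "w \<in> space M"
          then have "\<bar>D (x * A 0 w)\<bar> \<le> K * (x * A 0 w + (x * A 0 w)\<^sup>2)"
            using Suc.prems A_nonneg by (intro bound) auto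
          then show "norm (D (x * A 0 w)) \<le> norm ((K * x) * A 0 w + (K * x\<^sup>2) * (A 0 w)\<^sup>2)"
            by (simp add: algebra_simps power_mult_distrib)
        qed
      qed measurable
      fix w assume "w \<in> space M"
      then have "0 \<le> x * A 0 w" using Suc.prems A_nonneg by auto
      from Suc.IH[OF this]
      show "D (x * A 0 w) \<le> (K * \<mu> ^ N * x) * A 0 w + (K * \<rho> ^ N * x\<^sup>2) * (A 0 w)\<^sup>2"
        by (simp add: algebra_simps power_mult_distrib)
    qed (rule intA)
    also have "\<dots> = (K * \<mu> ^ N * x) * \<mu> + (K * \<rho> ^ N * x\<^sup>2) * \<rho>"
      using A_power_integrable[of 2 0] by (simp add: \<mu>_def \<rho>_def)
    finally show ?case by (simp add: algebra_simps)
  qed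
  show ?thesis
  proof (rule LIMSEQ_le_const)
    show "(\<lambda>N. K * (\<mu> ^ N * x + \<rho> ^ N * x\<^sup>2)) \<longlonglongrightarrow> 0"
      using \<mu>_nonneg \<mu>_less_1 \<rho>_nonneg \<rho>_less_1
      by (auto intro!: tendsto_eq_intros LIMSEQ_power_zero)
  qed (use * x in auto)
qed

end

text \<open>
  Measurability of \<open>X t\<close> with respect to \<open>info {..t}\<close> is causality: the state is a function of the
  present and past coefficients, hence independent of the future ones.
\<close>

locale stationary_recursion = affine_recursion +
  fixes X :: "int \<Rightarrow> 'a \<Rightarrow> real"
  assumes X_info: "\<And>t. X t \<in> borel_measurable (info {..t})"
    and X_nonneg: "\<And>t w. 0 \<le> X t w"
    and X_integrable: "\<And>t. integrable M (X t)"
    and X_ident: "\<And>t. distr M borel (X t) = distr M borel (X 0)"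
    and X_rec: "\<And>t. AE w in M. X t w = A t w * X (t - 1) w + B t w"
    and B_domain: "gaussian_domain M (B 0)"
    and B_square: "\<not> integrable M (\<lambda>w. (B 0 w)\<^sup>2)"
begin

definition m :: real where "m = (\<integral>w. X 0 w \<partial>M)"

lemma m_nonneg: "0 \<le> m" using X_nonneg by (simp add: m_def integral_nonneg_AE)

lemma X_measurable [measurable]: "X t \<in> borel_measurable M"
  by (rule info_measurable[OF X_info])

lemma integral_X:
  fixes g :: "real \<Rightarrow> 'b::{banach, second_countable_topology}"
  assumes [measurable]: "g \<in> borel_measurable borel"
  shows "(\<integral>w. g (X t w) \<partial>M) = (\<integral>w. g (X 0 w) \<partial>M)"
  using integral_distr[OF X_measurable[of t] assms] integral_distr[OF X_measurable[of 0] assms] X_ident[of t]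
  by simp

abbreviation "HX \<equiv> trunc_moment M (X 0)"
abbreviation "HB \<equiv> trunc_moment M (B 0)"

definition W :: "real \<Rightarrow> real" where "W x = (\<integral>w. lap (x * X 0 w) \<partial>M)"

lemma HB_measurable [measurable]: "HB \<in> borel_measurable borel"
  unfolding trunc_moment_def[abs_def] by measurable

lemma W_measurable [measurable]: "W \<in> borel_measurable borel"
  unfolding W_def[abs_def] by measurable

lemma X_lap_integrable: "0 \<le> x \<Longrightarrow> integrable M (\<lambda>w. lap (x * X t w))"
  using X_integrable X_nonneg by (intro lap_integrable) auto

lemma W_nonneg: "0 \<le> W x" by (simp add: W_def integral_nonneg_AE)

lemma W_le_HX: "0 \<le> x \<Longrightarrow> W x \<le> HX x"
  unfolding W_def trunc_moment_def using X_nonneg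
  by (intro integral_mono X_lap_integrable integrable_trunc_sq X_integrable lap_le_trunc_sq) auto

lemma HB_le: "0 \<le> x \<Longrightarrow> HB x \<le> x * \<mu>\<^sub>B"
  unfolding \<mu>\<^sub>B_def by (intro trunc_moment_le_linear B_integrable B_nonneg)

lemma HX_le: "0 \<le> x \<Longrightarrow> HX x \<le> x * m"
  unfolding m_def by (intro trunc_moment_le_linear X_integrable X_nonneg)

lemma HB_pos: "\<forall>\<^sub>F x in at_right 0. 0 < HB x"
  using B_domain by (simp add: gaussian_domain_def)

text \<open>
  In \<open>lap (l A X + l B) = lap (l A X) + lap (l B) + (1 - exp (- l A X)) (1 - exp (- l B))\<close> the last product
  is at most \<open>l\<^sup>2 A B X\<close>, and this has finite expectation by independence.
\<close>

lemma W_recursion: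
  assumes x: "0 \<le> x"
  shows "\<bar>W x - (\<integral>w. W (x * A 0 w) \<partial>M) - (\<integral>w. lap (x * B 0 w) \<partial>M)\<bar> \<le> m * \<mu> * \<mu>\<^sub>B * x\<^sup>2"
proof -
  let ?Y = "\<lambda>w. A 0 w * X (- 1) w"
  let ?c = "\<lambda>w. (1 - exp (- (x * ?Y w))) * (1 - exp (- (x * B 0 w)))"
  have indY: "indep_var borel (A 0) borel (X (- 1))"
    by (rule indep_info[where K="{0}" and K'="{..- 1}"]) (auto intro: info_A X_info)
  have mX: "(\<integral>w. X (- 1) w \<partial>M) = m" using integral_X[of "\<lambda>x. x" "- 1"] by (simp add: m_def)
  have Yi: "integrable M ?Y" using indep_var_integrable[OF indY] X_integrable by simp
  have Y0: "0 \<le> ?Y w" if "w \<in> space M" for w using that A_nonneg X_nonneg by simp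
  have iY: "integrable M (\<lambda>w. lap (x * ?Y w))" using Yi Y0 x by (intro lap_integrable) auto
  have iB: "integrable M (\<lambda>w. lap (x * B 0 w))" using B_nonneg x by (intro lap_integrable) auto
  have ic: "integrable M ?c"
    by (rule integrable_const_bound[where B=1])
      (use x Y0 B_nonneg in \<open>auto intro!: AE_I2 mult_le_one simp: abs_mult\<close>)
  have "W x = (\<integral>w. lap (x * ?Y w) + lap (x * B 0 w) + ?c w \<partial>M)"
    unfolding W_def
  proof (rule integral_cong_AE)
    show "AE w in M. lap (x * X 0 w) = lap (x * ?Y w) + lap (x * B 0 w) + ?c w"
      using X_rec[of 0] by eventually_elim (simp add: lap_add distrib_left)
  qed measurable
  also have "\<dots> = (\<integral>w. lap (x * ?Y w) \<partial>M) + (\<integral>w. lap (x * B 0 w) \<partial>M) + (\<integral>w. ?c w \<partial>M)"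
    using iY iB ic by simp
  also have "(\<integral>w. lap (x * ?Y w) \<partial>M) = (\<integral>w. (\<integral>w'. lap (x * (A 0 w * X (- 1) w')) \<partial>M) \<partial>M)"
    using indep_var_integral[OF indY, of "\<lambda>p. lap (x * (fst p * snd p))"] iY by simp
  also have "\<dots> = (\<integral>w. W (x * A 0 w) \<partial>M)"
    unfolding W_def using integral_X[of "\<lambda>y. lap (x * A 0 _ * y)" "- 1"]
    by (simp add: mult.assoc)
  finally have eq: "W x - (\<integral>w. W (x * A 0 w) \<partial>M) - (\<integral>w. lap (x * B 0 w) \<partial>M) = (\<integral>w. ?c w \<partial>M)"
    by simp
  have indAB: "indep_var borel (\<lambda>w. A 0 w * B 0 w) borel (X (- 1))"
    by (rule indep_info[where K="{0}" and K'="{..- 1}"])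
      (auto intro: info_A info_B X_info borel_measurable_times)
  have iAB: "integrable M (\<lambda>w. A 0 w * B 0 w)"
    by (rule indep_var_integrable[OF indep_A_B]) auto
  have "(\<integral>w. ?c w \<partial>M) \<le> (\<integral>w. x\<^sup>2 * (A 0 w * B 0 w * X (- 1) w) \<partial>M)"
  proof (rule integral_mono[OF ic])
    show "integrable M (\<lambda>w. x\<^sup>2 * (A 0 w * B 0 w * X (- 1) w))"
      using indep_var_integrable[OF indAB iAB X_integrable] by simp
    fix w assume w: "w \<in> space M"
    have 1: "1 - exp (- y) \<le> y" for y :: real using exp_ge_add_one_self[of "- y"] by linarith
    have "?c w \<le> (x * ?Y w) * (x * B 0 w)"
      using x Y0[OF w] B_nonneg[OF w] by (intro mult_mono 1) auto
    then show "?c w \<le> x\<^sup>2 * (A 0 w * B 0 w * X (- 1) w)"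
      by (simp add: power2_eq_square algebra_simps)
  qed
  also have "\<dots> = x\<^sup>2 * (\<mu> * \<mu>\<^sub>B * m)"
    using indep_var_lebesgue_integral[OF indAB iAB X_integrable]
      indep_var_lebesgue_integral[OF indep_A_B[of 0]] mX
    by (simp add: \<mu>_def \<mu>\<^sub>B_def)
  finally have "(\<integral>w. ?c w \<partial>M) \<le> m * \<mu> * \<mu>\<^sub>B * x\<^sup>2" by (simp add: algebra_simps)
  moreover have "0 \<le> (\<integral>w. ?c w \<partial>M)"
    using x Y0 B_nonneg by (intro integral_nonneg_AE AE_I2 mult_nonneg_nonneg) auto
  ultimately show ?thesis unfolding eq by simp
qed

lemma HB_A_le: 
  assumes "0 \<le> x"
  shows "integrable M (\<lambda>w. HB (x * A 0 w))" "(\<integral>w. HB (x * A 0 w) \<partial>M) \<le> (\<mu> + \<rho>) * HB x"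
proof -
  have le: "HB (x * A 0 w) \<le> A 0 w * HB x + (A 0 w)\<^sup>2 * HB x" if "w \<in> space M" for w
    using trunc_moment_scale[OF B_integrable A_nonneg[OF that, of 0], of x]
    by (simp add: mult.commute distrib_left)
  have i: "integrable M (\<lambda>w. A 0 w * HB x + (A 0 w)\<^sup>2 * HB x)"
    using A_power_integrable[of 2 0] by simp
  show *: "integrable M (\<lambda>w. HB (x * A 0 w))"
    by (rule Bochner_Integration.integrable_bound[OF i])
      (auto intro!: AE_I2 order_trans[OF le] simp: A_nonneg)
  have "(\<integral>w. HB (x * A 0 w) \<partial>M) \<le> (\<integral>w. A 0 w * HB x + (A 0 w)\<^sup>2 * HB x \<partial>M)"
    using * i le by (rule integral_mono)
  also have "\<dots> = (\<mu> + \<rho>) * HB x"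
    using A_power_integrable[of 2 0] by (simp add: \<mu>_def \<rho>_def distrib_right)
  finally show "(\<integral>w. HB (x * A 0 w) \<partial>M) \<le> (\<mu> + \<rho>) * HB x" .
qed

lemma HB_A_limit: "((\<lambda>x. (\<integral>w. HB (x * A 0 w) \<partial>M) / HB x) \<longlongrightarrow> \<rho>) (at_right 0)"
proof -
  have "((\<lambda>x. \<integral>w. HB (x * A 0 w) / HB x \<partial>M) \<longlongrightarrow> (\<integral>w. (A 0 w)\<^sup>2 \<partial>M)) (at_right 0)"
  proof (rule integral_dominated_convergence_at_right_0[where w="\<lambda>w. A 0 w + (A 0 w)\<^sup>2"])
    show "integrable M (\<lambda>w. A 0 w + (A 0 w)\<^sup>2)" using A_power_integrable[of 2 0] by simp
    show "AE w in M. ((\<lambda>x. HB (x * A 0 w) / HB x) \<longlongrightarrow> (A 0 w)\<^sup>2) (at_right 0)"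
      using gaussian_domain_scale_limit[OF B_domain A_nonneg] by (auto simp: mult.commute)
    show "\<forall>\<^sub>F x in at_right 0. AE w in M. norm (HB (x * A 0 w) / HB x) \<le> A 0 w + (A 0 w)\<^sup>2"
      using HB_pos
    proof eventually_elim
      case (elim x)
      show ?case
      proof (rule AE_I2)
        fix w assume "w \<in> space M"
        from trunc_moment_scale[OF B_integrable A_nonneg[OF this, of 0], of x] elim
        show "norm (HB (x * A 0 w) / HB x) \<le> A 0 w + (A 0 w)\<^sup>2"
          by (simp add: divide_le_eq mult.commute)
      qed
    qed
  qed measurable
  then show ?thesis by (simp add: \<rho>_def)
qed

lemma square_negligible_HB: "0 < c \<Longrightarrow> \<forall>\<^sub>F x in at_right 0. x\<^sup>2 \<le> c * HB x"
  by (rule square_negligible_of_infinite_second_moment[OF B_integrable B_nonneg B_square])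

lemma square_over_HB: "((\<lambda>x. x\<^sup>2 / HB x) \<longlongrightarrow> 0) (at_right 0)"
proof (rule tendstoI)
  fix e :: real assume "0 < e"
  then have "\<forall>\<^sub>F x in at_right 0. x\<^sup>2 \<le> e / 2 * HB x" by (intro square_negligible_HB) simp
  with HB_pos show "\<forall>\<^sub>F x in at_right 0. dist (x\<^sup>2 / HB x) 0 < e"
  proof eventually_elim
    case (elim x)
    then have "x\<^sup>2 / HB x \<le> e / 2" by (simp add: divide_le_eq)
    moreover have "dist (x\<^sup>2 / HB x) 0 = x\<^sup>2 / HB x" using elim by (simp add: dist_real_def)
    ultimately show ?case using \<open>0 < e\<close> by linarith
  qed
qed

lemma W_increment_limit: "((\<lambda>x. (W x - (\<integral>w. W (x * A 0 w) \<partial>M)) / HB x) \<longlongrightarrow> 1 / 2) (at_right 0)"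
proof -
  have lapB: "((\<lambda>x. (\<integral>w. lap (x * B 0 w) \<partial>M) / HB x) \<longlongrightarrow> 1 / 2) (at_right 0)"
    by (rule gaussian_domain_lap[OF B_domain])
  have "((\<lambda>x. (W x - (\<integral>w. W (x * A 0 w) \<partial>M)) / HB x - (\<integral>w. lap (x * B 0 w) \<partial>M) / HB x) \<longlongrightarrow> 0) (at_right 0)"
  proof (rule Lim_null_comparison)
    show "((\<lambda>x. m * \<mu> * \<mu>\<^sub>B * (x\<^sup>2 / HB x)) \<longlongrightarrow> 0) (at_right 0)"
      using tendsto_mult[OF tendsto_const square_over_HB] by simp
    have "\<forall>\<^sub>F x in at_right (0::real). 0 < x" by (simp add: eventually_at_right_less)
    with HB_pos
    show "\<forall>\<^sub>F x in at_right 0. norm ((W x - (\<integral>w. W (x * A 0 w) \<partial>M)) / HB x - (\<integral>w. lap (x * B 0 w) \<partial>M) / HB x)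
        \<le> m * \<mu> * \<mu>\<^sub>B * (x\<^sup>2 / HB x)"
    proof eventually_elim
      case (elim x)
      have "norm ((W x - (\<integral>w. W (x * A 0 w) \<partial>M)) / HB x - (\<integral>w. lap (x * B 0 w) \<partial>M) / HB x)
         = \<bar>W x - (\<integral>w. W (x * A 0 w) \<partial>M) - (\<integral>w. lap (x * B 0 w) \<partial>M)\<bar> / HB x"
        using elim by (simp add: abs_divide flip: diff_divide_distrib)
      also have "\<dots> \<le> m * \<mu> * \<mu>\<^sub>B * x\<^sup>2 / HB x"
        using W_recursion[of x] elim by (intro divide_right_mono) auto
      finally show ?case by simp
    qed
  qed
  from tendsto_add[OF this lapB] show ?thesis by simp
qed

lemma W_A_integrable: "0 \<le> x \<Longrightarrow> integrable M (\<lambda>w. W (x * A 0 w))"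
proof (rule Bochner_Integration.integrable_bound)
  show "integrable M (\<lambda>w. (x * m) * A 0 w)" by simp
  assume x: "0 \<le> x"
  show "AE w in M. norm (W (x * A 0 w)) \<le> norm ((x * m) * A 0 w)"
  proof (rule AE_I2)
    fix w assume "w \<in> space M"
    then have "0 \<le> x * A 0 w" using x A_nonneg by simp
    then have "W (x * A 0 w) \<le> x * A 0 w * m" using W_le_HX HX_le by (meson order_trans)
    then show "norm (W (x * A 0 w)) \<le> norm ((x * m) * A 0 w)"
      using W_nonneg[of "x * A 0 w"] by (simp add: algebra_simps)
  qed
qed measurable

text \<open>
  The difference \<open>D = W - k H\<^sub>B\<close> with \<open>k = 1 / (2 (1 - \<rho>))\<close> satisfies \<open>D(x) = E D(x A) + E(x)\<close> with
  \<open>E = o(H\<^sub>B)\<close>, because \<open>E H\<^sub>B(x A) \<sim> \<rho> H\<^sub>B(x)\<close>. The estimate of \<open>E\<close> holds only near 0, but far from 0 the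
  term \<open>x\<^sup>2\<close> dominates \<open>H\<^sub>B(x)\<close>, so \<open>\<bar>E(x)\<bar> \<le> \<eta> H\<^sub>B(x) + C x\<^sup>2\<close> for all \<open>x\<close>. For a fixed point \<open>l\<close> the
  right-hand side is majorized by a combination of \<open>x\<close> and \<open>x\<^sup>2\<close>, for which the averaging operator is
  explicit; the resulting supersolution bounds \<open>\<bar>D\<bar>\<close> by \<open>contraction_nonpos\<close>, and at \<open>x = l\<close> it is
  \<open>O(\<eta> H\<^sub>B(l)) + O(l\<^sup>2)\<close>.
\<close>

lemma W_limit: "((\<lambda>x. W x / HB x) \<longlongrightarrow> 1 / (2 * (1 - \<rho>))) (at_right 0)"
proof -
  define k where "k = 1 / (2 * (1 - \<rho>))"
  define c1 where "c1 = 1 / (1 - \<mu>)"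
  define c2 where "c2 = 1 / (1 - \<rho>)"
  have k: "0 < k" "k * (1 - \<rho>) = 1 / 2" using \<rho>_less_1 by (auto simp: k_def)
  have c: "0 < c1" "0 < c2" "c1 * (1 - \<mu>) = 1" "c2 * (1 - \<rho>) = 1"
    using \<rho>_less_1 \<mu>_less_1 by (auto simp: c1_def c2_def)
  define D where "D x = W x - k * HB x" for x
  have [measurable]: "D \<in> borel_measurable borel" unfolding D_def[abs_def] by measurable
  define E where "E x = D x - (\<integral>w. D (x * A 0 w) \<partial>M)" for x
  have iD: "integrable M (\<lambda>w. D (x * A 0 w))" if "0 \<le> x" for x
    unfolding D_def using that W_A_integrable HB_A_le by simp
  have E_eq: "E x = (W x - (\<integral>w. W (x * A 0 w) \<partial>M)) - k * (HB x - (\<integral>w. HB (x * A 0 w) \<partial>M))"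
    if "0 \<le> x" for x
    unfolding E_def D_def using that W_A_integrable HB_A_le by (simp add: algebra_simps)
  have D_bound: "\<bar>D x\<bar> \<le> (m + k * \<mu>\<^sub>B) * x" if "0 \<le> x" for x
  proof -
    have "W x \<le> x * m" using W_le_HX[OF that] HX_le[OF that] by simp
    moreover have "k * HB x \<le> k * (x * \<mu>\<^sub>B)" using HB_le[OF that] k by simp
    moreover have "0 \<le> W x" "0 \<le> k * HB x" using W_nonneg k by auto
    ultimately show ?thesis by (simp add: D_def algebra_simps)
  qed
  have E_lim: "((\<lambda>x. E x / HB x) \<longlongrightarrow> 0) (at_right 0)"
  proof -
    have "((\<lambda>x. (W x - (\<integral>w. W (x * A 0 w) \<partial>M)) / HB x - k * (1 - (\<integral>w. HB (x * A 0 w) \<partial>M) / HB x))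
        \<longlongrightarrow> 1 / 2 - k * (1 - \<rho>)) (at_right 0)"
      by (intro tendsto_intros W_increment_limit HB_A_limit)
    moreover have "1 / 2 - k * (1 - \<rho>) = 0" using k by simp
    moreover have "\<forall>\<^sub>F x in at_right 0. (W x - (\<integral>w. W (x * A 0 w) \<partial>M)) / HB x
        - k * (1 - (\<integral>w. HB (x * A 0 w) \<partial>M) / HB x) = E x / HB x"
      using HB_pos eventually_at_right_less[of "0::real"]
      by eventually_elim (simp add: E_eq diff_divide_distrib right_diff_distrib)
    ultimately show ?thesis by (auto elim: Lim_transform_eventually)
  qed
  define C where "C = m * \<mu> * \<mu>\<^sub>B"
  define C2 where "C2 = 1 + k * (1 + \<mu> + \<rho>)"
  have C: "0 \<le> C" "0 \<le> C2" using m_nonneg \<mu>_nonneg \<mu>\<^sub>B_nonneg \<rho>_nonneg k by (auto simp: C_def C2_def)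
  have E_bound: "\<bar>E x\<bar> \<le> C2 * HB x + C * x\<^sup>2" if x: "0 \<le> x" for x
  proof -
    have 1: "\<bar>W x - (\<integral>w. W (x * A 0 w) \<partial>M)\<bar> \<le> HB x + C * x\<^sup>2"
    proof -
      have "(\<integral>w. lap (x * B 0 w) \<partial>M) \<le> HB x"
        unfolding trunc_moment_def using x B_nonneg
        by (intro integral_mono lap_integrable integrable_trunc_sq lap_le_trunc_sq) auto
      moreover have "0 \<le> (\<integral>w. lap (x * B 0 w) \<partial>M)" by (simp add: integral_nonneg_AE)
      ultimately show ?thesis using W_recursion[OF x] unfolding C_def by linarith
    qed
    have 2: "\<bar>HB x - (\<integral>w. HB (x * A 0 w) \<partial>M)\<bar> \<le> (1 + \<mu> + \<rho>) * HB x"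
    proof -
      have "0 \<le> (\<integral>w. HB (x * A 0 w) \<partial>M)" by (simp add: integral_nonneg_AE)
      moreover have "0 \<le> HB x" by simp
      moreover have "(1 + \<mu> + \<rho>) * HB x = HB x + (\<mu> + \<rho>) * HB x" by (simp add: algebra_simps)
      moreover have "0 \<le> (\<mu> + \<rho>) * HB x" using \<mu>_nonneg \<rho>_nonneg by simp
      ultimately show ?thesis using HB_A_le(2)[OF x] by linarith
    qed
    have tri: "\<bar>a - k * b\<bar> \<le> \<bar>a\<bar> + k * \<bar>b\<bar>" for a b
      using abs_triangle_ineq4[of a "k * b"] k by (simp add: abs_mult)
    have "\<bar>E x\<bar> \<le> (HB x + C * x\<^sup>2) + k * ((1 + \<mu> + \<rho>) * HB x)"
      unfolding E_eq[OF x] using k by (intro order_trans[OF tri] add_mono 1 mult_left_mono 2) auto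
    then show ?thesis by (simp add: C2_def algebra_simps)
  qed
  have main: "\<forall>\<^sub>F x in at_right 0. \<bar>D x\<bar> \<le> \<eta> * (c1 + c2 + 1) * HB x" if \<eta>: "0 < \<eta>" for \<eta>
  proof -
    have "\<forall>\<^sub>F x in at_right 0. \<bar>E x / HB x\<bar> < \<eta>"
      using tendstoD[OF E_lim \<eta>] by simp
    with HB_pos have "\<forall>\<^sub>F x in at_right 0. \<bar>E x\<bar> \<le> \<eta> * HB x"
      by eventually_elim (simp add: abs_divide divide_less_eq)
    then obtain x0 where x0: "0 < x0" "\<And>x. 0 < x \<Longrightarrow> x < x0 \<Longrightarrow> \<bar>E x\<bar> \<le> \<eta> * HB x"
      unfolding eventually_at_right_field by auto
    define C\<eta> where "C\<eta> = C2 * (\<mu>\<^sub>B / x0) + C"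
    have C\<eta>: "0 \<le> C\<eta>" using C \<mu>\<^sub>B_nonneg x0 by (simp add: C\<eta>_def)
    have E_le: "\<bar>E x\<bar> \<le> \<eta> * HB x + C\<eta> * x\<^sup>2" if x: "0 \<le> x" for x
    proof -
      consider "x = 0" | "0 < x" "x < x0" | "x0 \<le> x" using x by linarith
      then show ?thesis
      proof cases
        case 1
        then show ?thesis using E_bound[of 0] HB_le[of 0] trunc_moment_nonneg[of M "B 0" 0] by simp
      next
        case 2
        have "0 \<le> C\<eta> * x\<^sup>2" using C\<eta> by simp
        with x0(2)[OF 2] show ?thesis by linarith
      next
        case 3
        have "HB x \<le> x * \<mu>\<^sub>B" by (rule HB_le[OF x])
        also have "\<dots> \<le> \<mu>\<^sub>B / x0 * x\<^sup>2"
          using 3 x0 \<mu>\<^sub>B_nonneg x mult_right_mono[OF 3, of "x * \<mu>\<^sub>B"]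
          by (simp add: field_simps power2_eq_square)
        finally have "C2 * HB x \<le> C2 * (\<mu>\<^sub>B / x0 * x\<^sup>2)" using C by (intro mult_left_mono)
        moreover have "0 \<le> \<eta> * HB x" using \<eta> by simp
        ultimately show ?thesis using E_bound[OF x] by (simp add: C\<eta>_def algebra_simps)
      qed
    qed
    have D_le: "\<bar>D l\<bar> \<le> \<eta> * HB l * (c1 + c2) + C\<eta> * c2 * l\<^sup>2" if l: "0 < l" for l
    proof -
      define a where "a = \<eta> * HB l * c1 / l"
      define b where "b = \<eta> * HB l * c2 / l\<^sup>2 + C\<eta> * c2"
      define F where "F x = a * x + b * x\<^sup>2" for x
      have [measurable]: "F \<in> borel_measurable borel" unfolding F_def[abs_def] by measurable
      have ab: "0 \<le> a" "0 \<le> b" using \<eta> l c C\<eta> by (auto simp: a_def b_def)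
      have iF: "integrable M (\<lambda>w. F (x * A 0 w))" for x
        unfolding F_def using A_power_integrable[of 2 0] by (simp add: power_mult_distrib)
      have F_int: "(\<integral>w. F (x * A 0 w) \<partial>M) = a * x * \<mu> + b * x\<^sup>2 * \<rho>" for x
        unfolding F_def using A_power_integrable[of 2 0]
        by (simp add: power_mult_distrib \<mu>_def \<rho>_def mult.assoc)
      \<comment> \<open>The coefficients \<open>c1\<close> and \<open>c2\<close> in \<open>F\<close> compensate the factors \<open>1 - \<mu>\<close> and \<open>1 - \<rho>\<close> of the operator.\<close>
      have super: "\<bar>E x\<bar> \<le> F x - (\<integral>w. F (x * A 0 w) \<partial>M)" if x: "0 \<le> x" for x
      proof -
        have "HB x = HB (x / l * l)" using l by simp
        also have "\<dots> \<le> (x / l + (x / l)\<^sup>2) * HB l"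
          using x l by (intro trunc_moment_scale B_integrable) auto
        finally have "\<eta> * HB x \<le> \<eta> * ((x / l + (x / l)\<^sup>2) * HB l)" using \<eta> by simp
        moreover have "F x - (\<integral>w. F (x * A 0 w) \<partial>M) = a * (1 - \<mu>) * x + b * (1 - \<rho>) * x\<^sup>2"
          unfolding F_int by (simp add: F_def algebra_simps)
        moreover have "a * (1 - \<mu>) = \<eta> * HB l / l"
        proof -
          have "a * (1 - \<mu>) = \<eta> * HB l / l * (c1 * (1 - \<mu>))" by (simp add: a_def)
          then show ?thesis using c by simp
        qed
        moreover have "b * (1 - \<rho>) = \<eta> * HB l / l\<^sup>2 + C\<eta>"
        proof -
          have "b * (1 - \<rho>) = (\<eta> * HB l / l\<^sup>2 + C\<eta>) * (c2 * (1 - \<rho>))" by (simp add: b_def algebra_simps)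
          then show ?thesis using c by simp
        qed
        moreover have "\<eta> * ((x / l + (x / l)\<^sup>2) * HB l) = \<eta> * HB l / l * x + \<eta> * HB l / l\<^sup>2 * x\<^sup>2"
          by (simp add: power_divide algebra_simps)
        ultimately show ?thesis using E_le[OF x] by (simp add: distrib_right)
      qed
      have step: "s * D l - F l \<le> 0" if s: "\<bar>s\<bar> = 1" for s :: real
      proof (rule contraction_nonpos[where D="\<lambda>x. s * D x - F x" and K="m + k * \<mu>\<^sub>B + a + b"])
        fix x :: real assume x: "0 \<le> x"
        have "\<bar>s * D x\<bar> \<le> (m + k * \<mu>\<^sub>B) * x" using D_bound[OF x] s by (simp add: abs_mult)
        moreover have "0 \<le> a * x" "0 \<le> b * x" "0 \<le> b * x\<^sup>2" "0 \<le> a * x\<^sup>2" "0 \<le> (m + k * \<mu>\<^sub>B) * x\<^sup>2"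
          using ab x m_nonneg k \<mu>\<^sub>B_nonneg by auto
        ultimately show "\<bar>s * D x - F x\<bar> \<le> (m + k * \<mu>\<^sub>B + a + b) * (x + x\<^sup>2)"
          unfolding F_def by (simp add: algebra_simps)
        have "s * E x \<le> \<bar>E x\<bar>" using s by (cases "s = 1") (auto simp: abs_if split: if_splits)
        with super[OF x] have "s * E x \<le> F x - (\<integral>w. F (x * A 0 w) \<partial>M)" by linarith
        then show "s * D x - F x \<le> (\<integral>w. s * D (x * A 0 w) - F (x * A 0 w) \<partial>M)"
          using iD[OF x] iF[of x] by (simp add: E_def algebra_simps)
      qed (use l in auto)
      have "\<bar>D l\<bar> \<le> F l" using step[of 1] step[of "- 1"] by simp
      also have "F l = \<eta> * HB l * (c1 + c2) + C\<eta> * c2 * l\<^sup>2"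
        using l by (simp add: F_def a_def b_def algebra_simps power2_eq_square)
      finally show ?thesis .
    qed
    have "0 < \<eta> / (C\<eta> * c2 + 1)" using \<eta> C\<eta> c by (intro divide_pos_pos add_nonneg_pos) auto
    from square_negligible_HB[OF this] eventually_at_right_less[of "0::real"]
    show ?thesis
    proof eventually_elim
      case (elim l)
      have "C\<eta> * c2 * l\<^sup>2 \<le> (C\<eta> * c2 + 1) * l\<^sup>2" by (simp add: distrib_right)
      also have "\<dots> \<le> (C\<eta> * c2 + 1) * (\<eta> / (C\<eta> * c2 + 1) * HB l)"
        using elim C\<eta> c by (intro mult_left_mono) auto
      also have "\<dots> = \<eta> * HB l"
      proof -
        have "0 < C\<eta> * c2 + 1" using C\<eta> c by (intro add_nonneg_pos) auto
        then show ?thesis by simp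
      qed
      finally show ?case using D_le[of l] elim by (simp add: algebra_simps)
    qed
  qed
  have "((\<lambda>x. D x / HB x) \<longlongrightarrow> 0) (at_right 0)"
  proof (rule tendstoI)
    fix e :: real assume e: "0 < e"
    have pos: "0 < c1 + c2 + 1" using c by simp
    have "\<forall>\<^sub>F x in at_right 0. \<bar>D x\<bar> \<le> e / 2 / (c1 + c2 + 1) * (c1 + c2 + 1) * HB x"
      using e pos by (intro main) simp
    with HB_pos show "\<forall>\<^sub>F x in at_right 0. dist (D x / HB x) 0 < e"
    proof eventually_elim
      case (elim x)
      have "e / 2 / (c1 + c2 + 1) * (c1 + c2 + 1) = e / 2"
        using pos by (metis less_irrefl nonzero_divide_eq_eq)
      then have "\<bar>D x\<bar> \<le> e / 2 * HB x" using elim by (simp only:)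
      also have "\<dots> < e * HB x" using e elim by simp
      finally show ?case using elim by (simp add: abs_divide divide_less_eq)
    qed
  qed
  then have "((\<lambda>x. D x / HB x + k) \<longlongrightarrow> 0 + k) (at_right 0)" by (intro tendsto_intros)
  moreover have "\<forall>\<^sub>F x in at_right 0. D x / HB x + k = W x / HB x"
    using HB_pos by eventually_elim (simp add: D_def diff_divide_distrib)
  ultimately show ?thesis by (auto simp: k_def elim: Lim_transform_eventually)
qed

lemma W_scale_limit:
  assumes p: "0 < p" shows "((\<lambda>x. W (p * x) / HB x) \<longlongrightarrow> p\<^sup>2 / (2 * (1 - \<rho>))) (at_right 0)"
proof -
  have f: "filterlim (\<lambda>l. p * l) (at_right 0) (at_right (0::real))"
    unfolding filterlim_at using p
    by (auto simp: eventually_at_filter zero_less_mult_iff intro!: tendsto_eq_intros)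
  have "((\<lambda>x. W (p * x) / HB (p * x) * (HB (p * x) / HB x)) \<longlongrightarrow> 1 / (2 * (1 - \<rho>)) * p\<^sup>2) (at_right 0)"
    using p by (intro tendsto_mult gaussian_domain_scale_limit[OF B_domain] filterlim_compose[OF W_limit f]) simp
  moreover have "\<forall>\<^sub>F x in at_right 0. W (p * x) / HB (p * x) * (HB (p * x) / HB x) = W (p * x) / HB x"
    using at_right_0_scale[OF HB_pos p] HB_pos by eventually_elim simp
  ultimately show ?thesis by (auto elim: Lim_transform_eventually)
qed

text \<open>
  As \<open>W(2 l) - W(4 l) / 4 = o(H\<^sub>B(l))\<close>, the second difference of \<open>lap\<close> makes the tail negligible.
\<close>

lemma X_domain: "gaussian_domain M (X 0)"
proof -
  define k where "k = 1 / (2 * (1 - \<rho>))"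
  have k: "0 < k" using \<rho>_less_1 by (simp add: k_def)
  let ?T = "\<lambda>l. \<integral>w. (if 1 < l * X 0 w then l * X 0 w else 0) \<partial>M"
  have pos: "\<forall>\<^sub>F x in at_right (0::real). 0 < x" by (simp add: eventually_at_right_less)
  have "\<forall>\<^sub>F x in at_right 0. k / 2 < W x / HB x"
    using order_tendstoD(1)[OF W_limit[folded k_def], of "k / 2"] k by simp
  with HB_pos pos have HX_ge: "\<forall>\<^sub>F x in at_right 0. k / 2 * HB x \<le> HX x"
  proof eventually_elim
    case (elim x)
    then have "k / 2 * HB x \<le> W x" by (simp add: less_divide_eq)
    with W_le_HX[of x] elim show ?case by simp
  qed
  have HX_pos: "\<forall>\<^sub>F x in at_right 0. 0 < HX x"
    using HX_ge HB_pos
  proof eventually_elim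
    case (elim x)
    have "0 < k / 2 * HB x" using elim k by simp
    with elim show ?case by linarith
  qed
  have T_le: "?T l \<le> 4 * (W (2 * l) - W (4 * l) / 4)" if l: "0 < l" for l
  proof -
    have "?T l \<le> (\<integral>w. 4 * (lap (2 * l * X 0 w) - lap (4 * l * X 0 w) / 4) \<partial>M)"
    proof (rule integral_mono)
      show "integrable M (\<lambda>w. if 1 < l * X 0 w then l * X 0 w else 0)"
        by (rule Bochner_Integration.integrable_bound[of M "\<lambda>w. l * X 0 w"])
          (use X_integrable in auto)
      show "integrable M (\<lambda>w. 4 * (lap (2 * l * X 0 w) - lap (4 * l * X 0 w) / 4))"
        using X_lap_integrable[of "2 * l" 0] X_lap_integrable[of "4 * l" 0] l by simp
      fix w assume "w \<in> space M"
      have y: "0 \<le> 2 * l * X 0 w" using l X_nonneg by simp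
      have le: "(if 1 < y / 2 then y / 2 else 0) \<le> 4 * (lap y - lap (2 * y) / 4)" if "0 \<le> y" for y
        using lap_second_difference[OF that] by auto
      have "2 * l * X 0 w / 2 = l * X 0 w" "2 * (2 * l * X 0 w) = 4 * l * X 0 w" by simp_all
      with le[OF y] 
      show "(if 1 < l * X 0 w then l * X 0 w else 0) \<le> 4 * (lap (2 * l * X 0 w) - lap (4 * l * X 0 w) / 4)"
        by (simp only:)
    qed
    also have "\<dots> = 4 * (W (2 * l) - W (4 * l) / 4)"
      using X_lap_integrable[of "2 * l" 0] X_lap_integrable[of "4 * l" 0] l by (simp add: W_def)
    finally show ?thesis .
  qed
  have lim: "((\<lambda>l. 8 / k * (W (2 * l) / HB l - W (4 * l) / HB l / 4)) \<longlongrightarrow> 8 / k * (2\<^sup>2 / (2 * (1 - \<rho>)) - 4\<^sup>2 / (2 * (1 - \<rho>)) / 4)) (at_right 0)"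
    by (intro tendsto_intros W_scale_limit) auto
  have "((\<lambda>l. ?T l / HX l) \<longlongrightarrow> 0) (at_right 0)"
  proof (rule Lim_null_comparison)
    show "((\<lambda>l. 8 / k * (W (2 * l) / HB l - W (4 * l) / HB l / 4)) \<longlongrightarrow> 0) (at_right 0)"
    proof -
      have "8 / k * (2\<^sup>2 / d - 4\<^sup>2 / d / 4) = 0" for d :: real by simp
      with lim show ?thesis by (simp only:)
    qed
    show "\<forall>\<^sub>F l in at_right 0. norm (?T l / HX l) \<le> 8 / k * (W (2 * l) / HB l - W (4 * l) / HB l / 4)"
      using HX_ge HX_pos HB_pos pos
    proof eventually_elim
      case (elim l)
      have T0: "0 \<le> ?T l" using elim by (intro integral_nonneg_AE) auto
      have "norm (?T l / HX l) = ?T l / HX l" using T0 elim by simp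
      also have "\<dots> \<le> ?T l / (k / 2 * HB l)"
        using T0 elim k by (intro divide_left_mono) auto
      also have "\<dots> \<le> 4 * (W (2 * l) - W (4 * l) / 4) / (k / 2 * HB l)"
        using T_le[of l] elim k by (intro divide_right_mono) auto
      also have "\<dots> = 8 / k * (W (2 * l) / HB l - W (4 * l) / HB l / 4)"
        using elim k by (simp add: field_simps)
      finally show ?case .
    qed
  qed
  then show ?thesis
    using X_integrable X_nonneg HX_pos by (auto simp: gaussian_domain_def)
qed

lemma HX_pos: "\<forall>\<^sub>F x in at_right 0. 0 < HX x"
  using X_domain by (simp add: gaussian_domain_def)

lemma HB_over_HX: "((\<lambda>x. HB x / HX x) \<longlongrightarrow> 1 - \<rho>) (at_right 0)"
proof -
  have "((\<lambda>x. W x / HX x) \<longlongrightarrow> 1 / 2) (at_right 0)"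
    unfolding W_def by (rule gaussian_domain_lap[OF X_domain])
  then have lim: "((\<lambda>x. (W x / HX x) / (W x / HB x)) \<longlongrightarrow> (1 / 2) / (1 / (2 * (1 - \<rho>)))) (at_right 0)"
    by (rule tendsto_divide[OF _ W_limit]) (use \<rho>_less_1 in simp_all)
  have "\<forall>\<^sub>F x in at_right 0. 0 < W x / HB x"
    using order_tendstoD(1)[OF W_limit, of 0] \<rho>_less_1 by simp
  with HB_pos HX_pos have ev: "\<forall>\<^sub>F x in at_right 0. (W x / HX x) / (W x / HB x) = HB x / HX x"
    by eventually_elim (auto simp: field_simps)
  have "(1 / 2) / (1 / (2 * (1 - \<rho>))) = 1 - \<rho>" by (simp add: field_simps)
  with Lim_transform_eventually[OF lim ev] show ?thesis by (simp only:)
qed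

end

section \<open>Characteristic functions of the martingale differences\<close>

lemma iexp_add: "iexp (x + y) = iexp x * iexp y"
  by (simp add: distrib_left exp_add)

lemma iexp_0_approx: "cmod (iexp x - 1) \<le> \<bar>x\<bar>"
  using iexp_approx1[of x 0] by simp

lemma iexp_1_approx: "cmod (iexp x - 1 - \<i> * x) \<le> x\<^sup>2 / 2"
  using iexp_approx1[of x 1] by (simp add: numeral_2_eq_2 diff_diff_eq)

lemma iexp_1_approx_linear: "cmod (iexp x - 1 - \<i> * x) \<le> 2 * \<bar>x\<bar>"
  using iexp_approx2[of x 1] by (simp add: diff_diff_eq)

lemma iexp_2_approx: "cmod (iexp x - 1 - \<i> * x + complex_of_real (x\<^sup>2 / 2)) \<le> \<bar>x\<bar> ^ 3 / 6"
proof -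
  have "(\<Sum>k\<le>2. (\<i> * complex_of_real x) ^ k / fact k) = 1 + \<i> * x - complex_of_real (x\<^sup>2 / 2)"
  proof -
    have "(\<Sum>k\<le>2. f k) = f 0 + f 1 + f 2" for f :: "nat \<Rightarrow> complex" by (simp add: numeral_2_eq_2)
    then show ?thesis by (simp add: power_mult_distrib)
  qed
  moreover have "fact (Suc 2) = (6 :: real)" by (simp add: eval_nat_numeral)
  ultimately show ?thesis using iexp_approx1[of x 2] by (simp add: algebra_simps eval_nat_numeral)
qed

lemma iexp_lipschitz: "cmod (iexp x - iexp y) \<le> \<bar>x - y\<bar>"
proof -
  have "iexp x = iexp y * iexp (x - y)" by (simp only: iexp_add[symmetric]) simp
  then have "iexp x - iexp y = iexp y * (iexp (x - y) - 1)" by (simp only: right_diff_distrib mult_1_right)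
  then have "cmod (iexp x - iexp y) = cmod (iexp (x - y) - 1)"
    by (simp only: norm_mult norm_exp_i_times mult_1_left)
  then show ?thesis using iexp_0_approx[of "x - y"] by (simp only:)
qed

text \<open>
  Factoring out \<open>iexp y\<close> leaves the second order remainder at \<open>x - y\<close> and the first order remainder
  at \<open>y\<close>; the constant in the minimum comes from the Lipschitz bound.
\<close>

lemma iexp_diff_approx:
  "cmod (iexp x - iexp y - \<i> * complex_of_real (x - y)) \<le> 2 * \<bar>x - y\<bar> * min 1 (\<bar>x\<bar> + \<bar>y\<bar>)"
proof -
  have e: "iexp x = iexp y * iexp (x - y)" by (simp only: iexp_add[symmetric]) simp
  note n1 = iexp_lipschitz[of x y]
  have n2: "cmod (\<i> * complex_of_real (x - y)) = \<bar>x - y\<bar>" by (simp add: norm_mult del: of_real_diff)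
  have aux: "a \<le> 2 * d" if "a \<le> b + c" "b \<le> d" "c = d" for a b c d :: real using that by linarith
  have 1: "cmod (iexp x - iexp y - \<i> * complex_of_real (x - y)) \<le> 2 * \<bar>x - y\<bar>"
    by (rule aux[OF norm_triangle_ineq4 n1 n2])
  have "iexp x - iexp y - \<i> * complex_of_real (x - y)
      = iexp y * (iexp (x - y) - 1 - \<i> * complex_of_real (x - y)) + \<i> * complex_of_real (x - y) * (iexp y - 1)"
    unfolding e by (simp add: algebra_simps)
  then have "cmod (iexp x - iexp y - \<i> * complex_of_real (x - y))
      \<le> cmod (iexp y * (iexp (x - y) - 1 - \<i> * complex_of_real (x - y)))
        + cmod (\<i> * complex_of_real (x - y) * (iexp y - 1))"
    by (simp only: norm_triangle_ineq)
  also have "\<dots> \<le> (x - y)\<^sup>2 / 2 + \<bar>x - y\<bar> * \<bar>y\<bar>"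
    using iexp_1_approx[of "x - y"] iexp_0_approx[of y]
    by (intro add_mono) (auto simp: norm_mult intro!: mult_left_mono simp del: of_real_diff)
  also have "\<dots> = \<bar>x - y\<bar> * (\<bar>x - y\<bar> / 2 + \<bar>y\<bar>)"
    by (simp add: distrib_left power2_eq_square flip: abs_mult)
  also have "\<dots> \<le> \<bar>x - y\<bar> * (2 * (\<bar>x\<bar> + \<bar>y\<bar>))"
    by (intro mult_left_mono) auto
  finally have "cmod (iexp x - iexp y - \<i> * complex_of_real (x - y)) \<le> 2 * \<bar>x - y\<bar> * (\<bar>x\<bar> + \<bar>y\<bar>)"
    by (simp only: mult.assoc mult.left_commute)
  with 1 show ?thesis by (auto simp: min_def)
qed

lemma iexp_second_order_limit:
  "((\<lambda>y. (iexp (c * y) - 1 - \<i> * complex_of_real (c * y)) /\<^sub>R y\<^sup>2) \<longlongrightarrow> - complex_of_real (c\<^sup>2 / 2)) (at_right 0)"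
proof (rule Lim_null[THEN iffD2], rule Lim_null_comparison)
  show "((\<lambda>y. \<bar>c\<bar> ^ 3 / 6 * y) \<longlongrightarrow> 0) (at_right (0::real))"
    by (auto intro!: tendsto_eq_intros)
  have pos: "\<forall>\<^sub>F y in at_right (0::real). 0 < y" by (simp add: eventually_at_right_less)
  show "\<forall>\<^sub>F y in at_right 0. cmod ((iexp (c * y) - 1 - \<i> * complex_of_real (c * y)) /\<^sub>R y\<^sup>2 - - complex_of_real (c\<^sup>2 / 2))
      \<le> \<bar>c\<bar> ^ 3 / 6 * y"
    using pos
  proof eventually_elim
    case (elim y)
    have "complex_of_real (c\<^sup>2 / 2) = complex_of_real ((c * y)\<^sup>2 / 2) /\<^sub>R y\<^sup>2"
      using elim by (simp add: scaleR_conv_of_real power_mult_distrib)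
    then have "cmod ((iexp (c * y) - 1 - \<i> * complex_of_real (c * y)) /\<^sub>R y\<^sup>2 - - complex_of_real (c\<^sup>2 / 2))
       = cmod ((iexp (c * y) - 1 - \<i> * complex_of_real (c * y) + complex_of_real ((c * y)\<^sup>2 / 2)) /\<^sub>R y\<^sup>2)"
      by (simp only: minus_minus diff_minus_eq_add scaleR_add_right)
    also have "\<dots> = inverse (y\<^sup>2) *
        cmod (iexp (c * y) - 1 - \<i> * complex_of_real (c * y) + complex_of_real ((c * y)\<^sup>2 / 2))"
      by (simp only: norm_scaleR abs_inverse abs_power2)
    also have "\<dots> \<le> inverse (y\<^sup>2) * (\<bar>c * y\<bar> ^ 3 / 6)"
      by (intro mult_left_mono iexp_2_approx) simp
    also have "\<dots> = \<bar>c\<bar> ^ 3 / 6 * y"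
    proof -
      have "inverse (y\<^sup>2) * ((\<bar>c\<bar> * y) ^ 3 / 6) = \<bar>c\<bar> ^ 3 / 6 * y"
        using elim by (simp only: power_mult_distrib) (simp add: field_simps power3_eq_cube power2_eq_square)
      then show ?thesis using elim by (simp only: abs_mult abs_of_pos)
    qed
    finally show ?case .
  qed
qed

lemma iexp_remainder_bound:
  assumes "0 \<le> y"
  shows "cmod (iexp (u * y) - 1 - \<i> * complex_of_real (u * y)) \<le> (u\<^sup>2 + 2 * \<bar>u\<bar>) * trunc_sq y"
proof (cases "y \<le> 1")
  case True
  have "cmod (iexp (u * y) - 1 - \<i> * complex_of_real (u * y)) \<le> (u * y)\<^sup>2 / 2" by (rule iexp_1_approx)
  also have "\<dots> = u\<^sup>2 / 2 * y\<^sup>2" by (simp add: power_mult_distrib)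
  also have "\<dots> \<le> (u\<^sup>2 + 2 * \<bar>u\<bar>) * y\<^sup>2" by (intro mult_right_mono) auto
  finally show ?thesis using True assms by (simp add: trunc_sq_small)
next
  case False
  have "cmod (iexp (u * y) - 1 - \<i> * complex_of_real (u * y)) \<le> 2 * \<bar>u * y\<bar>" by (rule iexp_1_approx_linear)
  also have "\<dots> = (2 * \<bar>u\<bar>) * y" using assms by (simp add: abs_mult)
  also have "\<dots> \<le> (u\<^sup>2 + 2 * \<bar>u\<bar>) * y" using assms by (intro mult_right_mono) auto
  finally show ?thesis using False by (simp add: trunc_sq_large)
qed

lemma integrable_iexp_times:
  fixes f :: "'a \<Rightarrow> complex"
  assumes "integrable M f" and [measurable]: "g \<in> borel_measurable M"
  shows "integrable M (\<lambda>w. iexp (g w) * f w)"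
proof (rule Bochner_Integration.integrable_bound[OF assms(1)])
  have [measurable]: "f \<in> borel_measurable M" using assms by auto
  show "(\<lambda>w. iexp (g w) * f w) \<in> borel_measurable M" by measurable
qed (simp add: norm_mult)

lemma (in prob_space) norm_integral_iexp_le_1: "cmod (\<integral>w. iexp (g w) \<partial>M) \<le> 1"
proof (cases "integrable M (\<lambda>w. iexp (g w))")
  case True
  have "cmod (\<integral>w. iexp (g w) \<partial>M) \<le> (\<integral>w. cmod (iexp (g w)) \<partial>M)" by (rule integral_norm_bound)
  also have "\<dots> = 1" by (simp add: prob_space)
  finally show ?thesis .
qed (simp add: not_integrable_integral_eq)

lemma (in prob_space) integrable_iexp_real: 
  assumes [measurable]: "random_variable borel g" shows "integrable M (\<lambda>w. iexp (g w))"
  by (rule integrable_const_bound[where B=1]) auto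

context stationary_recursion
begin

text \<open>
  The terms \<open>D k\<close> are the martingale differences of the introduction. For \<open>t \<le> 0\<close> the sum
  \<open>mart t\<close> is empty, so lags reaching beyond time 0 need no separate treatment.
\<close>

definition D :: "int \<Rightarrow> 'a \<Rightarrow> real" where
  "D k w = X k w - \<mu> * X (k - 1) w - \<mu>\<^sub>B"

definition mart :: "int \<Rightarrow> 'a \<Rightarrow> real" where
  "mart t w = (\<Sum>k\<in>{1..t}. D k w)"

lemma D_info: "k \<le> t \<Longrightarrow> D k \<in> borel_measurable (info {..t})"
  unfolding D_def[abs_def]
  by (intro borel_measurable_diff borel_measurable_times borel_measurable_const info_mono[OF X_info]) auto

lemma mart_info: "mart t \<in> borel_measurable (info {..t})"
  unfolding mart_def[abs_def] by (intro borel_measurable_sum D_info) auto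

lemma D_measurable [measurable]: "D k \<in> borel_measurable M"
  by (rule info_measurable[OF D_info[OF order_refl]])

lemma mart_measurable [measurable]: "mart t \<in> borel_measurable M"
  by (rule info_measurable[OF mart_info])

lemma D_eq: "AE w in M. D t w = (A t w - \<mu>) * X (t - 1) w + (B t w - \<mu>\<^sub>B)"
  using X_rec[of t] by eventually_elim (simp add: D_def algebra_simps)

lemma mart_step: "1 \<le> t \<Longrightarrow> mart t w = mart (t - 1) w + D t w"
proof -
  assume "1 \<le> t"
  then have "{1..t} = insert t {1..t - 1}" by auto
  then show ?thesis by (simp add: mart_def)
qed

lemma D_le: "\<bar>D k w\<bar> \<le> X k w + X (k - 1) w + \<mu>\<^sub>B"
proof -
  have "0 \<le> \<mu> * X (k - 1) w" "\<mu> * X (k - 1) w \<le> X (k - 1) w"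
    using \<mu>_nonneg \<mu>_less_1 X_nonneg mult_right_mono[of \<mu> 1 "X (k - 1) w"] by auto
  then show ?thesis using X_nonneg[of k w] X_nonneg[of "k - 1" w] \<mu>\<^sub>B_nonneg by (simp add: D_def abs_le_iff)
qed

lemma mart_diff_le:
  "\<bar>mart t w - mart (t - int q) w\<bar> \<le> (\<Sum>j<q. \<bar>D (t - int j) w\<bar>)"
proof (induction q)
  case 0 then show ?case by simp
next
  case (Suc q)
  have s: "\<bar>mart s w - mart (s - 1) w\<bar> \<le> \<bar>D s w\<bar>" for s
    by (cases "1 \<le> s") (auto simp: mart_step, simp add: mart_def)
  have "t - int (Suc q) = t - int q - 1" by simp
  then have "\<bar>mart t w - mart (t - int (Suc q)) w\<bar>
      \<le> \<bar>mart t w - mart (t - int q) w\<bar> + \<bar>D (t - int q) w\<bar>"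
    using s[of "t - int q"] by (simp only:)
  with Suc show ?case by simp
qed

definition cA :: "real \<Rightarrow> complex" where "cA s = (\<integral>w. iexp (s * (A 0 w - \<mu>)) \<partial>M)"

definition cB :: "real \<Rightarrow> complex" where "cB s = (\<integral>w. iexp (s * (B 0 w - \<mu>\<^sub>B)) \<partial>M)"

lemma cA_measurable [measurable]: "cA \<in> borel_measurable borel"
  unfolding cA_def[abs_def] by measurable

abbreviation cf :: "real \<Rightarrow> int \<Rightarrow> complex" where
  "cf v t \<equiv> \<integral>w. iexp (v * mart t w) \<partial>M"

text \<open>
  Given the past of time \<open>t\<close>, the increment \<open>(A t - \<mu>) X (t-1) + (B t - \<mu>\<^sub>B)\<close> is a sum of independent
  terms with \<open>X (t-1)\<close> frozen.
\<close>

lemma cf_step: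
  assumes t: "1 \<le> t"
  shows "cf v t
    = cB v * (\<integral>w. iexp (v * mart (t - 1) w) * cA (v * X (t - 1) w) \<partial>M)"
proof -
  let ?U = "\<lambda>w. (mart (t - 1) w, X (t - 1) w)" and ?V = "\<lambda>w. (A t w, B t w)"
  let ?f = "\<lambda>p :: (real \<times> real) \<times> (real \<times> real). iexp (v * fst (fst p)) *
    (iexp (v * snd (fst p) * (fst (snd p) - \<mu>)) * iexp (v * (snd (snd p) - \<mu>\<^sub>B)))"
  have ind: "indep_var (borel \<Otimes>\<^sub>M borel) ?U (borel \<Otimes>\<^sub>M borel) ?V"
  proof (rule indep_info)
    show "?U \<in> measurable (info {..t - 1}) (borel \<Otimes>\<^sub>M borel)"
      by (intro measurable_Pair mart_info X_info)
    show "?V \<in> measurable (info {t}) (borel \<Otimes>\<^sub>M borel)" by (rule info_AB) simp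
  qed auto
  have f: "?f \<in> borel_measurable ((borel \<Otimes>\<^sub>M borel) \<Otimes>\<^sub>M (borel \<Otimes>\<^sub>M borel))"
    by measurable
  have int: "integrable M (\<lambda>w. ?f (?U w, ?V w))"
    by (rule integrable_const_bound[where B=1]) (auto simp: norm_mult)
  have inner: "(\<integral>w'. ?f (?U w, ?V w') \<partial>M) = cB v * (iexp (v * mart (t - 1) w) * cA (v * X (t - 1) w))" for w
  proof -
    let ?x = "X (t - 1) w"
    have indAB: "indep_var borel (\<lambda>w'. iexp (v * ?x * (A t w' - \<mu>))) borel (\<lambda>w'. iexp (v * (B t w' - \<mu>\<^sub>B)))"
      using indep_var_compose[OF indep_A_B[of t], of "\<lambda>a. iexp (v * ?x * (a - \<mu>))" borel "\<lambda>b. iexp (v * (b - \<mu>\<^sub>B))" borel]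
      by (simp add: comp_def)
    have "(\<integral>w'. ?f (?U w, ?V w') \<partial>M) = iexp (v * mart (t - 1) w) *
        (\<integral>w'. iexp (v * ?x * (A t w' - \<mu>)) * iexp (v * (B t w' - \<mu>\<^sub>B)) \<partial>M)"
      by simp
    also have "(\<integral>w'. iexp (v * ?x * (A t w' - \<mu>)) * iexp (v * (B t w' - \<mu>\<^sub>B)) \<partial>M)
      = (\<integral>w'. iexp (v * ?x * (A t w' - \<mu>)) \<partial>M) * (\<integral>w'. iexp (v * (B t w' - \<mu>\<^sub>B)) \<partial>M)"
      by (rule indep_var_lebesgue_integral[OF indAB]) (rule integrable_iexp_real, measurable)+
    also have "(\<integral>w'. iexp (v * ?x * (A t w' - \<mu>)) \<partial>M) = cA (v * ?x)"
      unfolding cA_def by (rule integral_A) measurable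
    also have "(\<integral>w'. iexp (v * (B t w' - \<mu>\<^sub>B)) \<partial>M) = cB v"
      unfolding cB_def by (rule integral_B) measurable
    finally show ?thesis by (simp only: ac_simps)
  qed
  have "cf v t = (\<integral>w. ?f (?U w, ?V w) \<partial>M)"
  proof (rule integral_cong_AE)
    show "AE w in M. iexp (v * mart t w) = ?f (?U w, ?V w)"
      using D_eq[of t]
    proof eventually_elim
      case (elim w)
      have "v * mart t w = v * mart (t - 1) w + (v * X (t - 1) w * (A t w - \<mu>) + v * (B t w - \<mu>\<^sub>B))"
        unfolding mart_step[OF t] elim by (simp add: algebra_simps)
      then show ?case by (simp only: iexp_add fst_conv snd_conv)
    qed
    show "(\<lambda>w. ?f (?U w, ?V w)) \<in> borel_measurable M" using int by auto
  qed measurable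
  also have "\<dots> = (\<integral>w. (\<integral>w'. ?f (?U w, ?V w') \<partial>M) \<partial>M)"
    by (rule indep_var_integral[OF ind f int])
  also have "\<dots> = cB v * (\<integral>w. iexp (v * mart (t - 1) w) * cA (v * X (t - 1) w) \<partial>M)"
    unfolding inner by simp
  finally show ?thesis .
qed

definition cK :: real where
  "cK = (\<integral>w. 2 * \<bar>A 0 w - \<mu>\<bar> + 2 * (A 0 w - \<mu>)\<^sup>2 \<partial>M)"

lemma A_centered_square_integrable: "integrable M (\<lambda>w. (A 0 w - \<mu>)\<^sup>2)"
  using A_power_integrable[of 2 0] by (simp add: power2_diff)

lemma cK_nonneg: "0 \<le> cK"
  unfolding cK_def by (intro integral_nonneg_AE) auto

lemma cA_minus_1: "cA s - 1 = (\<integral>w. iexp (s * (A 0 w - \<mu>)) - 1 - \<i> * complex_of_real (s * (A 0 w - \<mu>)) \<partial>M)"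
proof -
  have i: "integrable M (\<lambda>w. A 0 w - \<mu>)" by simp
  have 0: "(\<integral>w. complex_of_real (s * (A 0 w - \<mu>)) \<partial>M) = 0"
  proof -
    have "(\<integral>w. A 0 w - \<mu> \<partial>M) = 0"
      by (subst Bochner_Integration.integral_diff) (simp_all add: \<mu>_def prob_space)
    then have "(\<integral>w. s * (A 0 w - \<mu>) \<partial>M) = 0" by (simp only: integral_mult_right_zero mult_zero_right)
    then have "complex_of_real (\<integral>w. s * (A 0 w - \<mu>) \<partial>M) = 0" by (simp only: of_real_0)
    then show ?thesis by (subst integral_complex_of_real)
  qed
  have i': "integrable M (\<lambda>w. complex_of_real (s * (A 0 w - \<mu>)))"
    by (intro integrable_of_real integrable_mult_right i)
  have "(\<integral>w. iexp (s * (A 0 w - \<mu>)) - 1 - \<i> * complex_of_real (s * (A 0 w - \<mu>)) \<partial>M)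
    = cA s - 1 - \<i> * (\<integral>w. complex_of_real (s * (A 0 w - \<mu>)) \<partial>M)"
    using integrable_iexp_real[of "\<lambda>w. s * (A 0 w - \<mu>)"] i'
    by (simp add: cA_def prob_space del: of_real_mult of_real_diff)
  then show ?thesis by (simp only: 0) simp
qed

text \<open>
  Centering makes the first order terms cancel, so that \<open>cA\<close> is flat near 0: its Lipschitz constant on
  a neighbourhood of 0 is of the order of the radius.
\<close>

lemma cA_diff: "cmod (cA x - cA y) \<le> cK * (\<bar>x - y\<bar> * min 1 (\<bar>x\<bar> + \<bar>y\<bar>))"
proof -
  let ?a = "\<lambda>w. A 0 w - \<mu>"
  let ?g = "\<lambda>s w. iexp (s * ?a w) - 1 - \<i> * complex_of_real (s * ?a w)"
  have ig: "integrable M (?g s)" for s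
  proof (rule Bochner_Integration.integrable_bound)
    show "integrable M (\<lambda>w. 2 * \<bar>s * ?a w\<bar>)" by simp
    show "AE w in M. norm (?g s w) \<le> norm (2 * \<bar>s * ?a w\<bar>)"
      using iexp_1_approx_linear[of "s * ?a _"] by (auto simp del: of_real_mult of_real_diff)
  qed measurable
  have "cA x - cA y = (cA x - 1) - (cA y - 1)" by simp
  also have "\<dots> = (\<integral>w. ?g x w - ?g y w \<partial>M)"
    unfolding cA_minus_1 by (rule Bochner_Integration.integral_diff[symmetric, OF ig ig])
  finally have "cmod (cA x - cA y) \<le> (\<integral>w. cmod (?g x w - ?g y w) \<partial>M)"
    by (simp only: integral_norm_bound)
  also have "\<dots> \<le> (\<integral>w. (2 * \<bar>?a w\<bar> + 2 * (?a w)\<^sup>2) * (\<bar>x - y\<bar> * min 1 (\<bar>x\<bar> + \<bar>y\<bar>)) \<partial>M)"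
  proof (rule integral_mono)
    show "integrable M (\<lambda>w. cmod (?g x w - ?g y w))" 
      by (rule integrable_norm[OF Bochner_Integration.integrable_diff[OF ig ig]])
    show "integrable M (\<lambda>w. (2 * \<bar>?a w\<bar> + 2 * (?a w)\<^sup>2) * (\<bar>x - y\<bar> * min 1 (\<bar>x\<bar> + \<bar>y\<bar>)))"
      using A_centered_square_integrable by (intro integrable_mult_left) simp
    fix w
    let ?b = "?a w" and ?z = "\<bar>x\<bar> + \<bar>y\<bar>"
    have "?g x w - ?g y w = iexp (x * ?b) - iexp (y * ?b) - \<i> * complex_of_real (x * ?b - y * ?b)"
      by (simp add: algebra_simps)
    then have "cmod (?g x w - ?g y w) \<le> 2 * \<bar>x * ?b - y * ?b\<bar> * min 1 (\<bar>x * ?b\<bar> + \<bar>y * ?b\<bar>)"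
      by (simp only: iexp_diff_approx)
    also have "\<dots> = 2 * (\<bar>x - y\<bar> * \<bar>?b\<bar>) * min 1 (?z * \<bar>?b\<bar>)"
      by (simp add: abs_mult distrib_right flip: left_diff_distrib)
    also have "\<dots> = \<bar>x - y\<bar> * (2 * (\<bar>?b\<bar> * min 1 (?z * \<bar>?b\<bar>)))" by simp
    also have "\<bar>?b\<bar> * min 1 (?z * \<bar>?b\<bar>) \<le> (\<bar>?b\<bar> + ?b\<^sup>2) * min 1 ?z"
    proof -
      have 1: "min 1 (?z * \<bar>?b\<bar>) \<le> (1 + \<bar>?b\<bar>) * min 1 ?z"
      proof (cases "?z \<le> 1")
        case True
        have "?z * \<bar>?b\<bar> \<le> ?z * (1 + \<bar>?b\<bar>)" by (intro mult_left_mono) auto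
        with True show ?thesis by (simp add: min_def mult.commute)
      next
        case False
        then have "min 1 ?z = 1" by simp
        then show ?thesis by (simp only:) (rule min.coboundedI1, simp)
      qed
      have "\<bar>?b\<bar> * min 1 (?z * \<bar>?b\<bar>) \<le> \<bar>?b\<bar> * ((1 + \<bar>?b\<bar>) * min 1 ?z)"
        by (rule mult_left_mono[OF 1]) simp
      also have "\<dots> = (\<bar>?b\<bar> + ?b\<^sup>2) * min 1 ?z"
        by (simp add: distrib_left distrib_right power2_eq_square flip: mult.assoc)
      finally show ?thesis .
    qed
    finally have "cmod (?g x w - ?g y w) \<le> \<bar>x - y\<bar> * (2 * ((\<bar>?b\<bar> + ?b\<^sup>2) * min 1 ?z))"
      by (simp add: mult_left_mono)
    then show "cmod (?g x w - ?g y w) \<le> (2 * \<bar>?b\<bar> + 2 * ?b\<^sup>2) * (\<bar>x - y\<bar> * min 1 ?z)"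
      by (simp add: algebra_simps)
  qed
  also have "\<dots> = cK * (\<bar>x - y\<bar> * min 1 (\<bar>x\<bar> + \<bar>y\<bar>))"
    unfolding cK_def by (rule integral_mult_left_zero)
  finally show ?thesis .
qed

definition cU :: "real \<Rightarrow> real" where "cU u = cK * (\<bar>u\<bar> * (1 + \<bar>u\<bar>))"

lemma cU_nonneg: "0 \<le> cU u" using cK_nonneg by (simp add: cU_def)

lemma cA_scaled_diff:
  assumes "0 \<le> x" "0 \<le> y"
  shows "cmod (cA (u * x) - cA (u * y)) \<le> cU u * (\<bar>x - y\<bar> * min 1 (x + y))"
proof -
  have m: "min 1 (\<bar>u\<bar> * z) \<le> (1 + \<bar>u\<bar>) * min 1 z" if "0 \<le> z" for z
  proof (cases "z \<le> 1")
    case True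
    have "\<bar>u\<bar> * z \<le> (1 + \<bar>u\<bar>) * z" using that by (intro mult_right_mono) auto
    with True show ?thesis by (simp add: min_def)
  next
    case False
    then have "min 1 z = 1" by simp
    then show ?thesis by (simp only:) (rule min.coboundedI1, simp)
  qed
  have "cmod (cA (u * x) - cA (u * y)) \<le> cK * (\<bar>u * x - u * y\<bar> * min 1 (\<bar>u * x\<bar> + \<bar>u * y\<bar>))"
    by (rule cA_diff)
  also have "\<dots> = cK * (\<bar>u\<bar> * \<bar>x - y\<bar> * min 1 (\<bar>u\<bar> * (x + y)))"
    using assms by (simp add: abs_mult distrib_left flip: right_diff_distrib)
  also have "\<dots> \<le> cK * (\<bar>u\<bar> * \<bar>x - y\<bar> * ((1 + \<bar>u\<bar>) * min 1 (x + y)))"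
    using assms by (intro mult_left_mono m cK_nonneg) auto
  finally show ?thesis by (simp add: cU_def ac_simps)
qed

lemma cA_0: "cA 0 = 1" by (simp add: cA_def prob_space)

lemma cA_scaled_bound: "0 \<le> x \<Longrightarrow> cmod (cA (u * x) - 1) \<le> cU u * trunc_sq x"
  using cA_scaled_diff[of x 0 u] by (simp add: cA_0 trunc_sq_eq)

lemma cA_scaled_limit: "((\<lambda>y. (cA (u * y) - 1) /\<^sub>R y\<^sup>2) \<longlongrightarrow> - complex_of_real (u\<^sup>2 / 2 * (\<rho> - \<mu>\<^sup>2))) (at_right 0)"
proof -
  let ?a = "\<lambda>w. A 0 w - \<mu>"
  let ?g = "\<lambda>y w. (iexp (u * ?a w * y) - 1 - \<i> * complex_of_real (u * ?a w * y)) /\<^sub>R y\<^sup>2"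
  have "((\<lambda>y. (\<integral>w. ?g y w \<partial>M)) \<longlongrightarrow> (\<integral>w. - complex_of_real ((u * ?a w)\<^sup>2 / 2) \<partial>M)) (at_right 0)"
  proof (rule integral_dominated_convergence_at_right_0[where w="\<lambda>w. u\<^sup>2 * (?a w)\<^sup>2"])
    show "integrable M (\<lambda>w. u\<^sup>2 * (?a w)\<^sup>2)" using A_centered_square_integrable by simp
    show "AE w in M. ((\<lambda>y. ?g y w) \<longlongrightarrow> - complex_of_real ((u * ?a w)\<^sup>2 / 2)) (at_right 0)"
      by (intro AE_I2 iexp_second_order_limit)
    have pos: "\<forall>\<^sub>F y in at_right (0::real). 0 < y" by (simp add: eventually_at_right_less)
    show "\<forall>\<^sub>F y in at_right 0. AE w in M. norm (?g y w) \<le> u\<^sup>2 * (?a w)\<^sup>2"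
      using pos
    proof eventually_elim
      case (elim y)
      have "norm (?g y w) \<le> u\<^sup>2 * (?a w)\<^sup>2" for w
      proof -
        have "norm (?g y w) = inverse (y\<^sup>2) * cmod (iexp (u * ?a w * y) - 1 - \<i> * complex_of_real (u * ?a w * y))"
          by (simp only: norm_scaleR abs_inverse abs_power2)
        also have "\<dots> \<le> inverse (y\<^sup>2) * ((u * ?a w * y)\<^sup>2 / 2)"
          by (intro mult_left_mono iexp_1_approx) simp
        also have "\<dots> = u\<^sup>2 * (?a w)\<^sup>2 / 2" using elim by (simp only: power_mult_distrib) simp
        finally show ?thesis by (rule order_trans) simp
      qed
      then show ?case by simp
    qed
  qed measurable
  moreover have "(\<integral>w. - complex_of_real ((u * ?a w)\<^sup>2 / 2) \<partial>M) = - complex_of_real (u\<^sup>2 / 2 * (\<rho> - \<mu>\<^sup>2))"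
  proof -
    have "(\<integral>w. complex_of_real ((u * ?a w)\<^sup>2 / 2) \<partial>M) = complex_of_real (\<integral>w. (u * ?a w)\<^sup>2 / 2 \<partial>M)"
      by (rule integral_complex_of_real)
    also have "(\<integral>w. (u * ?a w)\<^sup>2 / 2 \<partial>M) = u\<^sup>2 / 2 * (\<rho> - \<mu>\<^sup>2)"
      unfolding variance_A[symmetric] by (simp add: power_mult_distrib)
    finally show ?thesis by (simp only: integral_minus)
  qed
  moreover have "(\<integral>w. ?g y w \<partial>M) = (cA (u * y) - 1) /\<^sub>R y\<^sup>2" for y
    unfolding cA_minus_1 by (simp only: integral_scaleR_right ac_simps)
  ultimately show ?thesis by (simp only:)
qed

end

section \<open>Asymptotic independence of the martingale and the current state\<close>

lemma integrable_bounded_times: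
  fixes f g :: "'a \<Rightarrow> real"
  assumes "integrable M f" and [measurable]: "g \<in> borel_measurable M"
    and "\<And>w. 0 \<le> g w" "\<And>w. g w \<le> 1"
  shows "integrable M (\<lambda>w. g w * f w)"
proof (rule Bochner_Integration.integrable_bound[OF assms(1)])
  have [measurable]: "f \<in> borel_measurable M" using assms by auto
  show "(\<lambda>w. g w * f w) \<in> borel_measurable M" by measurable
  show "AE w in M. norm (g w * f w) \<le> norm (f w)"
    using assms(3,4) by (auto simp: abs_mult intro!: mult_left_le_one_le)
qed

lemma min_add_le:
  fixes a b c :: real
  assumes "0 \<le> a" "0 \<le> b" "0 \<le> c"
  shows "min 1 (a + b + c) \<le> min 1 a + min 1 b + c"
  using assms by (auto simp: min_def)

text \<open>
  A Young type inequality: either \<open>d\<close> is a small fraction of \<open>x\<close>, or \<open>x\<close> is at most a large multiple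
  of \<open>d\<close>. It converts a mixed term into a small multiple of the moment of the state and a large
  multiple of the moment of a geometrically small perturbation.
\<close>

lemma mult_min_le_trunc_sq:
  assumes "0 \<le> d" "0 \<le> x" "0 < \<theta>" "\<theta> \<le> 1"
  shows "d * min 1 x \<le> \<theta> * trunc_sq x + trunc_sq d / \<theta>"
proof (cases "d \<le> \<theta> * x")
  case True
  then have "d * min 1 x \<le> \<theta> * x * min 1 x" using assms by (intro mult_right_mono) auto
  also have "\<dots> = \<theta> * trunc_sq x" using assms by (simp add: trunc_sq_eq)
  finally show ?thesis using assms by (simp add: add_increasing2)
next
  case False
  then have "x \<le> d / \<theta>" using assms by (simp add: field_simps)
  moreover have "min 1 (d / \<theta>) \<le> min 1 d / \<theta>"
    using assms by (auto simp: min_def field_simps)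
  ultimately have "min 1 x \<le> min 1 d / \<theta>" by linarith
  then have "d * min 1 x \<le> d * (min 1 d / \<theta>)" using assms by (intro mult_left_mono)
  also have "\<dots> = trunc_sq d / \<theta>" using assms by (simp add: trunc_sq_eq)
  finally show ?thesis using assms by (simp add: add_increasing)
qed

context stationary_recursion
begin

text \<open>
  The factor \<open>min 1 (l X)\<close> makes this expectation smaller than \<open>H\<^sub>X(l)\<close>: the integrand is of third order
  at 0.
\<close>

definition cross_moment :: "real \<Rightarrow> real" where
  "cross_moment l = (\<integral>w. min 1 (l * X 0 w) * trunc_sq (l * X 0 w) \<partial>M)"

lemma cross_moment_limit: "((\<lambda>l. cross_moment l / HX l) \<longlongrightarrow> 0) (at_right 0)"
proof -
  have pos: "\<forall>\<^sub>F y in at_right (0::real). y \<in> {0<..<1}" by (rule eventually_at_right_real) simp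
  have lim: "((\<lambda>y. (min 1 y * trunc_sq y) /\<^sub>R y\<^sup>2) \<longlongrightarrow> 0) (at_right (0::real))"
  proof (rule Lim_transform_eventually)
    show "((\<lambda>y. y) \<longlongrightarrow> 0) (at_right (0::real))" by (rule tendsto_ident_at)
    show "\<forall>\<^sub>F y in at_right (0::real). y = (min 1 y * trunc_sq y) /\<^sub>R y\<^sup>2"
      using pos by eventually_elim (simp add: trunc_sq_small)
  qed
  have "((\<lambda>l. (\<integral>w. min 1 (l * X 0 w) * trunc_sq (l * X 0 w) \<partial>M) /\<^sub>R HX l) \<longlongrightarrow> 0) (at_right 0)"
  proof (rule gaussian_domain_integral[OF X_domain _ lim, where C=1])
    show "norm (min 1 y * trunc_sq y) \<le> 1 * trunc_sq y" if "0 \<le> y" for y :: real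
      using that by (simp add: abs_mult mult_left_le_one_le)
  qed measurable
  then show ?thesis unfolding cross_moment_def by (simp only: real_scaleR_def divide_inverse_commute)
qed

lemma X_trunc_sq_integrable: "integrable M (\<lambda>w. trunc_sq (l * X t w))"
  by (rule integrable_trunc_sq[OF X_integrable])

lemma X_trunc_sq_integral: "(\<integral>w. trunc_sq (l * X t w) \<partial>M) = HX l"
  unfolding trunc_moment_def by (rule integral_X) measurable

lemma min_X_integral_le:
  assumes "0 \<le> l" shows "(\<integral>w. min 1 (l * X t w) \<partial>M) \<le> l * m"
proof -
  have "(\<integral>w. min 1 (l * X t w) \<partial>M) \<le> (\<integral>w. l * X t w \<partial>M)"
  proof (rule integral_mono)
    show "integrable M (\<lambda>w. min 1 (l * X t w))"
      by (rule integrable_const_bound[where B=1]) (use assms X_nonneg in auto)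
  qed (use X_integrable in auto)
  also have "\<dots> = l * m" using integral_X[of "\<lambda>x. x" t] by (simp add: m_def)
  finally show ?thesis .
qed

lemma lag_X: "AE w in M. X t w = prodA t q w * X (t - int q) w + sumB t q w"
  by (rule lag_decomposition[OF X_rec])

lemma sumB_trunc_sq:
  assumes "0 \<le> l"
  shows "integrable M (\<lambda>w. trunc_sq (l * sumB t q w))"
    and "(\<integral>w. trunc_sq (l * sumB t q w) \<partial>M) \<le> HX l"
proof -
  have le: "AE w in M. trunc_sq (l * sumB t q w) \<le> trunc_sq (l * X t w)"
    using lag_X[of t q] AE_space
  proof eventually_elim
    case (elim w)
    have "0 \<le> prodA t q w * X (t - int q) w"
      using elim prodA_nonneg X_nonneg by simp
    then have "0 \<le> sumB t q w" "sumB t q w \<le> X t w" using elim sumB_nonneg by auto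
    then show ?case using assms by (intro trunc_sq_mono) (simp add: mult_left_mono)
  qed
  show i: "integrable M (\<lambda>w. trunc_sq (l * sumB t q w))"
    by (rule Bochner_Integration.integrable_bound[OF X_trunc_sq_integrable[of l t]])
      (use le in auto)
  show "(\<integral>w. trunc_sq (l * sumB t q w) \<partial>M) \<le> HX l"
    using integral_mono_AE[OF i X_trunc_sq_integrable le] by (simp add: X_trunc_sq_integral)
qed

lemma prodA_times_past:
  fixes f :: "'a \<Rightarrow> real"
  assumes f: "f \<in> borel_measurable (info {..t - int q})" and fi: "integrable M f"
  shows "integrable M (\<lambda>w. (prodA t q w + (prodA t q w)\<^sup>2) * f w)"
    and "(\<integral>w. (prodA t q w + (prodA t q w)\<^sup>2) * f w \<partial>M) = (\<mu> ^ q + \<rho> ^ q) * (\<integral>w. f w \<partial>M)"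
proof -
  have ind: "indep_var borel (\<lambda>w. prodA t q w + (prodA t q w)\<^sup>2) borel f"
    by (rule indep_info[OF _ f, where K="{t - int q<..}"])
      (auto intro!: borel_measurable_add borel_measurable_power prodA_info)
  have i2: "integrable M (\<lambda>w. (prodA t q w)\<^sup>2)" by (rule prodA_power_integrable) simp
  have i: "integrable M (\<lambda>w. prodA t q w + (prodA t q w)\<^sup>2)"
    by (intro Bochner_Integration.integrable_add prodA_integrable i2)
  show "integrable M (\<lambda>w. (prodA t q w + (prodA t q w)\<^sup>2) * f w)"
    by (rule indep_var_integrable[OF ind i fi])
  have "(\<integral>w. prodA t q w + (prodA t q w)\<^sup>2 \<partial>M) = \<mu> ^ q + \<rho> ^ q"
    by (subst Bochner_Integration.integral_add[OF prodA_integrable i2])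
      (simp only: prodA_integral prodA_square_integral)
  then show "(\<integral>w. (prodA t q w + (prodA t q w)\<^sup>2) * f w \<partial>M) = (\<mu> ^ q + \<rho> ^ q) * (\<integral>w. f w \<partial>M)"
    by (simp only: indep_var_lebesgue_integral[OF ind i fi])
qed

text \<open>
  Write \<open>X t = P X (t-j) + R\<close>. The part with \<open>P\<close> is the cross moment at lag 0 times a bounded factor,
  and \<open>R\<close> is independent of \<open>X (t-j)\<close>, whose truncation has mean at most \<open>l m\<close>.
\<close>

lemma cross_moment_lag_le:
  assumes l: "0 < l"
  shows "(\<integral>w. min 1 (l * X (t - int j) w) * trunc_sq (l * X t w) \<partial>M) \<le> 8 * cross_moment l + 4 * l * m * HX l"
proof -
  let ?k = "t - int j"
  let ?P = "prodA t j" and ?R = "sumB t j"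
  let ?x = "\<lambda>w. min 1 (l * X ?k w)"
  let ?f = "\<lambda>w. ?x w * trunc_sq (l * X ?k w)"
  have x: "0 \<le> ?x w" "?x w \<le> 1" for w using l X_nonneg by auto
  have x_info: "?x \<in> borel_measurable (info {..?k})"
    using measurable_compose[OF X_info, of "\<lambda>x. min 1 (l * x)" borel] by simp
  have f_info: "?f \<in> borel_measurable (info {..?k})"
    using measurable_compose[OF X_info, of "\<lambda>x. min 1 (l * x) * trunc_sq (l * x)" borel] by simp
  have fi: "integrable M ?f" by (rule integrable_bounded_times) (use x X_trunc_sq_integrable in auto)
  have f_int: "(\<integral>w. ?f w \<partial>M) = cross_moment l"
    unfolding cross_moment_def by (rule integral_X[of "\<lambda>x. min 1 (l * x) * trunc_sq (l * x)"]) measurable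
  have xi: "integrable M ?x" by (rule integrable_const_bound[where B=1]) (use x in auto)
  have Ri: "integrable M (\<lambda>w. trunc_sq (l * ?R w))" using l by (intro sumB_trunc_sq) simp
  have ind: "indep_var borel ?x borel (\<lambda>w. trunc_sq (l * ?R w))"
  proof (rule indep_info[OF x_info])
    show "(\<lambda>w. trunc_sq (l * ?R w)) \<in> borel_measurable (info {?k<..})"
      using measurable_compose[OF sumB_info, of "\<lambda>x. trunc_sq (l * x)" borel] by simp
  qed auto
  have iR: "integrable M (\<lambda>w. ?x w * trunc_sq (l * ?R w))" by (rule indep_var_integrable[OF ind xi Ri])
  have "(\<integral>w. ?x w * trunc_sq (l * X t w) \<partial>M)
      \<le> (\<integral>w. 4 * ((?P w + (?P w)\<^sup>2) * ?f w) + 4 * (?x w * trunc_sq (l * ?R w)) \<partial>M)"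
  proof (rule integral_mono_AE)
    show "integrable M (\<lambda>w. ?x w * trunc_sq (l * X t w))"
      by (rule integrable_bounded_times) (use x X_trunc_sq_integrable in auto)
    show "integrable M (\<lambda>w. 4 * ((?P w + (?P w)\<^sup>2) * ?f w) + 4 * (?x w * trunc_sq (l * ?R w)))"
      by (intro Bochner_Integration.integrable_add integrable_mult_right iR prodA_times_past[OF f_info fi])
    show "AE w in M. ?x w * trunc_sq (l * X t w)
        \<le> 4 * ((?P w + (?P w)\<^sup>2) * ?f w) + 4 * (?x w * trunc_sq (l * ?R w))"
      using lag_X[of t j] AE_space
    proof eventually_elim
      case (elim w)
      have "l * X t w = ?P w * (l * X ?k w) + l * ?R w" unfolding elim by (simp add: algebra_simps)
      then have "trunc_sq (l * X t w) \<le> 4 * trunc_sq (?P w * (l * X ?k w)) + 4 * trunc_sq (l * ?R w)"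
        by (simp only: trunc_sq_add)
      also have "\<dots> \<le> 4 * ((?P w + (?P w)\<^sup>2) * trunc_sq (l * X ?k w)) + 4 * trunc_sq (l * ?R w)"
        using trunc_sq_scale[OF prodA_nonneg, of w t j "l * X ?k w"] elim by simp
      finally have "?x w * trunc_sq (l * X t w)
          \<le> ?x w * (4 * ((?P w + (?P w)\<^sup>2) * trunc_sq (l * X ?k w)) + 4 * trunc_sq (l * ?R w))"
        by (rule mult_left_mono) (rule x)
      then show ?case by (simp only: distrib_left ac_simps)
    qed
  qed
  also have "\<dots> = 4 * ((\<mu> ^ j + \<rho> ^ j) * cross_moment l) + 4 * ((\<integral>w. ?x w \<partial>M) * (\<integral>w. trunc_sq (l * ?R w) \<partial>M))"
    using prodA_times_past[OF f_info fi] iR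
    by (subst Bochner_Integration.integral_add)
      (simp_all only: integral_mult_right_zero integrable_mult_right indep_var_lebesgue_integral[OF ind xi Ri] f_int)
  also have "\<dots> \<le> 4 * (2 * cross_moment l) + 4 * ((l * m) * HX l)"
  proof (intro add_mono mult_left_mono mult_mono)
    have "\<mu> ^ j \<le> 1" "\<rho> ^ j \<le> 1"
      using \<mu>_nonneg \<mu>_less_1 \<rho>_nonneg \<rho>_less_1 by (auto intro!: power_le_one)
    then show "\<mu> ^ j + \<rho> ^ j \<le> 2" by simp
    show "0 \<le> cross_moment l" unfolding cross_moment_def using l X_nonneg by (intro integral_nonneg_AE) auto
    show "(\<integral>w. ?x w \<partial>M) \<le> l * m" using l by (intro min_X_integral_le) simp
    show "(\<integral>w. trunc_sq (l * ?R w) \<partial>M) \<le> HX l" using l by (intro sumB_trunc_sq) simp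
  qed (use l m_nonneg in \<open>auto intro!: integral_nonneg_AE\<close>)
  finally show ?thesis by simp
qed

lemma iexp_mart_diff:
  assumes l: "0 < l"
  shows "cmod (iexp (u * l * mart t w) - iexp (u * l * mart (t - int q) w))
    \<le> (2 + \<bar>u\<bar>) * (\<Sum>j<q. min 1 (l * X (t - int j) w) + min 1 (l * X (t - int (Suc j)) w) + l * \<mu>\<^sub>B)"
proof -
  let ?d = "mart t w - mart (t - int q) w"
  have "iexp (u * l * mart t w) = iexp (u * l * mart (t - int q) w) * iexp (u * l * ?d)"
    by (simp only: iexp_add[symmetric]) (simp add: algebra_simps)
  then have "iexp (u * l * mart t w) - iexp (u * l * mart (t - int q) w)
      = iexp (u * l * mart (t - int q) w) * (iexp (u * l * ?d) - 1)"
    by (simp only: right_diff_distrib mult_1_right)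
  then have eq: "cmod (iexp (u * l * mart t w) - iexp (u * l * mart (t - int q) w)) = cmod (iexp (u * l * ?d) - 1)"
    by (simp only: norm_mult norm_exp_i_times mult_1_left)
  have 1: "cmod (iexp (u * l * ?d) - 1) \<le> \<bar>u\<bar> * (l * \<bar>?d\<bar>)"
    using iexp_0_approx[of "u * l * ?d"] l by (simp add: abs_mult mult.assoc)
  have 2: "cmod (iexp (u * l * ?d) - 1) \<le> 2"
    using norm_triangle_ineq4[of "iexp (u * l * ?d)" 1] by (simp only: norm_exp_i_times norm_one one_add_one)
  have "cmod (iexp (u * l * ?d) - 1) \<le> (2 + \<bar>u\<bar>) * min 1 (l * \<bar>?d\<bar>)"
  proof (cases "l * \<bar>?d\<bar> \<le> 1")
    case True
    have "0 \<le> 2 * (l * \<bar>?d\<bar>)" using l by simp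
    with 1 have "cmod (iexp (u * l * ?d) - 1) \<le> 2 * (l * \<bar>?d\<bar>) + \<bar>u\<bar> * (l * \<bar>?d\<bar>)" by linarith
    with True show ?thesis by (simp only: distrib_right min_absorb2)
  next
    case False
    then have "min 1 (l * \<bar>?d\<bar>) = 1" by simp
    with 2 show ?thesis by (simp only: mult_1_right)
  qed
  also have "min 1 (l * \<bar>?d\<bar>) \<le> (\<Sum>j<q. min 1 (l * X (t - int j) w) + min 1 (l * X (t - int (Suc j)) w) + l * \<mu>\<^sub>B)"
  proof -
    have "l * \<bar>?d\<bar> \<le> (\<Sum>j<q. l * \<bar>D (t - int j) w\<bar>)"
      using mult_left_mono[OF mart_diff_le[of t w q], of l] l by (simp add: sum_distrib_left)
    then have "min 1 (l * \<bar>?d\<bar>) \<le> min 1 (\<Sum>j<q. l * \<bar>D (t - int j) w\<bar>)" by simp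
    also have "\<dots> \<le> (\<Sum>j<q. min 1 (l * \<bar>D (t - int j) w\<bar>))"
    proof (induction q)
      case 0 then show ?case by simp
    next
      case (Suc q)
      have "min 1 (a + b) \<le> min 1 a + min 1 b" if "0 \<le> a" "0 \<le> b" for a b :: real
        using that by (auto simp: min_def)
      from this[of "\<Sum>j<q. l * \<bar>D (t - int j) w\<bar>" "l * \<bar>D (t - int q) w\<bar>"] Suc l
      show ?case by (simp add: sum_nonneg)
    qed
    also have "\<dots> \<le> (\<Sum>j<q. min 1 (l * X (t - int j) w) + min 1 (l * X (t - int (Suc j)) w) + l * \<mu>\<^sub>B)"
    proof (rule sum_mono)
      fix j
      have k: "t - int j - 1 = t - int (Suc j)" by simp
      have "l * \<bar>D (t - int j) w\<bar> \<le> l * X (t - int j) w + l * X (t - int (Suc j)) w + l * \<mu>\<^sub>B"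
        using mult_left_mono[OF D_le[of "t - int j" w], of l] l unfolding k by (simp only: distrib_left less_imp_le)
      then have "min 1 (l * \<bar>D (t - int j) w\<bar>) \<le> min 1 (l * X (t - int j) w + l * X (t - int (Suc j)) w + l * \<mu>\<^sub>B)"
        by (intro min.mono) auto
      also have "\<dots> \<le> min 1 (l * X (t - int j) w) + min 1 (l * X (t - int (Suc j)) w) + l * \<mu>\<^sub>B"
        using l X_nonneg \<mu>\<^sub>B_nonneg by (intro min_add_le) auto
      finally show "min 1 (l * \<bar>D (t - int j) w\<bar>)
        \<le> min 1 (l * X (t - int j) w) + min 1 (l * X (t - int (Suc j)) w) + l * \<mu>\<^sub>B" .
    qed
    finally show ?thesis .
  qed
  finally show ?thesis unfolding eq by (simp add: mult_left_mono)
qed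

text \<open>
  The random factor by which one step changes the conditional characteristic function, minus 1.
\<close>

abbreviation kap :: "real \<Rightarrow> real \<Rightarrow> complex" where
  "kap u x \<equiv> cA (u * x) - 1"

lemma kap_X_integrable: "0 \<le> l \<Longrightarrow> integrable M (\<lambda>w. kap u (l * X t w))"
  using cA_scaled_bound X_nonneg X_integrable
  by (intro integrable_dominated_trunc_sq[where C="cU u"]) auto

lemma kap_X_integral: "(\<integral>w. kap u (l * X t w) \<partial>M) = (\<integral>w. kap u (l * X 0 w) \<partial>M)"
  by (rule integral_X[of "\<lambda>x. kap u (l * x)"]) measurable

lemma kap_X_norm_le: "0 \<le> l \<Longrightarrow> cmod (\<integral>w. kap u (l * X t w) \<partial>M) \<le> cU u * HX l"
proof -
  assume l: "0 \<le> l"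
  have "cmod (\<integral>w. kap u (l * X t w) \<partial>M) \<le> (\<integral>w. cmod (kap u (l * X t w)) \<partial>M)" by (rule integral_norm_bound)
  also have "\<dots> \<le> (\<integral>w. cU u * trunc_sq (l * X t w) \<partial>M)"
    using l kap_X_integrable X_trunc_sq_integrable cA_scaled_bound X_nonneg
    by (intro integral_mono) auto
  also have "\<dots> = cU u * HX l" by (simp add: X_trunc_sq_integral)
  finally show ?thesis .
qed

text \<open>
  Replacing \<open>mart t\<close> by \<open>mart (t - q)\<close> costs at most a multiple of the sum of \<open>min 1 (l X k) + l \<mu>\<^sub>B\<close> over the
  last \<open>q + 1\<close> times \<open>k\<close>, and each of these terms is negligible under the truncated second moment of \<open>X t\<close>.
\<close>

lemma recent_increment_error:
  assumes l: "0 < l"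
  shows "(\<integral>w. cmod ((iexp (u * l * mart t w) - iexp (u * l * mart (t - int q) w)) * kap u (l * X t w)) \<partial>M)
    \<le> (2 + \<bar>u\<bar>) * cU u * (real q * (16 * cross_moment l + l * (8 * m + \<mu>\<^sub>B) * HX l))"
proof -
  let ?x = "\<lambda>j w. min 1 (l * X (t - int j) w)"
  let ?h = "\<lambda>w. trunc_sq (l * X t w)"
  let ?g = "\<lambda>j w. ?x j w * ?h w + ?x (Suc j) w * ?h w + l * \<mu>\<^sub>B * ?h w"
  have xi: "integrable M (\<lambda>w. ?x j w * ?h w)" for j
    by (rule integrable_bounded_times) (use l X_nonneg X_trunc_sq_integrable in auto)
  have gi: "integrable M (?g j)" for j
    by (intro Bochner_Integration.integrable_add integrable_mult_right xi X_trunc_sq_integrable)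
  have "(\<integral>w. cmod ((iexp (u * l * mart t w) - iexp (u * l * mart (t - int q) w)) * kap u (l * X t w)) \<partial>M)
    \<le> (\<integral>w. (2 + \<bar>u\<bar>) * cU u * (\<Sum>j<q. ?g j w) \<partial>M)"
  proof (rule integral_mono)
    have "integrable M (\<lambda>w. iexp (u * l * mart s w) * kap u (l * X t w))" for s
      using l by (intro integrable_iexp_times kap_X_integrable) auto
    then show "integrable M (\<lambda>w. cmod ((iexp (u * l * mart t w) - iexp (u * l * mart (t - int q) w)) * kap u (l * X t w)))"
      unfolding left_diff_distrib by (intro integrable_norm Bochner_Integration.integrable_diff)
    show "integrable M (\<lambda>w. (2 + \<bar>u\<bar>) * cU u * (\<Sum>j<q. ?g j w))"
      by (intro integrable_mult_right Bochner_Integration.integrable_sum gi)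
    fix w
    have "cmod ((iexp (u * l * mart t w) - iexp (u * l * mart (t - int q) w)) * kap u (l * X t w))
        \<le> ((2 + \<bar>u\<bar>) * (\<Sum>j<q. ?x j w + ?x (Suc j) w + l * \<mu>\<^sub>B)) * (cU u * ?h w)"
      unfolding norm_mult using l X_nonneg \<mu>\<^sub>B_nonneg
      by (intro mult_mono iexp_mart_diff cA_scaled_bound mult_nonneg_nonneg sum_nonneg) auto
    also have "\<dots> = (2 + \<bar>u\<bar>) * cU u * (\<Sum>j<q. ?g j w)"
      by (simp only: sum_distrib_left sum_distrib_right) (simp only: distrib_left distrib_right ac_simps)
    finally show "cmod ((iexp (u * l * mart t w) - iexp (u * l * mart (t - int q) w)) * kap u (l * X t w))
      \<le> (2 + \<bar>u\<bar>) * cU u * (\<Sum>j<q. ?g j w)" .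
  qed
  also have "\<dots> = (2 + \<bar>u\<bar>) * cU u * (\<Sum>j<q. \<integral>w. ?g j w \<partial>M)"
    by (simp only: integral_mult_right_zero Bochner_Integration.integral_sum[OF gi])
  also have "\<dots> \<le> (2 + \<bar>u\<bar>) * cU u * (\<Sum>j<q. 16 * cross_moment l + l * (8 * m + \<mu>\<^sub>B) * HX l)"
  proof (intro mult_left_mono sum_mono)
    fix j
    have "(\<integral>w. ?g j w \<partial>M) = (\<integral>w. ?x j w * ?h w \<partial>M) + (\<integral>w. ?x (Suc j) w * ?h w \<partial>M) + l * \<mu>\<^sub>B * HX l"
      using xi[of j] xi[of "Suc j"] X_trunc_sq_integrable[of l t]
      by (subst Bochner_Integration.integral_add, simp, simp, subst Bochner_Integration.integral_add)
        (simp_all add: X_trunc_sq_integral del: of_nat_Suc)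
    also have "\<dots> \<le> (8 * cross_moment l + 4 * l * m * HX l) + (8 * cross_moment l + 4 * l * m * HX l) + l * \<mu>\<^sub>B * HX l"
      by (intro add_mono cross_moment_lag_le l) simp
    also have "\<dots> = 16 * cross_moment l + l * (8 * m + \<mu>\<^sub>B) * HX l" by (simp add: algebra_simps)
    finally show "(\<integral>w. ?g j w \<partial>M) \<le> 16 * cross_moment l + l * (8 * m + \<mu>\<^sub>B) * HX l" .
  qed (use cU_nonneg in auto)
  also have "\<dots> = (2 + \<bar>u\<bar>) * cU u * (real q * (16 * cross_moment l + l * (8 * m + \<mu>\<^sub>B) * HX l))" by simp
  finally show ?thesis .
qed

lemma kap_sumB_integrable: "0 \<le> l \<Longrightarrow> integrable M (\<lambda>w. kap u (l * sumB t q w))"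
proof -
  assume l: "0 \<le> l"
  show ?thesis
  proof (rule Bochner_Integration.integrable_bound)
    show "integrable M (\<lambda>w. cU u * trunc_sq (l * sumB t q w))"
      using l by (intro integrable_mult_right sumB_trunc_sq)
    show "AE w in M. norm (kap u (l * sumB t q w)) \<le> norm (cU u * trunc_sq (l * sumB t q w))"
      using l sumB_nonneg cU_nonneg by (auto intro!: AE_I2 cA_scaled_bound simp: abs_mult)
  qed measurable
qed

text \<open>
  The state \<open>X t\<close> and its approximation \<open>sumB t q\<close>, which ignores everything up to time \<open>t - q\<close>, differ
  by \<open>prodA t q * X (t - q)\<close>, whose truncated second moment is at most \<open>(\<mu>\<^sup>q + \<rho>\<^sup>q) H\<^sub>X(l)\<close>.
\<close>

lemma forgetting_error:
  assumes l: "0 < l" and \<theta>: "0 < \<theta>" "\<theta> \<le> 1"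
  shows "(\<integral>w. cmod (kap u (l * X t w) - kap u (l * sumB t q w)) \<partial>M)
    \<le> 2 * cU u * (\<theta> + (\<mu> ^ q + \<rho> ^ q) / \<theta>) * HX l"
proof -
  let ?s = "t - int q"
  let ?P = "prodA t q" and ?R = "sumB t q"
  let ?h = "\<lambda>w. trunc_sq (l * X t w)" and ?f = "\<lambda>w. trunc_sq (l * X ?s w)"
  have f_info: "?f \<in> borel_measurable (info {..?s})"
    using measurable_compose[OF X_info, of "\<lambda>x. trunc_sq (l * x)" borel] by simp
  note Pf = prodA_times_past[OF f_info X_trunc_sq_integrable]
  have "(\<integral>w. cmod (kap u (l * X t w) - kap u (l * ?R w)) \<partial>M)
    \<le> (\<integral>w. 2 * cU u * (\<theta> * ?h w + ((?P w + (?P w)\<^sup>2) * ?f w) / \<theta>) \<partial>M)"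
  proof (rule integral_mono_AE)
    show "integrable M (\<lambda>w. cmod (kap u (l * X t w) - kap u (l * ?R w)))"
      using l by (intro integrable_norm Bochner_Integration.integrable_diff kap_X_integrable kap_sumB_integrable) auto
    show "integrable M (\<lambda>w. 2 * cU u * (\<theta> * ?h w + ((?P w + (?P w)\<^sup>2) * ?f w) / \<theta>))"
      by (intro integrable_mult_right Bochner_Integration.integrable_add integrable_divide Pf X_trunc_sq_integrable)
    show "AE w in M. cmod (kap u (l * X t w) - kap u (l * ?R w))
        \<le> 2 * cU u * (\<theta> * ?h w + ((?P w + (?P w)\<^sup>2) * ?f w) / \<theta>)"
      using lag_X[of t q] AE_space
    proof eventually_elim
      case (elim w)
      let ?d = "?P w * (l * X ?s w)"
      have P0: "0 \<le> ?P w" and R0: "0 \<le> ?R w" using elim prodA_nonneg sumB_nonneg by auto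
      have d0: "0 \<le> ?d" using P0 l X_nonneg by simp
      have X0: "0 \<le> l * X t w" and lR0: "0 \<le> l * ?R w" using l X_nonneg R0 by auto
      have d: "l * X t w - l * ?R w = ?d" unfolding elim by (simp add: algebra_simps)
      have R_le: "l * ?R w \<le> l * X t w" using d d0 by linarith
      have "cmod (kap u (l * X t w) - kap u (l * ?R w)) = cmod (cA (u * (l * X t w)) - cA (u * (l * ?R w)))"
        by simp
      also have "\<dots> \<le> cU u * (\<bar>?d\<bar> * min 1 (l * X t w + l * ?R w))"
        using cA_scaled_diff[OF X0 lR0] unfolding d .
      also have "\<dots> \<le> cU u * (?d * (2 * min 1 (l * X t w)))"
      proof (intro mult_left_mono mult_mono)
        show "min 1 (l * X t w + l * ?R w) \<le> 2 * min 1 (l * X t w)" using R_le lR0 by (auto simp: min_def)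
      qed (use d0 X0 lR0 cU_nonneg in auto)
      also have "\<dots> = 2 * cU u * (?d * min 1 (l * X t w))" by simp
      also have "\<dots> \<le> 2 * cU u * (\<theta> * ?h w + trunc_sq ?d / \<theta>)"
        using d0 X0 \<theta> cU_nonneg by (intro mult_left_mono mult_min_le_trunc_sq) auto
      also have "\<dots> \<le> 2 * cU u * (\<theta> * ?h w + ((?P w + (?P w)\<^sup>2) * ?f w) / \<theta>)"
        using \<theta> cU_nonneg trunc_sq_scale[OF P0]
        by (intro mult_left_mono add_left_mono divide_right_mono) auto
      finally show ?case .
    qed
  qed
  also have "\<dots> = 2 * cU u * (\<theta> * HX l + ((\<mu> ^ q + \<rho> ^ q) * HX l) / \<theta>)"
    using Pf X_trunc_sq_integrable[of l t]
    by (subst integral_mult_right_zero, subst Bochner_Integration.integral_add)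
      (auto simp: X_trunc_sq_integral)
  also have "\<dots> = 2 * cU u * (\<theta> + (\<mu> ^ q + \<rho> ^ q) / \<theta>) * HX l" by (simp add: algebra_simps)
  finally show ?thesis .
qed

lemma cf_lag_error:
  assumes l: "0 < l"
  shows "cmod (cf (u * l) (t - int q) - cf (u * l) t)
    \<le> (2 + \<bar>u\<bar>) * (real q * (l * (2 * m + \<mu>\<^sub>B)))"
proof -
  let ?x = "\<lambda>j w. min 1 (l * X (t - int j) w)"
  have xi: "integrable M (?x j)" for j
    by (rule integrable_const_bound[where B=1]) (use l X_nonneg in auto)
  have ii: "integrable M (\<lambda>w. iexp (u * l * mart s w))" for s by (rule integrable_iexp_real) measurable
  have gi: "integrable M (\<lambda>w. ?x j w + ?x (Suc j) w + l * \<mu>\<^sub>B)" for j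
    by (intro Bochner_Integration.integrable_add xi integrable_const)
  have "cmod (cf (u * l) (t - int q) - cf (u * l) t)
    = cmod (\<integral>w. iexp (u * l * mart t w) - iexp (u * l * mart (t - int q) w) \<partial>M)"
    by (subst Bochner_Integration.integral_diff[OF ii ii], rule norm_minus_commute)
  also have "\<dots> \<le> (\<integral>w. cmod (iexp (u * l * mart t w) - iexp (u * l * mart (t - int q) w)) \<partial>M)"
    by (rule integral_norm_bound)
  also have "\<dots> \<le> (\<integral>w. (2 + \<bar>u\<bar>) * (\<Sum>j<q. ?x j w + ?x (Suc j) w + l * \<mu>\<^sub>B) \<partial>M)"
    by (intro integral_mono iexp_mart_diff l integrable_norm Bochner_Integration.integrable_diff ii
        integrable_mult_right Bochner_Integration.integrable_sum gi)
  also have "\<dots> = (2 + \<bar>u\<bar>) * (\<Sum>j<q. \<integral>w. ?x j w + ?x (Suc j) w + l * \<mu>\<^sub>B \<partial>M)"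
    by (simp only: integral_mult_right_zero Bochner_Integration.integral_sum[OF gi])
  also have "\<dots> \<le> (2 + \<bar>u\<bar>) * (\<Sum>j<q. l * (2 * m + \<mu>\<^sub>B))"
  proof (intro mult_left_mono sum_mono)
    fix j
    have "(\<integral>w. ?x j w + ?x (Suc j) w + l * \<mu>\<^sub>B \<partial>M) = (\<integral>w. ?x j w \<partial>M) + (\<integral>w. ?x (Suc j) w \<partial>M) + l * \<mu>\<^sub>B"
      using xi[of j] xi[of "Suc j"] by (simp add: prob_space del: of_nat_Suc)
    also have "\<dots> \<le> l * m + l * m + l * \<mu>\<^sub>B"
      using l by (intro add_mono min_X_integral_le) auto
    finally show "(\<integral>w. ?x j w + ?x (Suc j) w + l * \<mu>\<^sub>B \<partial>M) \<le> l * (2 * m + \<mu>\<^sub>B)" by (simp add: algebra_simps)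
  qed auto
  also have "\<dots> = (2 + \<bar>u\<bar>) * (real q * (l * (2 * m + \<mu>\<^sub>B)))" by simp
  finally show ?thesis .
qed

text \<open>
  Pass from \<open>mart t\<close> to \<open>mart (t - q)\<close> and from \<open>X t\<close> to \<open>sumB t q\<close>. The new pair is independent, so
  the expectation of the product factorizes; then undo both replacements in the factors. The terms
  \<open>T1\<close> to \<open>T4\<close> are the costs of these four replacements.
\<close>

lemma decoupling_error:
  assumes l: "0 < l" and \<theta>: "0 < \<theta>" "\<theta> \<le> 1"
  shows "cmod ((\<integral>w. iexp (u * l * mart t w) * kap u (l * X t w) \<partial>M)
      - cf (u * l) t * (\<integral>w. kap u (l * X 0 w) \<partial>M))
    \<le> (2 + \<bar>u\<bar>) * cU u * real q * (16 * cross_moment l + l * (10 * m + 2 * \<mu>\<^sub>B) * HX l)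
      + 4 * cU u * (\<theta> + (\<mu> ^ q + \<rho> ^ q) / \<theta>) * HX l"
proof -
  let ?s = "t - int q"
  let ?c = "\<lambda>t w. iexp (u * l * mart t w)"
  let ?K = "\<lambda>w. kap u (l * X t w)" and ?L = "\<lambda>w. kap u (l * sumB t q w)"
  let ?phi = "\<lambda>t. \<integral>w. ?c t w \<partial>M"
  have l0: "0 \<le> l" using l by simp
  have Ki: "integrable M ?K" using l0 by (rule kap_X_integrable)
  have Li: "integrable M ?L" using l0 by (rule kap_sumB_integrable)
  have ci: "integrable M (?c s)" for s by (rule integrable_iexp_real) measurable
  have cK: "integrable M (\<lambda>w. ?c s w * ?K w)" for s by (rule integrable_iexp_times[OF Ki]) measurable
  have cL: "integrable M (\<lambda>w. ?c s w * ?L w)" for s by (rule integrable_iexp_times[OF Li]) measurable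
  have ind: "indep_var borel (?c ?s) borel ?L"
  proof (rule indep_info)
    show "?c ?s \<in> borel_measurable (info {..?s})"
      using measurable_compose[OF mart_info, of "\<lambda>x. iexp (u * l * x)" borel] by simp
    show "?L \<in> borel_measurable (info {?s<..})"
      using measurable_compose[OF sumB_info, of "\<lambda>x. kap u (l * x)" borel] by simp
  qed auto
  have prod: "(\<integral>w. ?c ?s w * ?L w \<partial>M) = ?phi ?s * (\<integral>w. ?L w \<partial>M)"
    by (rule indep_var_lebesgue_integral[OF ind ci Li])
  define T1 where "T1 = (\<integral>w. (?c t w - ?c ?s w) * ?K w \<partial>M)"
  define T2 where "T2 = (\<integral>w. ?c ?s w * (?K w - ?L w) \<partial>M)"
  define T3 where "T3 = ?phi ?s * (\<integral>w. ?L w - ?K w \<partial>M)"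
  define T4 where "T4 = (?phi ?s - ?phi t) * (\<integral>w. ?K w \<partial>M)"
  have "T1 = (\<integral>w. ?c t w * ?K w \<partial>M) - (\<integral>w. ?c ?s w * ?K w \<partial>M)"
    unfolding T1_def left_diff_distrib[of "?c t _" "?c ?s _"] by (rule Bochner_Integration.integral_diff[OF cK cK])
  moreover have "T2 = (\<integral>w. ?c ?s w * ?K w \<partial>M) - ?phi ?s * (\<integral>w. ?L w \<partial>M)"
  proof -
    have d: "?c ?s w * (?K w - ?L w) = ?c ?s w * ?K w - ?c ?s w * ?L w" for w
      by (rule right_diff_distrib)
    show ?thesis
      unfolding T2_def d prod[symmetric] by (rule Bochner_Integration.integral_diff[OF cK cL])
  qed
  moreover have "T3 = ?phi ?s * (\<integral>w. ?L w \<partial>M) - ?phi ?s * (\<integral>w. ?K w \<partial>M)"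
    unfolding T3_def Bochner_Integration.integral_diff[OF Li Ki] by (rule right_diff_distrib)
  moreover have "T4 = ?phi ?s * (\<integral>w. ?K w \<partial>M) - ?phi t * (\<integral>w. ?K w \<partial>M)"
    unfolding T4_def by (rule left_diff_distrib)
  ultimately have eq: "(\<integral>w. ?c t w * ?K w \<partial>M) - ?phi t * (\<integral>w. ?K w \<partial>M) = T1 + T2 + T3 + T4"
    by (simp only:) simp
  have b1: "cmod T1 \<le> (2 + \<bar>u\<bar>) * cU u * (real q * (16 * cross_moment l + l * (8 * m + \<mu>\<^sub>B) * HX l))"
    unfolding T1_def by (rule order_trans[OF integral_norm_bound recent_increment_error[OF l]])
  let ?F = "2 * cU u * (\<theta> + (\<mu> ^ q + \<rho> ^ q) / \<theta>) * HX l"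
  have b2: "cmod T2 \<le> ?F"
  proof -
    have "cmod T2 \<le> (\<integral>w. cmod (?c ?s w * (?K w - ?L w)) \<partial>M)"
      unfolding T2_def by (rule integral_norm_bound)
    also have "\<dots> = (\<integral>w. cmod (?K w - ?L w) \<partial>M)" by (simp only: norm_mult norm_exp_i_times mult_1_left)
    also have "\<dots> \<le> ?F" by (rule forgetting_error[OF l \<theta>])
    finally show ?thesis .
  qed
  have b3: "cmod T3 \<le> ?F"
  proof -
    have "cmod T3 \<le> 1 * (\<integral>w. cmod (?L w - ?K w) \<partial>M)"
      unfolding T3_def norm_mult by (intro mult_mono norm_integral_iexp_le_1 integral_norm_bound) auto
    also have "\<dots> = (\<integral>w. cmod (?K w - ?L w) \<partial>M)" by (simp only: norm_minus_commute mult_1_left)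
    also have "\<dots> \<le> ?F" by (rule forgetting_error[OF l \<theta>])
    finally show ?thesis .
  qed
  have b4: "cmod T4 \<le> ((2 + \<bar>u\<bar>) * (real q * (l * (2 * m + \<mu>\<^sub>B)))) * (cU u * HX l)"
    unfolding T4_def norm_mult using l m_nonneg \<mu>\<^sub>B_nonneg
    by (intro mult_mono cf_lag_error kap_X_norm_le) auto
  have "cmod (T1 + T2 + T3 + T4) \<le> cmod T1 + cmod T2 + cmod T3 + cmod T4"
    by (intro order_trans[OF norm_triangle_ineq] add_right_mono norm_triangle_ineq)
  also have "\<dots> \<le> (2 + \<bar>u\<bar>) * cU u * (real q * (16 * cross_moment l + l * (8 * m + \<mu>\<^sub>B) * HX l))
      + ?F + ?F + ((2 + \<bar>u\<bar>) * (real q * (l * (2 * m + \<mu>\<^sub>B)))) * (cU u * HX l)"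
    by (intro add_mono b1 b2 b3 b4)
  also have "\<dots> = (2 + \<bar>u\<bar>) * cU u * real q * (16 * cross_moment l + l * (10 * m + 2 * \<mu>\<^sub>B) * HX l)
      + 4 * cU u * (\<theta> + (\<mu> ^ q + \<rho> ^ q) / \<theta>) * HX l"
    by algebra
  finally show ?thesis unfolding eq[symmetric] kap_X_integral[of u l t] .
qed

text \<open>
  First \<open>\<theta>\<close>, then \<open>q\<close>, then \<open>l\<close> are chosen; none of the choices depends on \<open>t\<close>.
\<close>

lemma decoupling:
  assumes e: "0 < e"
  shows "\<forall>\<^sub>F l in at_right 0. \<forall>t. cmod ((\<integral>w. iexp (u * l * mart t w) * kap u (l * X t w) \<partial>M)
      - cf (u * l) t * (\<integral>w. kap u (l * X 0 w) \<partial>M)) \<le> e * HX l"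
proof -
  define C where "C = 4 * cU u + 1"
  have C: "0 < C" "4 * cU u \<le> C" using cU_nonneg[of u] by (auto simp: C_def)
  define \<theta> where "\<theta> = min 1 (e / (3 * C))"
  have \<theta>: "0 < \<theta>" "\<theta> \<le> 1" "C * \<theta> \<le> e / 3"
  proof -
    show "0 < \<theta>" "\<theta> \<le> 1" using e C by (auto simp: \<theta>_def)
    have "\<theta> \<le> e / (3 * C)" by (simp add: \<theta>_def)
    then show "C * \<theta> \<le> e / 3" using C by (simp add: field_simps)
  qed
  have "(\<lambda>q. C * ((\<mu> ^ q + \<rho> ^ q) / \<theta>)) \<longlonglongrightarrow> C * ((0 + 0) / \<theta>)"
    using \<mu>_nonneg \<mu>_less_1 \<rho>_nonneg \<rho>_less_1 \<theta> by (intro tendsto_intros LIMSEQ_power_zero) auto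
  then have "\<forall>\<^sub>F q in sequentially. C * ((\<mu> ^ q + \<rho> ^ q) / \<theta>) < e / 3"
    using e by (intro order_tendstoD) auto
  then obtain q where q: "C * ((\<mu> ^ q + \<rho> ^ q) / \<theta>) < e / 3" by (auto simp: eventually_sequentially)
  define a where "a = (2 + \<bar>u\<bar>) * cU u * real q"
  have lim: "((\<lambda>l. a * (16 * (cross_moment l / HX l) + l * (10 * m + 2 * \<mu>\<^sub>B))) \<longlongrightarrow> a * (16 * 0 + 0 * (10 * m + 2 * \<mu>\<^sub>B))) (at_right 0)"
    by (intro tendsto_intros cross_moment_limit)
  have "\<forall>\<^sub>F l in at_right 0. a * (16 * (cross_moment l / HX l) + l * (10 * m + 2 * \<mu>\<^sub>B)) < e / 3"
    by (rule order_tendstoD(2)[OF lim]) (use e in simp)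
  then show ?thesis using HX_pos eventually_at_right_less[of "0::real"]
  proof eventually_elim
    case (elim l)
    have "a * (16 * cross_moment l + l * (10 * m + 2 * \<mu>\<^sub>B) * HX l)
        = a * (16 * (cross_moment l / HX l) + l * (10 * m + 2 * \<mu>\<^sub>B)) * HX l"
    proof -
      have "a * (16 * c + d * h) = a * (16 * (c / h) + d) * h" if "0 < h" for c d h :: real
        using that by (simp add: field_simps)
      then show ?thesis using elim by blast
    qed
    also have "\<dots> \<le> e / 3 * HX l" using elim by (intro mult_right_mono) auto
    finally have 1: "a * (16 * cross_moment l + l * (10 * m + 2 * \<mu>\<^sub>B) * HX l) \<le> e / 3 * HX l" .
    have "4 * cU u * (\<theta> + (\<mu> ^ q + \<rho> ^ q) / \<theta>) \<le> C * (\<theta> + (\<mu> ^ q + \<rho> ^ q) / \<theta>)"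
      using C \<theta> \<mu>_nonneg \<rho>_nonneg by (intro mult_right_mono) auto
    also have "\<dots> \<le> 2 * e / 3" using \<theta> q by (simp add: distrib_left)
    finally have 2: "4 * cU u * (\<theta> + (\<mu> ^ q + \<rho> ^ q) / \<theta>) * HX l \<le> 2 * e / 3 * HX l"
      using elim by (intro mult_right_mono) auto
    show ?case
    proof
      fix t
      show "cmod ((\<integral>w. iexp (u * l * mart t w) * kap u (l * X t w) \<partial>M)
        - cf (u * l) t * (\<integral>w. kap u (l * X 0 w) \<partial>M)) \<le> e * HX l"
        using decoupling_error[of l \<theta> u t q] \<theta> elim 1 2 unfolding a_def by linarith
    qed
  qed
qed

text \<open>
  The deterministic factor gained by the characteristic function of the martingale in one step.
\<close>

definition zeta :: "real \<Rightarrow> real \<Rightarrow> complex" where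
  "zeta u l = cB (u * l) * (1 + (\<integral>w. kap u (l * X 0 w) \<partial>M))"

lemma cf_recursion:
  assumes e: "0 < e"
  shows "\<forall>\<^sub>F l in at_right 0. \<forall>t\<ge>1. cmod (cf (u * l) t
      - zeta u l * cf (u * l) (t - 1)) \<le> e * HX l"
  using decoupling[OF e, of u] eventually_at_right_less[of "0::real"]
proof eventually_elim
  case (elim l)
  show ?case
  proof (intro allI impI)
    fix t :: int assume t: "1 \<le> t"
    let ?c = "\<lambda>w. iexp (u * l * mart (t - 1) w)" and ?K = "\<lambda>w. kap u (l * X (t - 1) w)"
    have ci: "integrable M ?c" by (rule integrable_iexp_real) measurable
    have Ki: "integrable M (\<lambda>w. ?c w * ?K w)"
      using elim by (intro integrable_iexp_times kap_X_integrable) auto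
    have "?c w * cA (u * l * X (t - 1) w) = ?c w + ?c w * ?K w" for w
      by (simp add: algebra_simps)
    then have "(\<integral>w. ?c w * cA (u * l * X (t - 1) w) \<partial>M) = (\<integral>w. ?c w \<partial>M) + (\<integral>w. ?c w * ?K w \<partial>M)"
      by (simp only: Bochner_Integration.integral_add[OF ci Ki])
    moreover have alg: "b * (p + s) - b * (1 + k) * p = b * (s - p * k)" for b p s k :: complex
      by (simp add: algebra_simps)
    ultimately have eq: "cf (u * l) t - zeta u l * (\<integral>w. ?c w \<partial>M)
        = cB (u * l) * ((\<integral>w. ?c w * ?K w \<partial>M) - (\<integral>w. ?c w \<partial>M) * (\<integral>w. kap u (l * X 0 w) \<partial>M))"
      unfolding cf_step[OF t] zeta_def by (simp only: alg)
    have le: "cmod (cB (u * l) * ((\<integral>w. ?c w * ?K w \<partial>M) - (\<integral>w. ?c w \<partial>M) * (\<integral>w. kap u (l * X 0 w) \<partial>M)))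
        \<le> 1 * (e * HX l)"
    proof -
      have "cmod ((\<integral>w. ?c w * ?K w \<partial>M) - (\<integral>w. ?c w \<partial>M) * (\<integral>w. kap u (l * X 0 w) \<partial>M)) \<le> e * HX l"
        using elim(1) by (rule spec)
      then show ?thesis
        unfolding norm_mult cB_def by (rule mult_mono[OF norm_integral_iexp_le_1 _ zero_le_one norm_ge_zero])
    qed
    show "cmod (cf (u * l) t - zeta u l * (\<integral>w. ?c w \<partial>M)) \<le> e * HX l"
      unfolding eq using le by (simp only: mult_1_left)
  qed
qed

lemma zeta_norm: "0 \<le> l \<Longrightarrow> cmod (zeta u l) \<le> 1"
proof -
  assume l: "0 \<le> l"
  have "norm (cA s) \<le> 1" for s unfolding cA_def by (rule norm_integral_iexp_le_1)
  moreover have "1 + (\<integral>w. kap u (l * X 0 w) \<partial>M) = (\<integral>w. cA (u * (l * X 0 w)) \<partial>M)"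
  proof -
    have "(\<integral>w. cA (u * (l * X 0 w)) \<partial>M) = (\<integral>w. kap u (l * X 0 w) + 1 \<partial>M)" by simp
    also have "\<dots> = (\<integral>w. kap u (l * X 0 w) \<partial>M) + 1"
      by (subst Bochner_Integration.integral_add[OF kap_X_integrable[OF l]]) (simp_all add: prob_space)
    finally show ?thesis by simp
  qed
  moreover have "cmod (\<integral>w. cA (u * (l * X 0 w)) \<partial>M) \<le> 1"
  proof -
    have "(\<integral>w. cmod (cA (u * (l * X 0 w))) \<partial>M) \<le> (\<integral>w. 1 \<partial>M)"
      using calculation(1) by (intro integral_mono integrable_const_bound[where B=1]) auto
    then have "(\<integral>w. cmod (cA (u * (l * X 0 w))) \<partial>M) \<le> 1" by (simp add: prob_space)
    then show ?thesis by (rule order_trans[OF integral_norm_bound])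
  qed
  ultimately have "cmod (1 + (\<integral>w. kap u (l * X 0 w) \<partial>M)) \<le> 1" by (simp only:)
  moreover have "cmod (cB (u * l)) \<le> 1" unfolding cB_def by (rule norm_integral_iexp_le_1)
  ultimately show ?thesis unfolding zeta_def norm_mult by (intro mult_le_one) auto
qed

lemma kap_limit: "((\<lambda>l. (\<integral>w. kap u (l * X 0 w) \<partial>M) /\<^sub>R HX l) \<longlongrightarrow> - complex_of_real (u\<^sup>2 / 2 * (\<rho> - \<mu>\<^sup>2))) (at_right 0)"
  by (rule gaussian_domain_integral[OF X_domain _ cA_scaled_limit cA_scaled_bound]) measurable

text \<open>
  Replacing \<open>B - \<mu>\<^sub>B\<close> by \<open>B\<close> in the second order remainder costs \<open>O(l\<^sup>2)\<close>, which is \<open>o(H\<^sub>B(l))\<close> because the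
  second moment of \<open>B\<close> is infinite.
\<close>

lemma cB_limit: "((\<lambda>l. (cB (u * l) - 1) /\<^sub>R HB l) \<longlongrightarrow> - complex_of_real (u\<^sup>2 / 2)) (at_right 0)"
proof -
  let ?g = "\<lambda>y. iexp (u * y) - 1 - \<i> * complex_of_real (u * y)"
  define G where "G l = (\<integral>w. ?g (l * B 0 w) \<partial>M)" for l
  define E where "E x = iexp (- x) * (1 + \<i> * complex_of_real x) - 1" for x :: real
  have G: "((\<lambda>l. G l /\<^sub>R HB l) \<longlongrightarrow> - complex_of_real (u\<^sup>2 / 2)) (at_right 0)"
    unfolding G_def
    by (rule gaussian_domain_integral[OF B_domain _ iexp_second_order_limit iexp_remainder_bound]) measurable
  have eq: "cB (u * l) - 1 = iexp (- (u * l * \<mu>\<^sub>B)) * G l + E (u * l * \<mu>\<^sub>B)" for l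
  proof -
    have i1: "integrable M (\<lambda>w. iexp (u * (l * B 0 w)))" by (rule integrable_iexp_real) measurable
    have i2: "integrable M (\<lambda>w. complex_of_real (u * (l * B 0 w)))"
      by (intro integrable_of_real integrable_mult_right B_integrable)
    have "(\<integral>w. complex_of_real (u * (l * B 0 w)) \<partial>M) = complex_of_real (\<integral>w. u * (l * B 0 w) \<partial>M)"
      by (rule integral_complex_of_real)
    also have "(\<integral>w. u * (l * B 0 w) \<partial>M) = u * l * \<mu>\<^sub>B" by (simp add: \<mu>\<^sub>B_def)
    finally have b: "(\<integral>w. complex_of_real (u * (l * B 0 w)) \<partial>M) = complex_of_real (u * l * \<mu>\<^sub>B)" .
    have G_eq: "G l = (\<integral>w. iexp (u * (l * B 0 w)) \<partial>M) - 1 - \<i> * complex_of_real (u * l * \<mu>\<^sub>B)"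
      unfolding G_def b[symmetric]
      by (subst Bochner_Integration.integral_diff, intro Bochner_Integration.integrable_diff i1 integrable_const,
          intro integrable_mult_right i2, subst Bochner_Integration.integral_diff[OF i1 integrable_const])
        (simp add: prob_space del: of_real_mult)
    have cB_eq: "cB (u * l) = iexp (- (u * l * \<mu>\<^sub>B)) * (\<integral>w. iexp (u * (l * B 0 w)) \<partial>M)"
    proof -
      have "iexp (u * l * (B 0 w - \<mu>\<^sub>B)) = iexp (- (u * l * \<mu>\<^sub>B)) * iexp (u * (l * B 0 w))" for w
        by (simp only: iexp_add[symmetric]) (simp add: algebra_simps)
      then show ?thesis unfolding cB_def by (simp only: integral_mult_right_zero)
    qed
    have alg: "c - 1 = z * g + (z * (1 + b) - 1)" if "c = z * k" "g = k - 1 - b" for b c g k z :: complex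
      unfolding that by (simp add: algebra_simps)
    show ?thesis unfolding E_def by (rule alg[OF cB_eq G_eq])
  qed
  have E_le: "cmod (E x) \<le> x\<^sup>2 / 2" for x
  proof -
    have "iexp (- x) * iexp x = 1" by (simp only: iexp_add[symmetric]) simp
    then have "E x = - (iexp (- x) * (iexp x - 1 - \<i> * complex_of_real x))"
      unfolding E_def by (simp only: right_diff_distrib distrib_left) simp
    then have "cmod (E x) = cmod (iexp x - 1 - \<i> * complex_of_real x)"
      by (simp only: norm_minus_cancel norm_mult norm_exp_i_times mult_1_left)
    then show ?thesis using iexp_1_approx[of x] by (simp only:)
  qed
  have c: "((\<lambda>l. iexp (- (u * l * \<mu>\<^sub>B))) \<longlongrightarrow> iexp (- (u * 0 * \<mu>\<^sub>B))) (at_right 0)"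
    by (intro tendsto_intros)
  have E_lim: "((\<lambda>l. E (u * l * \<mu>\<^sub>B) /\<^sub>R HB l) \<longlongrightarrow> 0) (at_right 0)"
  proof (rule Lim_null_comparison)
    show "((\<lambda>l. (u * \<mu>\<^sub>B)\<^sup>2 / 2 * (l\<^sup>2 / HB l)) \<longlongrightarrow> 0) (at_right 0)"
      by (rule tendsto_mult_right_zero[OF square_over_HB])
    show "\<forall>\<^sub>F l in at_right 0. norm (E (u * l * \<mu>\<^sub>B) /\<^sub>R HB l) \<le> (u * \<mu>\<^sub>B)\<^sup>2 / 2 * (l\<^sup>2 / HB l)"
      using HB_pos
    proof eventually_elim
      case (elim l)
      have "norm (E (u * l * \<mu>\<^sub>B) /\<^sub>R HB l) = cmod (E (u * l * \<mu>\<^sub>B)) / HB l"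
        using elim by (simp add: divide_inverse mult.commute)
      also have "\<dots> \<le> ((u * l * \<mu>\<^sub>B)\<^sup>2 / 2) / HB l" using elim by (intro divide_right_mono E_le) auto
      also have "\<dots> = (u * \<mu>\<^sub>B)\<^sup>2 / 2 * (l\<^sup>2 / HB l)" by (simp add: power_mult_distrib)
      finally show ?case .
    qed
  qed
  have "((\<lambda>l. iexp (- (u * l * \<mu>\<^sub>B)) * (G l /\<^sub>R HB l) + E (u * l * \<mu>\<^sub>B) /\<^sub>R HB l)
      \<longlongrightarrow> iexp (- (u * 0 * \<mu>\<^sub>B)) * - complex_of_real (u\<^sup>2 / 2) + 0) (at_right 0)"
    by (intro tendsto_add tendsto_mult c G E_lim)
  moreover have "iexp (- (u * l * \<mu>\<^sub>B)) * (G l /\<^sub>R HB l) + E (u * l * \<mu>\<^sub>B) /\<^sub>R HB l = (cB (u * l) - 1) /\<^sub>R HB l" for l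
    unfolding eq by (simp only: scaleR_add_right mult_scaleR_right)
  ultimately show ?thesis by simp
qed

text \<open>
  The contribution \<open>\<rho> - \<mu>\<^sup>2\<close> of \<open>(A - \<mu>) X\<close> and the contribution \<open>1 - \<rho>\<close> of \<open>B\<close>, measured in units of \<open>H\<^sub>X\<close>,
  add up to \<open>1 - \<mu>\<^sup>2\<close>.
\<close>

lemma zeta_limit:
  "((\<lambda>l. (zeta u l - 1) /\<^sub>R HX l) \<longlongrightarrow> - complex_of_real (u\<^sup>2 / 2 * (1 - \<mu>\<^sup>2))) (at_right 0)"
proof -
  let ?K = "\<lambda>l. \<integral>w. kap u (l * X 0 w) \<partial>M"
  have HX0: "(HX \<longlongrightarrow> 0) (at_right 0)"
  proof (rule Lim_null_comparison)
    show "((\<lambda>l. l * m) \<longlongrightarrow> 0) (at_right 0)" by (auto intro!: tendsto_eq_intros)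
    show "\<forall>\<^sub>F l in at_right 0. norm (HX l) \<le> l * m"
      using eventually_at_right_less[of "0::real"] by eventually_elim (simp add: HX_le)
  qed
  have K0: "(?K \<longlongrightarrow> 0) (at_right 0)"
  proof -
    have "((\<lambda>l. HX l *\<^sub>R (?K l /\<^sub>R HX l)) \<longlongrightarrow> 0 *\<^sub>R - complex_of_real (u\<^sup>2 / 2 * (\<rho> - \<mu>\<^sup>2))) (at_right 0)"
      by (intro tendsto_scaleR HX0 kap_limit)
    moreover have "\<forall>\<^sub>F l in at_right 0. HX l *\<^sub>R (?K l /\<^sub>R HX l) = ?K l"
      using HX_pos by eventually_elim simp
    ultimately show ?thesis using Lim_transform_eventually by fastforce
  qed
  have cB: "((\<lambda>l. (cB (u * l) - 1) /\<^sub>R HX l) \<longlongrightarrow> (1 - \<rho>) *\<^sub>R - complex_of_real (u\<^sup>2 / 2)) (at_right 0)"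
  proof -
    have "((\<lambda>l. (HB l / HX l) *\<^sub>R ((cB (u * l) - 1) /\<^sub>R HB l)) \<longlongrightarrow> (1 - \<rho>) *\<^sub>R - complex_of_real (u\<^sup>2 / 2)) (at_right 0)"
      by (intro tendsto_scaleR HB_over_HX cB_limit)
    moreover have "\<forall>\<^sub>F l in at_right 0. (HB l / HX l) *\<^sub>R ((cB (u * l) - 1) /\<^sub>R HB l) = (cB (u * l) - 1) /\<^sub>R HX l"
      using HB_pos by eventually_elim (simp add: divide_inverse)
    ultimately show ?thesis by (rule Lim_transform_eventually)
  qed
  have "((\<lambda>l. (cB (u * l) - 1) /\<^sub>R HX l * (1 + ?K l) + ?K l /\<^sub>R HX l)
     \<longlongrightarrow> ((1 - \<rho>) *\<^sub>R - complex_of_real (u\<^sup>2 / 2)) * (1 + 0) + - complex_of_real (u\<^sup>2 / 2 * (\<rho> - \<mu>\<^sup>2))) (at_right 0)"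
    by (intro tendsto_add tendsto_mult cB kap_limit tendsto_const K0)
  moreover have "(cB (u * l) - 1) /\<^sub>R HX l * (1 + ?K l) + ?K l /\<^sub>R HX l = (zeta u l - 1) /\<^sub>R HX l" for l
    unfolding zeta_def by (simp add: scaleR_conv_of_real algebra_simps)
  moreover have "((1 - \<rho>) *\<^sub>R - complex_of_real (u\<^sup>2 / 2)) * (1 + 0) + - complex_of_real (u\<^sup>2 / 2 * (\<rho> - \<mu>\<^sup>2))
      = - complex_of_real (u\<^sup>2 / 2 * (1 - \<mu>\<^sup>2))"
    by (simp add: scaleR_conv_of_real field_simps)
  ultimately show ?thesis by (simp only:)
qed

end

section \<open>Normalization and convergence in law\<close>

lemma (in prob_space) normalizing_expression_eq:
  assumes [measurable]: "random_variable borel Y" and b: "0 < b"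
  shows "prob {w\<in>space M. \<bar>Y w\<bar> > b} +
      1 / b\<^sup>2 * (\<integral>w. (Y w)\<^sup>2 * indicator {w\<in>space M. \<bar>Y w\<bar> \<le> b} w \<partial>M)
    = (\<integral>w. (min 1 (\<bar>Y w\<bar> / b))\<^sup>2 \<partial>M)"
proof -
  let ?I = "\<lambda>w. indicator {w\<in>space M. \<bar>Y w\<bar> > b} w :: real"
  let ?J = "\<lambda>w. (Y w)\<^sup>2 * indicator {w\<in>space M. \<bar>Y w\<bar> \<le> b} w"
  have I: "integrable M ?I" by (rule integrable_const_bound[where B=1]) (auto simp: indicator_def)
  have J: "integrable M ?J"
    by (rule integrable_const_bound[where B="b\<^sup>2"])
      (use b in \<open>auto simp: indicator_def abs_le_square_iff[symmetric] intro!: AE_I2\<close>)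
  have "(\<integral>w. (min 1 (\<bar>Y w\<bar> / b))\<^sup>2 \<partial>M) = (\<integral>w. ?I w + 1 / b\<^sup>2 * ?J w \<partial>M)"
  proof (rule Bochner_Integration.integral_cong)
    fix w assume "w \<in> space M"
    then show "(min 1 (\<bar>Y w\<bar> / b))\<^sup>2 = ?I w + 1 / b\<^sup>2 * ?J w"
      using b by (cases "\<bar>Y w\<bar> \<le> b") (auto simp: min_def power_divide field_simps)
  qed simp
  also have "\<dots> = (\<integral>w. ?I w \<partial>M) + 1 / b\<^sup>2 * (\<integral>w. ?J w \<partial>M)"
    using I J by simp
  also have "(\<integral>w. ?I w \<partial>M) = prob {w\<in>space M. \<bar>Y w\<bar> > b}" by simp
  finally show ?thesis ..
qed

lemma char_centered_normal:
  assumes s: "0 < s"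
  shows "real_distribution (density lborel (normal_density 0 s))"
    and "char (density lborel (normal_density 0 s)) t = complex_of_real (exp (- ((s * t)\<^sup>2) / 2))"
proof -
  interpret N: prob_space "density lborel (normal_density 0 s)" by (rule prob_space_normal_density[OF s])
  show "real_distribution (density lborel (normal_density 0 s))"
    by (intro real_distribution.intro real_distribution_axioms.intro) (auto intro: N.prob_space_axioms)
  interpret std: prob_space std_normal_distribution by (rule prob_space_normal_density) simp
  have "distributed std_normal_distribution lborel (\<lambda>x. x) (normal_density 0 1)"
    by (auto simp: distributed_def intro!: distr_id2)
  from std.normal_density_affine[OF this, of s 0] s
  have "distr std_normal_distribution lborel (\<lambda>x. s * x) = density lborel (normal_density 0 s)"
    by (simp add: distributed_def)
  then have "char (density lborel (normal_density 0 s)) t = (\<integral>x. iexp (t * x) \<partial>distr std_normal_distribution lborel (\<lambda>x. s * x))"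
    by (simp add: char_def)
  also have "\<dots> = char std_normal_distribution (s * t)"
    unfolding char_def by (subst integral_distr) (auto simp: ac_simps)
  finally show "char (density lborel (normal_density 0 s)) t = complex_of_real (exp (- ((s * t)\<^sup>2) / 2))"
    by (simp add: char_std_normal_distribution)
qed

lemma power_tendsto_exp:
  fixes z :: "nat \<Rightarrow> complex" and v :: real
  assumes z: "\<forall>\<^sub>F n in sequentially. cmod (z n) \<le> 1" and v: "0 \<le> v"
    and lim: "(\<lambda>n. real n *\<^sub>R (z n - 1)) \<longlonglongrightarrow> - complex_of_real v"
  shows "(\<lambda>n. z n ^ n) \<longlonglongrightarrow> complex_of_real (exp (- v))"
proof -
  define w where "w n = complex_of_real (1 + (- v) / real n)" for n
  have w: "(\<lambda>n. w n ^ n) \<longlonglongrightarrow> complex_of_real (exp (- v))"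
    unfolding w_def of_real_power[symmetric] by (intro tendsto_of_real tendsto_exp_limit_sequentially)
  have "(\<lambda>n. z n ^ n - w n ^ n) \<longlonglongrightarrow> 0"
  proof (rule Lim_null_comparison)
    have "(\<lambda>n. real n *\<^sub>R (z n - 1) - - complex_of_real v) \<longlonglongrightarrow> 0"
      using lim by (rule LIM_zero)
    then show "(\<lambda>n. cmod (real n *\<^sub>R (z n - 1) - - complex_of_real v)) \<longlonglongrightarrow> 0"
      by (rule tendsto_norm_zero)
    have "\<forall>\<^sub>F n in sequentially. v < real n"
      using filterlim_real_sequentially by (auto simp: filterlim_at_top_dense)
    with z show "\<forall>\<^sub>F n in sequentially. norm (z n ^ n - w n ^ n) \<le> cmod (real n *\<^sub>R (z n - 1) - - complex_of_real v)"
    proof eventually_elim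
      case (elim n)
      have n: "0 < real n" using elim v by linarith
      have "\<bar>1 + (- v) / real n\<bar> \<le> 1" using elim v n by (auto simp: abs_le_iff field_simps)
      then have "cmod (w n) \<le> 1" unfolding w_def norm_of_real .
      with elim have "norm (z n ^ n - w n ^ n) \<le> real n * norm (z n - w n)"
        by (intro norm_power_diff) auto
      also have "\<dots> = cmod (real n *\<^sub>R (z n - w n))" by simp
      also have "real n *\<^sub>R (z n - w n) = real n *\<^sub>R (z n - 1) - - complex_of_real v"
        using n by (simp add: w_def scaleR_conv_of_real algebra_simps)
      finally show ?case .
    qed
  qed
  from tendsto_add[OF this w] show ?thesis by simp
qed

context stationary_recursion
begin

lemma truncated_square_ratio:
  "((\<lambda>l. (\<integral>w. (min 1 (l * X 0 w))\<^sup>2 \<partial>M) / HX l) \<longlongrightarrow> 1) (at_right 0)"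
proof -
  have pos: "\<forall>\<^sub>F y in at_right (0::real). y \<in> {0<..<1}" by (rule eventually_at_right_real) simp
  have lim: "((\<lambda>y. (min 1 y)\<^sup>2 /\<^sub>R y\<^sup>2) \<longlongrightarrow> 1) (at_right (0::real))"
    by (rule Lim_transform_eventually[OF tendsto_const])
      (use pos in eventually_elim, simp)
  have "((\<lambda>l. (\<integral>w. (min 1 (l * X 0 w))\<^sup>2 \<partial>M) /\<^sub>R HX l) \<longlongrightarrow> 1) (at_right 0)"
  proof (rule gaussian_domain_integral[OF X_domain _ lim, where C=1])
    show "norm ((min 1 y)\<^sup>2) \<le> 1 * trunc_sq y" if "0 \<le> y" for y :: real
      using that by (cases "y \<le> 1") (auto simp: trunc_sq_small trunc_sq_large)
  qed measurable
  then show ?thesis by (simp only: real_scaleR_def divide_inverse_commute)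
qed

text \<open>
  Otherwise \<open>E min(1, X / a\<^sub>n)\<^sup>2 = 1 / n\<close> would for infinitely many \<open>n\<close> exceed the positive number \<open>E min(1, X / C)\<^sup>2\<close>.
\<close>

lemma normalizing_sequence_at_top:
  assumes a: "\<forall>\<^sub>F n in sequentially. 0 < a n \<and> real n * (\<integral>w. (min 1 (X 0 w / a n))\<^sup>2 \<partial>M) = 1"
  shows "filterlim a at_top sequentially"
  unfolding filterlim_at_top_gt[where c=0]
proof (intro allI impI)
  fix C :: real assume C: "0 < C"
  define f where "f b w = (min 1 (X 0 w / b))\<^sup>2" for b w
  have fi: "integrable M (f b)" if "0 < b" for b
    unfolding f_def using that X_nonneg
    by (intro integrable_const_bound[where B=1]) (auto intro!: power_le_one)
  have "(\<integral>w. f C w \<partial>M) \<noteq> 0"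
  proof
    assume "(\<integral>w. f C w \<partial>M) = 0"
    then have "AE w in M. f C w = 0"
      by (subst (asm) integral_nonneg_eq_0_iff_AE[OF fi[OF C]]) (auto simp: f_def)
    then have "AE w in M. X 0 w = 0"
      by eventually_elim (use C in \<open>auto simp: f_def min_def split: if_splits\<close>)
    then have "AE w in M. trunc_sq (l * X 0 w) = 0" for l
      by eventually_elim simp
    then have "HX l = 0" for l unfolding trunc_moment_def by (rule integral_eq_zero_AE)
    with HX_pos have "\<forall>\<^sub>F l in at_right (0::real). False" by simp
    then show False by (simp add: trivial_limit_at_right_real)
  qed
  moreover have "0 \<le> (\<integral>w. f C w \<partial>M)" by (intro integral_nonneg_AE) (auto simp: f_def)
  ultimately have c: "0 < (\<integral>w. f C w \<partial>M)" by simp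
  have "\<forall>\<^sub>F n in sequentially. 1 / (\<integral>w. f C w \<partial>M) < real n"
    using filterlim_real_sequentially by (auto simp: filterlim_at_top_dense)
  with a show "\<forall>\<^sub>F n in sequentially. C \<le> a n"
  proof eventually_elim
    case (elim n)
    show ?case
    proof (rule ccontr)
      assume "\<not> C \<le> a n"
      then have "(\<integral>w. f C w \<partial>M) \<le> (\<integral>w. f (a n) w \<partial>M)"
      proof (intro integral_mono fi)
        fix w
        have "X 0 w / C \<le> X 0 w / a n"
          using elim C X_nonneg \<open>\<not> C \<le> a n\<close> by (intro divide_left_mono) auto
        then show "f C w \<le> f (a n) w"
          unfolding f_def using C X_nonneg by (intro power_mono min.mono) auto
      qed (use C elim in auto)
      then have "real n * (\<integral>w. f C w \<partial>M) \<le> real n * (\<integral>w. f (a n) w \<partial>M)"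
        by (intro mult_left_mono) auto
      also have "\<dots> = 1" using elim by (simp add: f_def)
      finally show False using elim c by (simp add: divide_less_eq)
    qed
  qed
qed

lemma normalizing_sequence_limits:
  assumes a: "\<forall>\<^sub>F n in sequentially. 0 < a n \<and> real n * (\<integral>w. (min 1 (X 0 w / a n))\<^sup>2 \<partial>M) = 1"
  shows "filterlim (\<lambda>n. 1 / a n) (at_right 0) sequentially"
    and "(\<lambda>n. real n * HX (1 / a n)) \<longlonglongrightarrow> 1"
proof -
  have "filterlim (\<lambda>n. inverse (a n)) (at_right 0) sequentially"
    by (rule filterlim_compose[OF filterlim_inverse_at_right_top normalizing_sequence_at_top[OF a]])
  then show l: "filterlim (\<lambda>n. 1 / a n) (at_right 0) sequentially" by (simp add: inverse_eq_divide)
  have "(\<lambda>n. (\<integral>w. (min 1 (1 / a n * X 0 w))\<^sup>2 \<partial>M) / HX (1 / a n)) \<longlonglongrightarrow> 1"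
    by (rule filterlim_compose[OF truncated_square_ratio l])
  then have "(\<lambda>n. inverse ((\<integral>w. (min 1 (1 / a n * X 0 w))\<^sup>2 \<partial>M) / HX (1 / a n))) \<longlonglongrightarrow> inverse 1"
    by (rule tendsto_inverse) simp
  moreover have "\<forall>\<^sub>F n in sequentially. inverse ((\<integral>w. (min 1 (1 / a n * X 0 w))\<^sup>2 \<partial>M) / HX (1 / a n)) = real n * HX (1 / a n)"
    using a
  proof eventually_elim
    case (elim n)
    then have "n \<noteq> 0" by (intro notI) simp
    then have "(\<integral>w. (min 1 (1 / a n * X 0 w))\<^sup>2 \<partial>M) = 1 / real n"
      using elim by (simp add: eq_divide_eq mult.commute)
    then show ?case by simp
  qed
  ultimately show "(\<lambda>n. real n * HX (1 / a n)) \<longlonglongrightarrow> 1"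
    using Lim_transform_eventually by fastforce
qed

text \<open>
  Since \<open>\<bar>zeta\<bar> \<le> 1\<close>, the errors \<open>o(H\<^sub>X(1 / a\<^sub>n)) = o(1/n)\<close> of the \<open>n\<close> steps add up without amplification.
\<close>

lemma cf_mart_limit:
  assumes a: "\<forall>\<^sub>F n in sequentially. 0 < a n \<and> real n * (\<integral>w. (min 1 (X 0 w / a n))\<^sup>2 \<partial>M) = 1"
  shows "(\<lambda>n. \<integral>w. iexp (u * (1 / a n) * mart (int n) w) \<partial>M)
    \<longlonglongrightarrow> complex_of_real (exp (- (u\<^sup>2 / 2 * (1 - \<mu>\<^sup>2))))"
proof -
  note l = normalizing_sequence_limits(1)[OF a] and H = normalizing_sequence_limits(2)[OF a]
  define phi where "phi n t = cf (u * (1 / a n)) t" for n t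
  define z where "z n = zeta u (1 / a n)" for n
  have z1: "\<forall>\<^sub>F n in sequentially. cmod (z n) \<le> 1"
    using a by eventually_elim (simp add: z_def zeta_norm)
  have "\<mu>\<^sup>2 \<le> 1" using \<mu>_nonneg \<mu>_less_1 by (simp add: power_le_one)
  then have v: "0 \<le> u\<^sup>2 / 2 * (1 - \<mu>\<^sup>2)" by simp
  have "(\<lambda>n. (real n * HX (1 / a n)) *\<^sub>R ((z n - 1) /\<^sub>R HX (1 / a n))) \<longlonglongrightarrow> 1 *\<^sub>R - complex_of_real (u\<^sup>2 / 2 * (1 - \<mu>\<^sup>2))"
    unfolding z_def by (intro tendsto_scaleR H filterlim_compose[OF zeta_limit l])
  moreover have "\<forall>\<^sub>F n in sequentially. (real n * HX (1 / a n)) *\<^sub>R ((z n - 1) /\<^sub>R HX (1 / a n)) = real n *\<^sub>R (z n - 1)"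
    using filterlim_iff[THEN iffD1, OF l, rule_format, OF HX_pos] by eventually_elim simp
  ultimately have "(\<lambda>n. real n *\<^sub>R (z n - 1)) \<longlonglongrightarrow> 1 *\<^sub>R - complex_of_real (u\<^sup>2 / 2 * (1 - \<mu>\<^sup>2))"
    by (rule Lim_transform_eventually)
  then have zlim: "(\<lambda>n. z n ^ n) \<longlonglongrightarrow> complex_of_real (exp (- (u\<^sup>2 / 2 * (1 - \<mu>\<^sup>2))))"
    by (intro power_tendsto_exp z1 v) (simp only: scaleR_one)
  have "(\<lambda>n. phi n (int n) - z n ^ n) \<longlonglongrightarrow> 0"
  proof (rule tendstoI)
    fix e :: real assume e: "0 < e"
    have "0 < e / 2" using e by simp
    from filterlim_iff[THEN iffD1, OF l, rule_format, OF cf_recursion[OF this, of u]]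
    have rec: "\<forall>\<^sub>F n in sequentially. \<forall>t\<ge>1. cmod (phi n t - z n * phi n (t - 1)) \<le> e / 2 * HX (1 / a n)"
      by (simp only: phi_def z_def)
    have "\<forall>\<^sub>F n in sequentially. real n * HX (1 / a n) < 2"
      by (rule order_tendstoD(2)[OF H]) simp
    with rec z1 show "\<forall>\<^sub>F n in sequentially. dist (phi n (int n) - z n ^ n) 0 < e"
    proof eventually_elim
      case (elim n)
      have "cmod (phi n (int k) - z n ^ k) \<le> real k * (e / 2 * HX (1 / a n))" for k
      proof (induction k)
        case 0 then show ?case by (simp add: phi_def mart_def prob_space)
      next
        case (Suc k)
        have 1: "cmod (phi n (int (Suc k)) - z n * phi n (int k)) \<le> e / 2 * HX (1 / a n)"
          using elim(1)[rule_format, of "int (Suc k)"] by simp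
        have 2: "cmod (z n * (phi n (int k) - z n ^ k)) \<le> real k * (e / 2 * HX (1 / a n))"
          unfolding norm_mult
          by (rule order_trans[OF mult_left_le_one_le Suc]) (use elim in auto)
        have "phi n (int (Suc k)) - z n ^ Suc k
            = (phi n (int (Suc k)) - z n * phi n (int k)) + z n * (phi n (int k) - z n ^ k)"
          by (simp add: algebra_simps)
        then have "cmod (phi n (int (Suc k)) - z n ^ Suc k)
            \<le> cmod (phi n (int (Suc k)) - z n * phi n (int k)) + cmod (z n * (phi n (int k) - z n ^ k))"
          by (simp only: norm_triangle_ineq)
        also have "\<dots> \<le> real (Suc k) * (e / 2 * HX (1 / a n))"
          using add_mono[OF 1 2] by (simp add: distrib_right)
        finally show ?case .
      qed
      from this[of n] have "cmod (phi n (int n) - z n ^ n) \<le> e / 2 * (real n * HX (1 / a n))"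
        by (simp only: ac_simps)
      also have "\<dots> < e / 2 * 2" using elim e by (intro mult_strict_left_mono) auto
      finally show ?case by simp
    qed
  qed
  from tendsto_add[OF this zlim] show ?thesis by (simp add: phi_def)
qed

lemma mean_X: "m = \<mu>\<^sub>B / (1 - \<mu>)"
proof -
  have indY: "indep_var borel (A 0) borel (X (- 1))"
    by (rule indep_info[where K="{0}" and K'="{..- 1}"]) (auto intro: info_A X_info)
  have "m = (\<integral>w. A 0 w * X (- 1) w + B 0 w \<partial>M)"
    unfolding m_def using X_rec[of 0] by (intro integral_cong_AE) auto
  also have "\<dots> = (\<integral>w. A 0 w * X (- 1) w \<partial>M) + \<mu>\<^sub>B"
    unfolding \<mu>\<^sub>B_def
    by (intro Bochner_Integration.integral_add indep_var_integrable[OF indY] X_integrable) auto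
  also have "(\<integral>w. A 0 w * X (- 1) w \<partial>M) = \<mu> * m"
    using indep_var_lebesgue_integral[OF indY _ X_integrable] integral_X[of "\<lambda>x. x" "- 1"]
    by (simp add: \<mu>_def m_def)
  finally have eq: "m = \<mu> * m + \<mu>\<^sub>B" .
  have "m * (1 - \<mu>) = m - \<mu> * m" by (simp add: algebra_simps)
  then have "m * (1 - \<mu>) = \<mu>\<^sub>B" using eq by linarith
  then show ?thesis using \<mu>_less_1 by (simp add: eq_divide_eq)
qed

lemma mart_eq_partial_sum:
  "mart (int n) w = (1 - \<mu>) * (partial_sum X n w - real n * m) + \<mu> * (X (int n) w - X 0 w)"
proof (induction n)
  case 0 then show ?case by (simp add: mart_def partial_sum_def)
next
  case (Suc n)
  have b: "\<mu>\<^sub>B = (1 - \<mu>) * m" using mean_X \<mu>_less_1 by simp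
  have p: "partial_sum X (Suc n) w = partial_sum X n w + X (int (Suc n)) w"
    by (simp add: partial_sum_def)
  have "int (Suc n) - 1 = int n" "1 \<le> int (Suc n)" by simp_all
  then have "mart (int (Suc n)) w = mart (int n) w + (X (int (Suc n)) w - \<mu> * X (int n) w - \<mu>\<^sub>B)"
    using mart_step[of "int (Suc n)" w] by (simp only: D_def)
  also have "\<dots> = (1 - \<mu>) * (partial_sum X (Suc n) w - real (Suc n) * m) + \<mu> * (X (int (Suc n)) w - X 0 w)"
    unfolding Suc.IH p b by (simp add: algebra_simps)
  finally show ?case .
qed

lemma partial_sum_measurable [measurable]: "partial_sum X n \<in> borel_measurable M"
  unfolding partial_sum_def[abs_def] by measurable

text \<open>
  The boundary term \<open>\<mu> (X n - X 0) / a\<^sub>n\<close> vanishes in mean, and \<open>(1 - \<mu>\<^sup>2) / (1 - \<mu>)\<^sup>2 = (1 + \<mu>) / (1 - \<mu>)\<close>.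
\<close>

lemma cf_partial_sum_limit:
  assumes a: "\<forall>\<^sub>F n in sequentially. 0 < a n \<and> real n * (\<integral>w. (min 1 (X 0 w / a n))\<^sup>2 \<partial>M) = 1"
  shows "(\<lambda>n. \<integral>w. iexp (t * ((partial_sum X n w - real n * m) / a n)) \<partial>M)
    \<longlonglongrightarrow> complex_of_real (exp (- ((sqrt ((1 + \<mu>) / (1 - \<mu>)) * t)\<^sup>2) / 2))"
proof -
  define u where "u = t / (1 - \<mu>)"
  have \<mu>1: "0 < 1 - \<mu>" using \<mu>_less_1 by simp
  let ?S = "\<lambda>n w. (partial_sum X n w - real n * m) / a n"
  let ?d = "\<lambda>n. (\<integral>w. iexp (t * ?S n w) \<partial>M) - (\<integral>w. iexp (u * (1 / a n) * mart (int n) w) \<partial>M)"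
  have "?d \<longlonglongrightarrow> 0"
  proof (rule Lim_null_comparison)
    have l0: "(\<lambda>n. 1 / a n) \<longlonglongrightarrow> 0"
      using normalizing_sequence_limits(1)[OF a] by (simp add: filterlim_at)
    show "(\<lambda>n. \<bar>u\<bar> * \<mu> * (2 * m) * (1 / a n)) \<longlonglongrightarrow> 0"
      by (rule tendsto_mult_right_zero[OF l0])
    show "\<forall>\<^sub>F n in sequentially. norm (?d n) \<le> \<bar>u\<bar> * \<mu> * (2 * m) * (1 / a n)"
      using a
    proof eventually_elim
      case (elim n)
      let ?x = "\<lambda>w. t * ?S n w" and ?y = "\<lambda>w. u * (1 / a n) * mart (int n) w"
      have ix: "integrable M (\<lambda>w. iexp (?x w))" by (rule integrable_iexp_real) measurable
      have iy: "integrable M (\<lambda>w. iexp (?y w))" by (rule integrable_iexp_real) measurable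
      have iz: "integrable M (\<lambda>w. \<bar>u\<bar> * \<mu> * (1 / a n) * (X (int n) w + X 0 w))"
        by (intro integrable_mult_right Bochner_Integration.integrable_add X_integrable)
      have le: "cmod (iexp (?x w) - iexp (?y w)) \<le> \<bar>u\<bar> * \<mu> * (1 / a n) * (X (int n) w + X 0 w)" for w
      proof -
        have t: "t = u * (1 - \<mu>)" using \<mu>1 by (simp add: u_def)
        have "?y w = ?x w + u * (1 / a n) * (\<mu> * (X (int n) w - X 0 w))"
          unfolding mart_eq_partial_sum t by (simp add: divide_inverse algebra_simps)
        then have xy: "?x w - ?y w = - (u * (1 / a n) * (\<mu> * (X (int n) w - X 0 w)))" by linarith
        have "cmod (iexp (?x w) - iexp (?y w)) \<le> \<bar>?x w - ?y w\<bar>" by (rule iexp_lipschitz)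
        also have "\<dots> = \<bar>u\<bar> * \<mu> * (1 / a n) * \<bar>X (int n) w - X 0 w\<bar>"
          unfolding xy using elim \<mu>_nonneg by (simp add: abs_mult)
        also have "\<dots> \<le> \<bar>u\<bar> * \<mu> * (1 / a n) * (X (int n) w + X 0 w)"
          using elim \<mu>_nonneg X_nonneg[of 0 w] X_nonneg[of "int n" w] by (intro mult_left_mono) auto
        finally show ?thesis .
      qed
      have "norm (?d n) = cmod (\<integral>w. iexp (?x w) - iexp (?y w) \<partial>M)"
        by (subst Bochner_Integration.integral_diff[OF ix iy]) (rule refl)
      also have "\<dots> \<le> (\<integral>w. cmod (iexp (?x w) - iexp (?y w)) \<partial>M)" by (rule integral_norm_bound)
      also have "\<dots> \<le> (\<integral>w. \<bar>u\<bar> * \<mu> * (1 / a n) * (X (int n) w + X 0 w) \<partial>M)"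
        by (rule integral_mono[OF integrable_norm[OF Bochner_Integration.integrable_diff[OF ix iy]] iz le])
      also have "\<dots> = \<bar>u\<bar> * \<mu> * (1 / a n) * ((\<integral>w. X (int n) w \<partial>M) + (\<integral>w. X 0 w \<partial>M))"
        by (simp only: integral_mult_right_zero Bochner_Integration.integral_add[OF X_integrable X_integrable])
      also have "\<dots> = \<bar>u\<bar> * \<mu> * (2 * m) * (1 / a n)"
        using integral_X[of "\<lambda>x. x" "int n"] by (simp add: m_def)
      finally show ?case .
    qed
  qed
  from tendsto_add[OF this cf_mart_limit[OF a, of u]]
  have "(\<lambda>n. \<integral>w. iexp (t * ?S n w) \<partial>M) \<longlonglongrightarrow> complex_of_real (exp (- (u\<^sup>2 / 2 * (1 - \<mu>\<^sup>2))))"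
    by simp
  moreover have "u\<^sup>2 / 2 * (1 - \<mu>\<^sup>2) = (sqrt ((1 + \<mu>) / (1 - \<mu>)) * t)\<^sup>2 / 2"
  proof -
    have "0 \<le> (1 + \<mu>) / (1 - \<mu>)" using \<mu>1 \<mu>_nonneg by simp
    then have "(sqrt ((1 + \<mu>) / (1 - \<mu>)) * t)\<^sup>2 = (1 + \<mu>) / (1 - \<mu>) * t\<^sup>2"
      by (simp add: power_mult_distrib)
    also have "\<dots> = u\<^sup>2 * ((1 - \<mu>) * (1 + \<mu>))"
    proof -
      have "b / d * t\<^sup>2 = (t / d)\<^sup>2 * (d * b)" if "0 < d" for b d :: real
        using that by (simp add: power_divide power2_eq_square)
      from this[OF \<mu>1] show ?thesis by (simp only: u_def)
    qed
    also have "(1 - \<mu>) * (1 + \<mu>) = 1 - \<mu>\<^sup>2" by (simp add: power2_eq_square algebra_simps)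
    finally show ?thesis by simp
  qed
  ultimately show ?thesis by simp
qed

theorem partial_sum_clt:
  assumes a: "\<forall>\<^sub>F n in sequentially. 0 < a n \<and> real n * (\<integral>w. (min 1 (X 0 w / a n))\<^sup>2 \<partial>M) = 1"
  shows "weak_conv_m (\<lambda>n. distr M borel (\<lambda>w. (partial_sum X n w - real n * m) / a n))
    (density lborel (normal_density 0 (sqrt ((1 + \<mu>) / (1 - \<mu>)))))"
proof (rule levy_continuity)
  have s: "0 < sqrt ((1 + \<mu>) / (1 - \<mu>))" using \<mu>_less_1 \<mu>_nonneg by simp
  show "real_distribution (distr M borel (\<lambda>w. (partial_sum X n w - real n * m) / a n))" for n
    by (rule real_distribution_distr) measurable
  show "real_distribution (density lborel (normal_density 0 (sqrt ((1 + \<mu>) / (1 - \<mu>)))))"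
    by (rule char_centered_normal[OF s])
  fix t
  have "char (distr M borel (\<lambda>w. (partial_sum X n w - real n * m) / a n)) t
      = (\<integral>w. iexp (t * ((partial_sum X n w - real n * m) / a n)) \<partial>M)" for n
    unfolding char_def by (rule integral_distr) measurable
  then show "(\<lambda>n. char (distr M borel (\<lambda>w. (partial_sum X n w - real n * m) / a n)) t)
      \<longlonglongrightarrow> char (density lborel (normal_density 0 (sqrt ((1 + \<mu>) / (1 - \<mu>))))) t"
    unfolding char_centered_normal(2)[OF s] using cf_partial_sum_limit[OF a, of t] by (simp only:)
qed

end

theorem proposition3p18:
  fixes M :: "'a measure"
    and A B X :: "int \<Rightarrow> 'a \<Rightarrow> real"
    and a :: "nat \<Rightarrow> real"
    and r :: "nat \<Rightarrow> nat"
    and \<beta> \<delta> :: real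
  assumes "prob_space M"
    and nonneg: "\<And>t \<omega>. \<omega> \<in> space M \<Longrightarrow> 0 \<le> A t \<omega> \<and> 0 \<le> B t \<omega>"
    and iid_indep: "prob_space.indep_vars M (\<lambda>_. borel \<Otimes>\<^sub>M borel) (\<lambda>t \<omega>. (A t \<omega>, B t \<omega>)) UNIV"
    and iid_distr: "\<And>t. distr M (borel \<Otimes>\<^sub>M borel) (\<lambda>\<omega>. (A t \<omega>, B t \<omega>)) =
                         distr M (borel \<Otimes>\<^sub>M borel) (\<lambda>\<omega>. (A 0 \<omega>, B 0 \<omega>))"
    and A_B_indep: "prob_space.indep_var M
                      (Pi\<^sub>M UNIV (\<lambda>_::int. borel)) (\<lambda>\<omega> t. A t \<omega>)
                      (Pi\<^sub>M UNIV (\<lambda>_::int. borel)) (\<lambda>\<omega> t. B t \<omega>)"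
    and B_rv: "regularly_varying M (B 0) 2"
    and B_var: "(\<integral>\<^sup>+\<omega>. ennreal ((B 0 \<omega> - integral\<^sup>L M (B 0))\<^sup>2) \<partial>M) = \<infinity>"
    and A2: "integrable M (\<lambda>\<omega>. A 0 \<omega> ^ 2)" "(\<integral>\<omega>. A 0 \<omega> ^ 2 \<partial>M) < 1"
    and A4: "integrable M (\<lambda>\<omega>. A 0 \<omega> ^ 4)"
    and \<beta>: "\<beta> > 2"
    and A_\<beta>: "integrable M (\<lambda>\<omega>. A 0 \<omega> powr \<beta>)" "(\<integral>\<omega>. A 0 \<omega> powr \<beta> \<partial>M) = 1"
    and A_\<beta>_log: "integrable M (\<lambda>\<omega>. if A 0 \<omega> = 0 then 0 else A 0 \<omega> powr \<beta> * ln (A 0 \<omega>))"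
    and A_nonarith: "non_arithmetic
                       (distr (uniform_measure M {\<omega> \<in> space M. A 0 \<omega> > 0}) borel (\<lambda>\<omega>. ln (A 0 \<omega>)))"
    and X: "stationary_solution M A B X"
    and a: "normalizing_sequence M (X 0) a"
    and mixing: "strongly_mixing_geometric M X"
    and r: "filterlim r at_top sequentially" "(\<lambda>n. real (r n) / real n) \<longlonglongrightarrow> 0"
    and block_mixing:
      "\<And>u::real. (\<lambda>n.
          (\<integral>\<omega>. exp (\<i> * complex_of_real (u * ((partial_sum X n \<omega> - centering M X n) / a n))) \<partial>M) -
          (\<integral>\<omega>. exp (\<i> * complex_of_real (u * ((partial_sum X (r n) \<omega> - centering M X (r n)) / a n))) \<partial>M)
            ^ (n div r n)) \<longlonglongrightarrow> 0"
    and \<delta>: "0 < \<delta>" "\<delta> < 1"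
    and r_\<delta>: "(\<lambda>n. real n / (a n)\<^sup>2 * real (r n) powr \<delta>) \<longlonglongrightarrow> 0"
  shows "integral\<^sup>L M (X 0) = integral\<^sup>L M (B 0) / (1 - integral\<^sup>L M (A 0)) \<and>
    weak_conv_m
      (\<lambda>n. distr M borel (\<lambda>\<omega>. (partial_sum X n \<omega> - centering M X n) / a n))
      (density lborel
        (normal_density 0 (sqrt ((1 + integral\<^sup>L M (A 0)) / (1 - integral\<^sup>L M (A 0))))))"
proof -
  interpret prob_space M by fact
  have AB [measurable]: "(\<lambda>\<omega>. (A t \<omega>, B t \<omega>)) \<in> measurable M (borel \<Otimes>\<^sub>M borel)" for t
    using iid_indep unfolding indep_vars_def by auto
  have B_meas [measurable]: "B t \<in> borel_measurable M" for t
    using measurable_compose[OF AB measurable_snd] by simp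
  have B_domain: "gaussian_domain M (B 0)"
    using nonneg B_rv by (intro gaussian_domain_of_regularly_varying) auto
  then have B_int: "integrable M (B 0)" by (simp add: gaussian_domain_def)
  have B_square: "\<not> integrable M (\<lambda>\<omega>. (B 0 \<omega>)\<^sup>2)"
  proof
    assume "integrable M (\<lambda>\<omega>. (B 0 \<omega>)\<^sup>2)"
    with B_int have "integrable M (\<lambda>\<omega>. (B 0 \<omega> - integral\<^sup>L M (B 0))\<^sup>2)"
      by (simp add: power2_diff)
    then have "(\<integral>\<^sup>+\<omega>. ennreal ((B 0 \<omega> - integral\<^sup>L M (B 0))\<^sup>2) \<partial>M) < \<infinity>"
      by (subst nn_integral_eq_integral) auto
    with B_var show False by simp
  qed
  interpret affine_recursion M A B
  proof
    show "indep_var borel (A t) borel (B t)" for t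
      using indep_var_compose[OF A_B_indep measurable_component_singleton[of t] measurable_component_singleton[of t]]
      by (simp add: comp_def)
  qed (use nonneg iid_indep iid_distr A2 B_int in auto)
  have X_meas [measurable]: "X t \<in> borel_measurable M" for t
    using X by (auto simp: stationary_solution_def strictly_stationary_def)
  have X_distr: "distr M borel (X t) = distr M borel (X 0)" for t
  proof -
    let ?P = "Pi\<^sub>M UNIV (\<lambda>_::int. borel :: real measure)"
    have m: "(\<lambda>\<omega> s. X (s + h) \<omega>) \<in> measurable M ?P" for h
      by (rule measurable_PiM_single') auto
    have "distr M ?P (\<lambda>\<omega> s. X (s + t) \<omega>) = distr M ?P (\<lambda>\<omega> s. X s \<omega>)"
      using X by (auto simp: stationary_solution_def strictly_stationary_def)
    then have "distr (distr M ?P (\<lambda>\<omega> s. X (s + t) \<omega>)) borel (\<lambda>f. f 0)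
        = distr (distr M ?P (\<lambda>\<omega> s. X s \<omega>)) borel (\<lambda>f. f 0)" by simp
    then show ?thesis
      using m[of t] m[of 0] by (simp add: distr_distr comp_def)
  qed
  have X_eq: "AE \<omega> in M. X t \<omega> = perpetuity t \<omega>" for t
    using X by (intro stationary_solution_eq_perpetuity X_meas X_distr) (auto simp: stationary_solution_def)
  interpret stationary_recursion M A B perpetuity
  proof
    show "distr M borel (perpetuity t) = distr M borel (perpetuity 0)" for t
    proof -
      have "distr M borel (perpetuity s) = distr M borel (X s)" for s
        using X_eq[of s] by (intro distr_cong_AE) auto
      then show ?thesis using X_distr[of t] by simp
    qed
  qed (use perpetuity_info perpetuity_nonneg perpetuity_integrable perpetuity_recursion B_domain B_square in auto)
  have EX: "integral\<^sup>L M (X 0) = m"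
    unfolding m_def using X_eq[of 0] by (intro integral_cong_AE) auto
  have norm: "\<forall>\<^sub>F n in sequentially. 0 < a n \<and> real n * (\<integral>\<omega>. (min 1 (perpetuity 0 \<omega> / a n))\<^sup>2 \<partial>M) = 1"
    using a unfolding normalizing_sequence_def
  proof eventually_elim
    case (elim n)
    then have an: "0 < a n" by simp
    have "(\<integral>\<omega>. (min 1 (perpetuity 0 \<omega> / a n))\<^sup>2 \<partial>M) = (\<integral>\<omega>. (min 1 (\<bar>X 0 \<omega>\<bar> / a n))\<^sup>2 \<partial>M)"
      using X_eq[of 0] by (intro integral_cong_AE) (auto simp: perpetuity_nonneg)
    with elim show ?case
      unfolding normalizing_expression_eq[OF X_meas an, symmetric] by (simp add: algebra_simps)
  qed
  have "distr M borel (\<lambda>\<omega>. (partial_sum X n \<omega> - centering M X n) / a n)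
      = distr M borel (\<lambda>\<omega>. (partial_sum perpetuity n \<omega> - real n * m) / a n)" for n
  proof (rule distr_cong_AE)
    have "AE \<omega> in M. \<forall>t\<in>{1..n}. X (int t) \<omega> = perpetuity (int t) \<omega>"
      using X_eq by (simp add: AE_ball_countable)
    then show "AE \<omega> in M. (partial_sum X n \<omega> - centering M X n) / a n
        = (partial_sum perpetuity n \<omega> - real n * m) / a n"
      by eventually_elim (simp add: partial_sum_def centering_def EX)
    show "(\<lambda>\<omega>. (partial_sum X n \<omega> - centering M X n) / a n) \<in> borel_measurable M"
      unfolding partial_sum_def by measurable
    show "(\<lambda>\<omega>. (partial_sum perpetuity n \<omega> - real n * m) / a n) \<in> borel_measurable M"
      by measurable
  qed (rule refl)+
  with partial_sum_clt[OF norm] mean_X show ?thesis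
    by (simp add: EX \<mu>_def \<mu>\<^sub>B_def)
qed

end
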